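(* Let $\varrho_1,\varrho_2$ be proximate orders with orders $\rho_1,\rho_2>0$ such that $r^{\varrho_1(r)}=O(r^{\varrho_2(r)})$ as $r\to\infty$. Let $\hat\varrho_1$ be a normalized proximate order with $\hat\varrho_1(r)=\varrho_1(r)$ for all sufficiently large $r$. Then: (a) If $\{u_\ell\}_{\ell\in\mathbb{N}_0}\subseteq\mathcal{SM}_L(\mathbb{R}^{n+1})$ satisfies $$\forall\sigma>0\ \exists\varepsilon,C>0\ \forall\ell\in\mathbb{N}_0:\quad \|u_\ell\|_{\varrho_2,\sigma}\le C\frac{G_{\hat\varrho_1,\ell}}{\ell!}\varepsilon^\ell,$$ then for every $f\in A_{\varrho_1,+0}$ the series $Tf:=\sum_{\ell=0}^\infty u_\ell\star_L\partial_{x_0}^\ell f$ converges in $A_{\varrho_2,+0}$, and $T:A_{\varrho_1,+0}\to A_{\varrho_2,+0}$ is continuous. (b) Conversely, every continuous right $\mathbb{R}_n$-linear operator $T:A_{\varrho_1,+0}\to A_{\varrho_2,+0}$ is of the form $Tf=\sum_{\ell=0}^\infty u_\ell\star_L\partial_{x_0}^\ell f$ for some sequence $\{u_\ell\}$ satisfying the condition in (a).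
   Context: $\mathbb{R}_n$ is the real Clifford algebra generated by $e_1,\dots,e_n$ with $e_ie_j=-e_je_i$ ($i\neq j$), $e_i^2=-1$, with Euclidean norm $|a|^2=\sum_Aa_A^2$ for $a=\sum_Aa_Ae_A$. Paravectors $x=x_0+\sum_{\ell=1}^nx_\ell e_\ell$ are identified with $\mathbb{R}^{n+1}$, and $\mathbb{S}=\{\sum x_\ell e_\ell:\sum x_\ell^2=1\}$. $f:\mathbb{R}^{n+1}\to\mathbb{R}_n$ is (entire) left slice monogenic, $f\in\mathcal{SM}_L(\mathbb{R}^{n+1})$, if $f(u+jv)=f_0(u,v)+jf_1(u,v)$ for all $u,v\in\mathbb{R}$, $j\in\mathbb{S}$, with $f_0,f_1$ continuously differentiable, $f_0(u,-v)=f_0(u,v)$, $f_1(u,-v)=-f_1(u,v)$, $\partial_uf_0=\partial_vf_1$, $\partial_vf_0=-\partial_uf_1$. Star product: $f\star_Lg=f_0g_0-f_1g_1+j(f_1g_0+f_0g_1)$. $\partial_{x_0}$ is the partial derivative in $x_0$. A proximate order is a differentiable $\varrho:[0,\infty)\to[0,\infty)$ with $\lim_{r\to\infty}\varrho(r)=\rho>0$ and $\lim_{r\to\infty}\varrho'(r)r\ln r=0$; it is normalized if $r\mapsto r^{\varrho(r)}$ is strictly increasing on $(0,\infty)$ and tends to $0$ as $r\to0^+$; then $\varphi$ is the inverse of $r\mapsto r^{\varrho(r)}$ and $G_{\varrho,0}=1$, $G_{\varrho,\ell}=\varphi(\ell)^\ell/(e\rho)^{\ell/\rho}$. For $\sigma>0$,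 $A_{\varrho,\sigma}=\{f\in\mathcal{SM}_L(\mathbb{R}^{n+1}):\|f\|_{\varrho,\sigma}:=\sup_x|f(x)|e^{-\sigma|x|^{\varrho(|x|)}}<\infty\}$. $A_{\varrho,+0}=\bigcap_{\epsilon>0}A_{\varrho,\epsilon}$ with the projective limit topology given by all norms $\|\cdot\|_{\varrho,\epsilon}$, $\epsilon>0$. *)

theory Defs
  imports "HOL-Analysis.Analysis" "HOL-Library.Landau_Symbols"
begin

text \<open>Clifford algebra R_n: generators indexed by a finite linearly ordered type 'n
  (so n = CARD('n)); an element a = sum_A a_A e_A is a vector indexed by subsets A of 'n.
  The Euclidean norm of real^('n set) is exactly |a| = sqrt(sum_A a_A^2).
  Paravectors x = x0 + sum x_l e_l are points of real \<times> real^'n (= R^(n+1)).\<close>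

type_synonym 'n clif = "real ^ ('n set)"
type_synonym 'n pt = "real \<times> (real ^ 'n)"

text \<open>Sign of e_A e_B = sign * e_(A symmetric-difference B), from e_i e_j = - e_j e_i, e_i^2 = -1.\<close>
definition csign :: "'n::{finite,linorder} set \<Rightarrow> 'n set \<Rightarrow> real" where
  "csign A B = (-1) ^ (card {(a, b). a \<in> A \<and> b \<in> B \<and> b < a} + card (A \<inter> B))"

definition cmult :: "'n::{finite,linorder} clif \<Rightarrow> 'n clif \<Rightarrow> 'n clif" where
  "cmult a b = (\<chi> C. \<Sum>A\<in>UNIV. \<Sum>B\<in>UNIV.
      if (A - B) \<union> (B - A) = C then csign A B * (a $ A) * (b $ B) else 0)"

definition emb :: "real ^ ('n::{finite,linorder}) \<Rightarrow> 'n clif" where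
  "emb j = (\<chi> A. if is_singleton A then j $ the_elem A else 0)"

definition slice_decomp ::
  "('n::{finite,linorder} pt \<Rightarrow> 'n clif) \<Rightarrow> (real \<times> real \<Rightarrow> 'n clif) \<Rightarrow> (real \<times> real \<Rightarrow> 'n clif) \<Rightarrow> bool" where
  "slice_decomp f f0 f1 \<longleftrightarrow>
     (\<forall>u v. f0 (u, -v) = f0 (u, v) \<and> f1 (u, -v) = - f1 (u, v)) \<and>
     (\<forall>u v j. norm j = 1 \<longrightarrow> f (u, v *\<^sub>R j) = f0 (u, v) + cmult (emb j) (f1 (u, v)))"

definition slice_monogenic :: "('n::{finite,linorder} pt \<Rightarrow> 'n clif) \<Rightarrow> bool" where
  "slice_monogenic f \<longleftrightarrow>
    (\<exists>f0 f1 (D0 :: real \<times> real \<Rightarrow> (real \<times> real) \<Rightarrow>\<^sub>L 'n clif) (D1 :: real \<times> real \<Rightarrow> (real \<times> real) \<Rightarrow>\<^sub>L 'n clif).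
       slice_decomp f f0 f1 \<and>
       (\<forall>p. (f0 has_derivative blinfun_apply (D0 p)) (at p)) \<and>
       (\<forall>p. (f1 has_derivative blinfun_apply (D1 p)) (at p)) \<and>
       continuous_on UNIV D0 \<and> continuous_on UNIV D1 \<and>
       (\<forall>p. blinfun_apply (D0 p) (1, 0) = blinfun_apply (D1 p) (0, 1) \<and>
            blinfun_apply (D0 p) (0, 1) = - blinfun_apply (D1 p) (1, 0)))"

definition star_L :: "('n::{finite,linorder} pt \<Rightarrow> 'n clif) \<Rightarrow> ('n pt \<Rightarrow> 'n clif) \<Rightarrow> 'n pt \<Rightarrow> 'n clif" where
  "star_L f g x = (SOME y. \<exists>f0 f1 g0 g1 u v j.
      slice_decomp f f0 f1 \<and> slice_decomp g g0 g1 \<and> norm j = 1 \<and> x = (u, v *\<^sub>R j) \<and>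
      y = cmult (f0 (u, v)) (g0 (u, v)) - cmult (f1 (u, v)) (g1 (u, v))
          + cmult (emb j) (cmult (f1 (u, v)) (g0 (u, v)) + cmult (f0 (u, v)) (g1 (u, v))))"

definition dx0 :: "('n::{finite,linorder} pt \<Rightarrow> 'n clif) \<Rightarrow> 'n pt \<Rightarrow> 'n clif" where
  "dx0 f x = vector_derivative (\<lambda>t. f (t, snd x)) (at (fst x))"

definition proximate_order :: "(real \<Rightarrow> real) \<Rightarrow> real \<Rightarrow> bool" where
  "proximate_order \<rho>' \<rho> \<longleftrightarrow>
     (\<forall>r\<ge>0. \<rho>' r \<ge> 0) \<and> (\<forall>r\<ge>0. \<rho>' differentiable (at r within {0..})) \<and>
     \<rho> > 0 \<and> (\<rho>' \<longlongrightarrow> \<rho>) at_top \<and>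
     ((\<lambda>r. deriv \<rho>' r * r * ln r) \<longlongrightarrow> 0) at_top"

definition normalized_proximate_order :: "(real \<Rightarrow> real) \<Rightarrow> real \<Rightarrow> bool" where
  "normalized_proximate_order \<rho>' \<rho> \<longleftrightarrow> proximate_order \<rho>' \<rho> \<and>
     strict_mono_on {0<..} (\<lambda>r. r powr \<rho>' r) \<and>
     ((\<lambda>r. r powr \<rho>' r) \<longlongrightarrow> 0) (at_right 0)"

definition prox_inv :: "(real \<Rightarrow> real) \<Rightarrow> real \<Rightarrow> real" where
  "prox_inv \<rho>' s = (THE r. r > 0 \<and> r powr \<rho>' r = s)"

definition Gseq :: "(real \<Rightarrow> real) \<Rightarrow> real \<Rightarrow> nat \<Rightarrow> real" where
  "Gseq \<rho>' \<rho> l = (if l = 0 then 1 else prox_inv \<rho>' (real l) ^ l / (exp 1 * \<rho>) powr (real l / \<rho>))"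

definition weight_fun :: "(real \<Rightarrow> real) \<Rightarrow> real \<Rightarrow> ('n::{finite,linorder} pt \<Rightarrow> 'n clif) \<Rightarrow> 'n pt \<Rightarrow> real" where
  "weight_fun \<rho>' \<sigma> f x = norm (f x) * exp (- \<sigma> * norm x powr \<rho>' (norm x))"

definition wnorm :: "(real \<Rightarrow> real) \<Rightarrow> real \<Rightarrow> ('n::{finite,linorder} pt \<Rightarrow> 'n clif) \<Rightarrow> real" where
  "wnorm \<rho>' \<sigma> f = (SUP x. weight_fun \<rho>' \<sigma> f x)"

definition A_space :: "(real \<Rightarrow> real) \<Rightarrow> real \<Rightarrow> ('n::{finite,linorder} pt \<Rightarrow> 'n clif) set" where
  "A_space \<rho>' \<sigma> = {f. slice_monogenic f \<and> bdd_above (range (weight_fun \<rho>' \<sigma> f))}"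

definition A_plus0 :: "(real \<Rightarrow> real) \<Rightarrow> ('n::{finite,linorder} pt \<Rightarrow> 'n clif) set" where
  "A_plus0 \<rho>' = {f. \<forall>\<epsilon>>0. f \<in> A_space \<rho>' \<epsilon>}"

text \<open>Projective limit topology on A_{rho',+0}: the initial topology of all norms ||.||_{rho',eps}.\<close>
definition A_top :: "(real \<Rightarrow> real) \<Rightarrow> ('n::{finite,linorder} pt \<Rightarrow> 'n clif) topology" where
  "A_top \<rho>' = topology (\<lambda>U. U \<subseteq> A_plus0 \<rho>' \<and>
     (\<forall>f\<in>U. \<exists>E r. finite E \<and> (\<forall>e\<in>E. e > 0) \<and> r > 0 \<and>
        {g \<in> A_plus0 \<rho>'. \<forall>e\<in>E. wnorm \<rho>' e (\<lambda>x. g x - f x) < r} \<subseteq> U))"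

definition right_linear_on ::
  "('n::{finite,linorder} pt \<Rightarrow> 'n clif) set \<Rightarrow> (('n pt \<Rightarrow> 'n clif) \<Rightarrow> ('n pt \<Rightarrow> 'n clif)) \<Rightarrow> bool" where
  "right_linear_on S T \<longleftrightarrow> (\<forall>f\<in>S. \<forall>g\<in>S. \<forall>a b.
      T (\<lambda>x. cmult (f x) a + cmult (g x) b) = (\<lambda>x. cmult (T f x) a + cmult (T g x) b))"

definition partial_series ::
  "(nat \<Rightarrow> 'n::{finite,linorder} pt \<Rightarrow> 'n clif) \<Rightarrow> ('n pt \<Rightarrow> 'n clif) \<Rightarrow> nat \<Rightarrow> 'n pt \<Rightarrow> 'n clif" where
  "partial_series u f N = (\<lambda>x. \<Sum>l<N. star_L (u l) ((dx0 ^^ l) f) x)"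

definition coeff_cond ::
  "(real \<Rightarrow> real) \<Rightarrow> (real \<Rightarrow> real) \<Rightarrow> real \<Rightarrow> (nat \<Rightarrow> 'n::{finite,linorder} pt \<Rightarrow> 'n clif) \<Rightarrow> bool" where
  "coeff_cond \<rho>2 \<rho>h1 \<rho>1 u \<longleftrightarrow> (\<forall>\<sigma>>0. \<exists>\<epsilon>>0. \<exists>C>0. \<forall>l.
      u l \<in> A_space \<rho>2 \<sigma> \<and> wnorm \<rho>2 \<sigma> (u l) \<le> C * Gseq \<rho>h1 \<rho>1 l / fact l * \<epsilon> ^ l)"

end

theory Submission
  imports Defs "HOL-Complex_Analysis.Complex_Analysis"
begin

text \<open>A slice monogenic function \<open>f = f0 + j f1\<close> is the same as its stem \<open>F = f0 + i f1\<close>, a family of \<open>2^n\<close>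
  entire functions compatible with conjugation. In this picture \<open>\<star>\<close> is the pointwise product in the
  complexified Clifford algebra, \<open>\<partial>_{x0}\<close> is the complex derivative, and the weighted norms agree up to a
  constant, so everything becomes a statement about entire functions of one variable.

  For (a), Cauchy's estimate on a circle of radius proportional to \<open>\<phi>(l)\<close> gives
  \<open>\<bar>F^(l)(z)\<bar> \<le> C l! (\<delta> / \<phi>(l))^l \<bar>\<bar>F\<bar>\<bar> exp(\<sigma> M1(\<bar>z\<bar>))\<close> with \<open>\<delta>\<close> and \<open>\<sigma>\<close> as small as desired, which beats the growth
  of \<open>u_l\<close> and makes the series geometric.

  For (b), \<open>T(x^m) = \<Sum>_{l\<le>m} u_l \<star> \<partial>^l x^m\<close> is solved by binomial inversion:
  \<open>l! u_l = \<Sum>_{k\<le>l} (l choose k) (-x)^(l-k) \<star> T(x^k)\<close>. Since \<open>\<bar>x\<bar>^m \<le> (C \<phi>(m))^m exp(\<sigma> M1(\<bar>x\<bar>))\<close> and \<open>\<phi>\<close> is increasing,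
  the continuity of \<open>T\<close> yields the bound on \<open>u_l\<close>. Both sides are continuous, right linear and agree on powers,
  and Taylor polynomials are dense.\<close>

section \<open>The Clifford product\<close>

text \<open>The smallness of \<open>\<delta>\<close> in (a) comes from the order of choices. A
  member of the source space has finite norm for every exponent, so the Cauchy radius is first fixed
  as a large multiple of \<open>\<phi>(l)\<close>, and only then is the exponent taken so small that
  \<open>M1\<close> on that circle, at most a constant times \<open>1 + l\<close>, costs no more
  than a constant times \<open>e^l\<close>. The multiple absorbs that factor and leaves the ratio
  1/2 against any prescribed geometric growth of the coefficients. Two discrepancies stay harmless:
  \<open>(e \<rho>)^(l/\<rho>)\<close> in \<open>G\<close> is geometric in \<open>l\<close> and goes
  into \<open>\<epsilon>^l\<close>; and \<open>M1\<close>, which need not be monotone, stays within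
  an additive constant of its normalized counterpart. The O-hypothesis lets the weight in
  \<open>M1\<close> that derivatives or powers of \<open>x\<close> leave behind be charged to
  \<open>M2\<close>. In (b) noncommutativity does no harm: the stems of powers of \<open>x\<close>
  are scalar, hence central, so the inversion is an identity of complex numbers in each
  component.\<close>

lemma csign_eq_prod:
  fixes A B :: "'n::{finite,linorder} set"
  shows "csign A B = (\<Prod>a\<in>A. \<Prod>b\<in>B. if b \<le> a then -1 else 1)"
proof -
  have "(\<Prod>a\<in>A. \<Prod>b\<in>B. if b \<le> a then -1 else (1::real))
      = (\<Prod>p\<in>A \<times> B. if snd p \<le> fst p then -1 else 1)"
    by (simp add: prod.cartesian_product case_prod_beta)
  also have "\<dots> = (-1) ^ card {p \<in> A \<times> B. snd p \<le> fst p}"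
    by (subst prod.If_cases) (auto simp: Int_def conj_commute)
  \<comment> \<open>Pairs with \<open>b < a\<close> are the transpositions needed to sort the
    product, diagonal pairs are the squares \<open>e_a e_a = -1\<close>; together they are the pairs
    with \<open>b \<le> a\<close>.\<close>
  also have "{p \<in> A \<times> B. snd p \<le> fst p} =
      {(a, b). a \<in> A \<and> b \<in> B \<and> b < a} \<union> (\<lambda>a. (a, a)) ` (A \<inter> B)"
    by (auto simp: image_iff)
  also have "card \<dots> = card {(a, b). a \<in> A \<and> b \<in> B \<and> b < a} + card ((\<lambda>a. (a, a)) ` (A \<inter> B))"
    by (rule card_Un_disjoint) auto
  also have "card ((\<lambda>a. (a, a)) ` (A \<inter> B)) = card (A \<inter> B)"
    by (rule card_image) (auto simp: inj_on_def)
  finally show ?thesis by (simp add: csign_def)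
qed

text \<open>Elements of the intersection occur twice on the right and contribute
  \<open>h a * h a = 1\<close>. Applied to the product form of the sign, this makes
  \<open>csign\<close> multiplicative in each argument with respect to symmetric difference.\<close>

lemma prod_sym_diff:
  fixes h :: "'a \<Rightarrow> 'b::comm_ring_1"
  assumes "finite A" "finite B" "\<And>a. h a * h a = 1"
  shows "prod h (sym_diff A B) = prod h A * prod h B"
proof -
  have "prod h A * prod h B = (prod h (A - B) * prod h (A \<inter> B)) * (prod h (B - A) * prod h (A \<inter> B))"
    using assms(1,2)
    by (metis Int_commute prod.Int_Diff mult.commute)
  also have "\<dots> = prod h (A - B) * prod h (B - A) * (\<Prod>a\<in>A \<inter> B. h a * h a)"
    by (simp add: prod.distrib algebra_simps)
  also have "\<dots> = prod h (sym_diff A B)"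
    using assms by (subst prod.union_disjoint) auto
  finally show ?thesis by simp
qed

lemma csign_sq: "csign A B * csign A B = 1"
  by (simp add: csign_def flip: power_add)

lemma csign_sym_diff_left: "csign (sym_diff A B) C = csign A C * csign B C"
  unfolding csign_eq_prod by (rule prod_sym_diff) (auto simp flip: prod.distrib intro!: prod.neutral)

lemma csign_sym_diff_right: "csign C (sym_diff A B) = csign C A * csign C B"
proof -
  have "csign C (sym_diff A B) = (\<Prod>a\<in>C. (\<Prod>b\<in>A. if b \<le> a then -1 else 1) * (\<Prod>b\<in>B. if b \<le> a then -1 else 1))"
    unfolding csign_eq_prod by (intro prod.cong refl prod_sym_diff) auto
  then show ?thesis by (simp add: csign_eq_prod prod.distrib)
qed

lemma csign_empty [simp]: "csign {} B = 1" "csign A {} = 1"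
  by (simp_all add: csign_eq_prod)

text \<open>The Clifford product of coefficient families over an arbitrary commutative algebra; complex
  coefficients give the complexified Clifford algebra, in which stem functions take their values.\<close>

definition clprod :: "('n::{finite,linorder} set \<Rightarrow> 'a::{real_algebra_1,comm_ring_1}) \<Rightarrow> ('n set \<Rightarrow> 'a) \<Rightarrow> 'n set \<Rightarrow> 'a" where
  "clprod p q C = (\<Sum>A\<in>UNIV. \<Sum>B\<in>UNIV. if sym_diff A B = C then of_real (csign A B) * p A * q B else 0)"

lemma cmult_nth: "($) (cmult a b) = clprod (($) a) (($) b)"
  by (simp add: fun_eq_iff cmult_def clprod_def of_real_eq_id cong: if_cong)

lemma clprod_alt:
  fixes p q :: "'n::{finite,linorder} set \<Rightarrow> 'a::{real_algebra_1,comm_ring_1}"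
  shows "clprod p q C = (\<Sum>A\<in>UNIV. of_real (csign A (sym_diff A C)) * p A * q (sym_diff A C))"
proof -
  have eq: "sym_diff A B = C \<longleftrightarrow> sym_diff A C = B" for A B :: "'n set" by auto
  show ?thesis
    unfolding clprod_def eq by (simp add: sum.delta')
qed

text \<open>Substituting the symmetric difference with \<open>A\<close> for the middle index gives
  both bracketings the same triple products. The signs agree because a function multiplicative in
  both arguments is a 2-cocycle.\<close>

lemma clprod_assoc: "clprod (clprod p q) r = clprod p (clprod q r)"
  for p q r :: "'n::{finite,linorder} set \<Rightarrow> 'a::{real_algebra_1,comm_ring_1}"
proof
  fix D
  let ?s = csign
  have sgn: "?s C (sym_diff C D) * ?s A (sym_diff A C)
     = ?s A (sym_diff A D) * ?s (sym_diff A C) (sym_diff C D)" for A C :: "'n set"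
  proof -
    have 1: "sym_diff A D = sym_diff (sym_diff A C) (sym_diff C D)" by auto
    have 2: "?s A (sym_diff A D) = ?s A (sym_diff A C) * ?s A (sym_diff C D)"
      unfolding 1 by (rule csign_sym_diff_right)
    have 3: "?s (sym_diff A C) (sym_diff C D) = ?s A (sym_diff C D) * ?s C (sym_diff C D)"
      by (rule csign_sym_diff_left)
    \<comment> \<open>Here \<open>z\<close> is the sign of \<open>A\<close> against
      \<open>sym_diff C D\<close>; it arises once from each expansion and cancels.\<close>
    have "y * x = (x * z) * (z * y)" if "z * z = 1" for x y z :: real
      using that by (metis mult.assoc mult.commute mult_1)
    then show ?thesis unfolding 2 3 using csign_sq by blast
  qed
  have "clprod p (clprod q r) D = (\<Sum>A\<in>UNIV. \<Sum>B\<in>UNIV. of_real (?s A (sym_diff A D)) * p A *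
       (of_real (?s B (sym_diff B (sym_diff A D))) * q B * r (sym_diff B (sym_diff A D))))"
    by (simp add: clprod_alt sum_distrib_left)
  also have "\<dots> = (\<Sum>A\<in>UNIV. \<Sum>C\<in>UNIV. of_real (?s A (sym_diff A D)) * p A *
       (of_real (?s (sym_diff A C) (sym_diff C D)) * q (sym_diff A C) * r (sym_diff C D)))"
  proof (rule sum.cong[OF refl])
    fix A :: "'n set"
    have inv: "sym_diff A (sym_diff A C) = C" for C by auto
    have e: "sym_diff (sym_diff A C) (sym_diff A D) = sym_diff C D" for C by auto
    have "bij (sym_diff A)" by (rule o_bij[of "sym_diff A"]) (auto simp: fun_eq_iff)
    then show "(\<Sum>B\<in>UNIV. of_real (?s A (sym_diff A D)) * p A *
       (of_real (?s B (sym_diff B (sym_diff A D))) * q B * r (sym_diff B (sym_diff A D)))) =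
       (\<Sum>C\<in>UNIV. of_real (?s A (sym_diff A D)) * p A *
       (of_real (?s (sym_diff A C) (sym_diff C D)) * q (sym_diff A C) * r (sym_diff C D)))"
      by (subst sum.reindex_bij_betw[symmetric, of "sym_diff A" UNIV]) (simp_all only: e)
  qed
  also have "\<dots> = (\<Sum>A\<in>UNIV. \<Sum>C\<in>UNIV. of_real (?s A (sym_diff A D) * ?s (sym_diff A C) (sym_diff C D)) *
       (p A * q (sym_diff A C) * r (sym_diff C D)))"
    by (simp add: algebra_simps)
  also have "\<dots> = (\<Sum>C\<in>UNIV. \<Sum>A\<in>UNIV. of_real (?s C (sym_diff C D) * ?s A (sym_diff A C)) *
       (p A * q (sym_diff A C) * r (sym_diff C D)))"
    unfolding sgn by (rule sum.swap)
  also have "\<dots> = clprod (clprod p q) r D"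
    by (simp add: clprod_alt sum_distrib_left sum_distrib_right algebra_simps)
  finally show "clprod (clprod p q) r D = clprod p (clprod q r) D" by simp
qed

lemma cmult_assoc: "cmult (cmult a b) c = cmult a (cmult b c)"
proof -
  have "($) (cmult (cmult a b) c) = ($) (cmult a (cmult b c))"
    by (simp only: cmult_nth clprod_assoc)
  then show ?thesis by (simp add: vec_eq_iff)
qed

lemma bilinear_cmult: "bilinear cmult"
  unfolding bilinear_def
  by (intro conjI allI linearI)
     (simp_all add: vec_eq_iff cmult_def sum.distrib[symmetric] sum_distrib_left algebra_simps
        if_distrib[of "\<lambda>t. _ * t"] cong: if_cong, auto intro!: sum.cong)

lemma bounded_bilinear_cmult: "bounded_bilinear cmult"
  using bilinear_cmult by (simp add: bilinear_conv_bounded_bilinear)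

interpretation cmult: bounded_bilinear cmult
  by (rule bounded_bilinear_cmult)

section \<open>Unit element and squares of vectors\<close>

definition clif_one :: "'n::{finite,linorder} clif" where
  "clif_one = (\<chi> A. if A = {} then 1 else 0)"

lemma cmult_clif_one_right [simp]: "cmult a clif_one = a"
proof -
  have "cmult a clif_one $ C = a $ C" for C
  proof -
    have eq: "sym_diff A C = {} \<longleftrightarrow> A = C" for A by auto
    show ?thesis
      unfolding cmult_nth clprod_alt clif_one_def by (simp only: eq vec_lambda_beta) (simp add: if_distrib[of "\<lambda>t. _ * t"] sum.delta cong: if_cong)
  qed
  then show ?thesis by (simp add: vec_eq_iff)
qed

lemma cmult_clif_one_left [simp]: "cmult clif_one a = a"
proof -
  have "cmult clif_one a $ C = a $ C" for C
    by (simp add: cmult_nth clprod_alt clif_one_def if_distrib[of "\<lambda>t. _ * t"] if_distrib[of "\<lambda>t. t * _"] sum.delta cong: if_cong)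
  then show ?thesis by (simp add: vec_eq_iff)
qed

lemma sum_emb_sq: "(\<Sum>A\<in>UNIV. emb j $ A * emb j $ A) = (norm j)\<^sup>2"
proof -
  have "(\<Sum>A\<in>UNIV. emb j $ A * emb j $ A) = (\<Sum>A\<in>range (\<lambda>a. {a}). emb j $ A * emb j $ A)"
    by (rule sum.mono_neutral_right) (auto simp: emb_def is_singleton_def)
  also have "\<dots> = (\<Sum>a\<in>UNIV. (j $ a)\<^sup>2)"
    by (subst sum.reindex) (auto simp: inj_on_def emb_def power2_eq_square)
  also have "\<dots> = (norm j)\<^sup>2"
    by (simp add: norm_vec_def L2_set_def sum_nonneg)
  finally show ?thesis .
qed

text \<open>The product is added to itself with the factors exchanged: distinct generators then
  cancel by anticommutation, and each equal pair contributes -2 times the square of a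
  coordinate.\<close>

lemma cmult_emb_self: "cmult (emb j) (emb j) = - ((norm j)\<^sup>2 *\<^sub>R clif_one)"
proof -
  let ?e = "emb j"
  have "2 * cmult ?e ?e $ C = 2 * (- ((norm j)\<^sup>2 *\<^sub>R clif_one) $ C)" for C
  proof -
    have "cmult ?e ?e $ C = (\<Sum>A\<in>UNIV. \<Sum>B\<in>UNIV.
        if sym_diff A B = C then csign B A * (?e $ B) * (?e $ A) else 0)"
      unfolding cmult_def by (simp, subst sum.swap) (simp add: Un_commute)
    then have "2 * cmult ?e ?e $ C = (\<Sum>A\<in>UNIV. \<Sum>B\<in>UNIV.
        (if sym_diff A B = C then csign A B * (?e $ A) * (?e $ B) else 0) +
        (if sym_diff A B = C then csign B A * (?e $ B) * (?e $ A) else 0))"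
      by (simp add: cmult_def sum.distrib)
    also have "\<dots> = (\<Sum>A\<in>UNIV. \<Sum>B\<in>UNIV. if A = B then (if C = {} then -2 * (?e $ A * ?e $ A) else 0) else 0)"
    proof (intro sum.cong refl)
      fix A B :: "'a set"
      have "csign {a} {b} + csign {b} {a} = (if a = b then -2 else 0)" for a b :: 'a
        by (auto simp: csign_eq_prod)
      then have *: "csign {a} {b} * x + csign {b} {a} * x = (if a = b then -2 * x else 0)" for a b :: 'a and x :: real
        by (metis (full_types) mult_zero_left distrib_right)
      show "(if sym_diff A B = C then csign A B * (?e $ A) * (?e $ B) else 0) +
        (if sym_diff A B = C then csign B A * (?e $ B) * (?e $ A) else 0) =
        (if A = B then (if C = {} then -2 * (?e $ A * ?e $ A) else 0) else 0)"
      proof (cases "is_singleton A \<and> is_singleton B")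
        case True
        then obtain a b where ab: "A = {a}" "B = {b}" by (auto simp: is_singleton_def)
        show ?thesis
        proof (cases "a = b")
          case True
          then show ?thesis using *[of a a "?e $ A * ?e $ A"] unfolding ab by (auto simp: mult.assoc)
        next
          case False
          have swp: "x * y * z = x * (z * y)" for x y z :: real by simp
          have "csign {b} {a} * (?e $ {b}) * (?e $ {a}) = csign {b} {a} * (?e $ {a} * ?e $ {b})"
            by (rule swp)
          then show ?thesis using *[of a b "?e $ {a} * ?e $ {b}"] False unfolding ab
            by (simp only: mult.assoc) simp
        qed
      next
        case False
        then have "?e $ A = 0 \<or> ?e $ B = 0" by (auto simp: emb_def)
        then show ?thesis by auto
      qed
    qed
    also have "\<dots> = (if C = {} then -2 * (\<Sum>A\<in>UNIV. ?e $ A * ?e $ A) else 0)"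
      by (simp add: sum_distrib_left)
    finally show ?thesis by (simp add: sum_emb_sq clif_one_def)
  qed
  then have "2 *\<^sub>R cmult ?e ?e = 2 *\<^sub>R (- ((norm j)\<^sup>2 *\<^sub>R clif_one))"
    by (subst vec_eq_iff) (simp only: vector_scaleR_component vector_uminus_component real_scaleR_def simp_thms)
  then show ?thesis
    by (rule real_vector.scale_left_imp_eq[rotated]) simp
qed

lemma cmult_emb_emb: "norm j = 1 \<Longrightarrow> cmult (emb j) (cmult (emb j) a) = - a"
  by (simp add: cmult_emb_self cmult.minus_left flip: cmult_assoc)

lemma emb_minus: "emb (- j) = - emb j"
  by (simp add: vec_eq_iff emb_def)

lemma emb_0 [simp]: "emb 0 = 0"
  by (simp add: vec_eq_iff emb_def)

lemma norm_emb: "norm (emb j) = norm j"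
proof -
  have "(norm (emb j))\<^sup>2 = (norm j)\<^sup>2"
    unfolding sum_emb_sq[symmetric] by (simp add: norm_vec_def L2_set_def sum_nonneg power2_eq_square)
  then show ?thesis by simp
qed

section \<open>Stem functions\<close>

type_synonym 'n stem = "'n set \<Rightarrow> complex \<Rightarrow> complex"

text \<open>In terms of a slice decomposition \<open>f0\<close>, \<open>f1\<close> the stem is \<open>F A (u + iv) = f0(u,v)_A + i f1(u,v)_A\<close>.\<close>

definition stem :: "'n::{finite,linorder} stem \<Rightarrow> bool" where
  "stem F \<longleftrightarrow> (\<forall>A. F A holomorphic_on UNIV) \<and> (\<forall>A z. F A (cnj z) = cnj (F A z))"

definition reV :: "'n::{finite,linorder} stem \<Rightarrow> complex \<Rightarrow> 'n clif" where
  "reV F z = (\<chi> A. Re (F A z))"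

definition imV :: "'n::{finite,linorder} stem \<Rightarrow> complex \<Rightarrow> 'n clif" where
  "imV F z = (\<chi> A. Im (F A z))"

text \<open>On the real axis \<open>sgn (snd x)\<close> is 0 and the second summand disappears. This
  is the right value, since the imaginary part of a stem vanishes there
  (\<open>imV_real\<close>).\<close>

definition ind :: "'n::{finite,linorder} stem \<Rightarrow> 'n pt \<Rightarrow> 'n clif" where
  "ind F x = reV F (Complex (fst x) (norm (snd x)))
     + cmult (emb (sgn (snd x))) (imV F (Complex (fst x) (norm (snd x))))"

lemma stem_holo: "stem F \<Longrightarrow> F A holomorphic_on S"
  unfolding stem_def by (meson holomorphic_on_subset subset_UNIV)

lemma stem_cnj: "stem F \<Longrightarrow> F A (cnj z) = cnj (F A z)"
  by (simp add: stem_def)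

lemma Complex_uminus: "Complex u (- v) = cnj (Complex u v)"
  by (simp add: complex_eq_iff)

lemma reV_cnj: "stem F \<Longrightarrow> reV F (Complex u (-v)) = reV F (Complex u v)"
  by (simp add: reV_def Complex_uminus stem_cnj)

lemma imV_cnj: "stem F \<Longrightarrow> imV F (Complex u (-v)) = - imV F (Complex u v)"
  by (simp add: imV_def Complex_uminus stem_cnj vec_eq_iff)

lemma imV_real: "stem F \<Longrightarrow> imV F (Complex u 0) = 0"
  using imV_cnj[of F u 0] by (simp add: vec_eq_iff)

text \<open>\<open>ind\<close> only looks at the nonnegative radius. For \<open>v < 0\<close> both
  the unit vector and \<open>imV\<close> change sign, so their product is the same and the slice
  formula holds for every real \<open>v\<close>.\<close>

lemma ind_slice:
  assumes "stem F" "norm j = 1"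
  shows "ind F (u, v *\<^sub>R j) = reV F (Complex u v) + cmult (emb j) (imV F (Complex u v))"
proof -
  consider "v > 0" | "v = 0" | "v < 0" by linarith
  then show ?thesis
  proof cases
    case 1
    then show ?thesis using assms by (simp add: ind_def sgn_scaleR) (simp add: sgn_div_norm)
  next
    case 2
    then show ?thesis using assms by (simp add: ind_def imV_real cmult.zero_right)
  next
    case 3
    then show ?thesis using assms
      by (simp add: ind_def sgn_scaleR imV_cnj reV_cnj)
         (simp add: sgn_div_norm emb_minus cmult.minus_left cmult.minus_right)
  qed
qed

lemma slice_decomp_ind:
  assumes "stem F"
  shows "slice_decomp (ind F) (\<lambda>(u, v). reV F (Complex u v)) (\<lambda>(u, v). imV F (Complex u v))"
  using assms by (simp add: slice_decomp_def ind_slice reV_cnj imV_cnj)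

lemma ex_unit: "\<exists>j::real^'n::{finite,linorder}. norm j = 1"
  by (rule exI[of _ "axis undefined 1"]) simp

text \<open>Both components are recovered from the values of \<open>f\<close> at two conjugate
  points of one slice. Hence decompositions are unique, and bounds on \<open>f\<close> pass to its
  components.\<close>

lemma slice_decomp_halves:
  assumes "slice_decomp f f0 f1" "norm j = 1"
  shows "f0 (u, v) = (1/2) *\<^sub>R (f (u, v *\<^sub>R j) + f (u, (-v) *\<^sub>R j))"
    and "f1 (u, v) = - cmult (emb j) ((1/2) *\<^sub>R (f (u, v *\<^sub>R j) - f (u, (-v) *\<^sub>R j)))"
proof -
  have 1: "f (u, v *\<^sub>R j) = f0 (u, v) + cmult (emb j) (f1 (u, v))"
    and 2: "f (u, (-v) *\<^sub>R j) = f0 (u, v) - cmult (emb j) (f1 (u, v))"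
    using assms unfolding slice_decomp_def by (auto simp del: scaleR_minus_left simp add: cmult.minus_right)
  show "f0 (u, v) = (1/2) *\<^sub>R (f (u, v *\<^sub>R j) + f (u, (-v) *\<^sub>R j))"
    unfolding 1 2 by (simp add: scaleR_2[symmetric])
  have "(1/2) *\<^sub>R (f (u, v *\<^sub>R j) - f (u, (-v) *\<^sub>R j)) = cmult (emb j) (f1 (u, v))"
    unfolding 1 2 by (simp add: scaleR_2[symmetric])
  then show "f1 (u, v) = - cmult (emb j) ((1/2) *\<^sub>R (f (u, v *\<^sub>R j) - f (u, (-v) *\<^sub>R j)))"
    using assms(2) by (simp add: cmult_emb_emb)
qed

lemma slice_decomp_unique:
  fixes f :: "'n::{finite,linorder} pt \<Rightarrow> 'n clif"
  assumes "slice_decomp f f0 f1" "slice_decomp f g0 g1"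
  shows "f0 = g0" "f1 = g1"
proof -
  obtain j :: "(real, 'n) vec" where j: "norm j = 1" using ex_unit by blast
  show "f0 = g0" "f1 = g1"
    using slice_decomp_halves[OF assms(1) j] slice_decomp_halves[OF assms(2) j]
    by (auto simp: fun_eq_iff)
qed

lemma ind_inj:
  assumes "stem F" "stem G" "ind F = ind G"
  shows "F = G"
proof -
  have "(\<lambda>(u, v). reV F (Complex u v)) = (\<lambda>(u, v). reV G (Complex u v))"
       "(\<lambda>(u, v). imV F (Complex u v)) = (\<lambda>(u, v). imV G (Complex u v))"
    using slice_decomp_unique[OF slice_decomp_ind[OF assms(1)]] slice_decomp_ind[OF assms(2)] assms(3)
    by simp_all
  then have "Re (F A z) = Re (G A z)" "Im (F A z) = Im (G A z)" for A z
    by (auto simp: fun_eq_iff reV_def imV_def vec_eq_iff dest!: spec2[of _ "Re z" "Im z"])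
  then show ?thesis by (auto simp: fun_eq_iff complex_eq_iff)
qed

lemma pt_polar:
  obtains j :: "real^'n::{finite,linorder}" where "norm j = 1" "x = (fst x, norm (snd x) *\<^sub>R j)"
proof (cases "snd x = 0")
  case True
  then show ?thesis using that ex_unit by (metis norm_zero prod.collapse scaleR_zero_left)
next
  case False
  then have "norm (sgn (snd x)) = 1" "x = (fst x, norm (snd x) *\<^sub>R sgn (snd x))"
    by (simp_all add: norm_sgn sgn_div_norm)
  then show ?thesis using that by blast
qed

lemma has_derivative_vecI:
  fixes f :: "'a::real_normed_vector \<Rightarrow> real ^ 'n"
  assumes "\<And>A. ((\<lambda>x. f x $ A) has_derivative (\<lambda>h. f' h $ A)) (at x)"
  shows "(f has_derivative f') (at x)"
  using assms by (subst has_derivative_componentwise_within) (auto simp: Basis_vec_def inner_axis)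

lemma stem_DERIV: "stem F \<Longrightarrow> (F A has_field_derivative deriv (F A) z) (at z)"
  by (rule holomorphic_derivI[of _ UNIV]) (auto intro: stem_holo)

lemma stem_has_derivative:
  assumes "stem F"
  shows "((\<lambda>p. F A (Complex (fst p) (snd p))) has_derivative
    (\<lambda>h. deriv (F A) (Complex (fst p) (snd p)) * Complex (fst h) (snd h))) (at p)"
proof -
  have bl: "bounded_linear (\<lambda>p. Complex (fst p) (snd p))"
    unfolding Complex_eq
    by (intro bounded_linear_intros bounded_linear_compose[OF bounded_linear_of_real]
        bounded_linear_fst bounded_linear_snd)
  show ?thesis
    by (rule has_derivative_compose[OF bounded_linear_imp_has_derivative[OF bl]])
       (use stem_DERIV[OF assms] in \<open>simp add: has_field_derivative_def\<close>)
qed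

lemma reV_has_derivative:
  assumes "stem F"
  shows "((\<lambda>p. reV F (Complex (fst p) (snd p))) has_derivative
    (\<lambda>h. \<chi> A. Re (deriv (F A) (Complex (fst p) (snd p)) * Complex (fst h) (snd h)))) (at p)"
  unfolding reV_def
  by (rule has_derivative_vecI) (simp only: vec_lambda_beta, rule has_derivative_Re[OF stem_has_derivative[OF assms]])

lemma imV_has_derivative:
  assumes "stem F"
  shows "((\<lambda>p. imV F (Complex (fst p) (snd p))) has_derivative
    (\<lambda>h. \<chi> A. Im (deriv (F A) (Complex (fst p) (snd p)) * Complex (fst h) (snd h)))) (at p)"
  unfolding imV_def
  by (rule has_derivative_vecI) (simp only: vec_lambda_beta, rule has_derivative_Im[OF stem_has_derivative[OF assms]])

lemma stem_deriv_continuous: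
  assumes "stem F"
  shows "continuous_on S (\<lambda>p. deriv (F A) (Complex (fst p) (snd p)))"
proof -
  have "continuous_on UNIV (deriv (F A))"
    by (intro holomorphic_on_imp_continuous_on holomorphic_deriv stem_holo assms open_UNIV)
  moreover have "continuous_on S (\<lambda>p. Complex (fst p) (snd p))"
    unfolding Complex_eq by (intro continuous_intros)
  ultimately show ?thesis by (rule continuous_on_compose2) auto
qed

text \<open>The two differentials are the real and imaginary parts of multiplication by the complex
  derivative, so the Cauchy-Riemann equations are built in and their continuity is that of the
  derivative of a holomorphic function.\<close>

lemma slice_monogenic_ind:
  assumes F: "stem F"
  shows "slice_monogenic (ind F)"
proof -
  define d where "d = (\<lambda>A (p::real \<times> real). deriv (F A) (Complex (fst p) (snd p)))"
  define D0 where "D0 = (\<lambda>p. Blinfun (\<lambda>h. \<chi> A. Re (d A p * Complex (fst h) (snd h))))"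
  define D1 where "D1 = (\<lambda>p. Blinfun (\<lambda>h. \<chi> A. Im (d A p * Complex (fst h) (snd h))))"
  have hd0: "((\<lambda>p. reV F (Complex (fst p) (snd p))) has_derivative
      (\<lambda>h. \<chi> A. Re (d A p * Complex (fst h) (snd h)))) (at p)" for p
    unfolding d_def by (rule reV_has_derivative[OF F])
  have hd1: "((\<lambda>p. imV F (Complex (fst p) (snd p))) has_derivative
      (\<lambda>h. \<chi> A. Im (d A p * Complex (fst h) (snd h)))) (at p)" for p
    unfolding d_def by (rule imV_has_derivative[OF F])
  have D0: "blinfun_apply (D0 p) = (\<lambda>h. \<chi> A. Re (d A p * Complex (fst h) (snd h)))" for p
    unfolding D0_def by (rule bounded_linear_Blinfun_apply[OF has_derivative_bounded_linear[OF hd0]])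
  have D1: "blinfun_apply (D1 p) = (\<lambda>h. \<chi> A. Im (d A p * Complex (fst h) (snd h)))" for p
    unfolding D1_def by (rule bounded_linear_Blinfun_apply[OF has_derivative_bounded_linear[OF hd1]])
  have cd: "continuous_on UNIV (d A)" for A
    unfolding d_def by (rule stem_deriv_continuous[OF F])
  have "continuous_on UNIV D0" "continuous_on UNIV D1"
    by (rule continuous_on_blinfun_componentwise, simp only: D0 D1, intro continuous_intros cd)+
  with slice_decomp_ind[OF F] hd0 hd1 show ?thesis
    unfolding slice_monogenic_def
    apply -
    apply (rule exI[of _ "\<lambda>(u, v). reV F (Complex u v)"])
    apply (rule exI[of _ "\<lambda>(u, v). imV F (Complex u v)"])
    apply (rule exI[of _ D0])
    apply (rule exI[of _ D1])
    apply (simp add: D0 D1 case_prod_beta' vec_eq_iff)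
    done
qed

lemma slice_monogenic_imp_stem:
  assumes "slice_monogenic f"
  shows "\<exists>F. stem F \<and> f = ind F"
proof -
  from assms obtain f0 f1 D0 D1 where dec: "slice_decomp f f0 f1"
    and D0: "\<And>p. (f0 has_derivative blinfun_apply (D0 p)) (at p)"
    and D1: "\<And>p. (f1 has_derivative blinfun_apply (D1 p)) (at p)"
    and CR: "\<And>p. blinfun_apply (D0 p) (1, 0) = blinfun_apply (D1 p) (0, 1)"
            "\<And>p. blinfun_apply (D0 p) (0, 1) = - blinfun_apply (D1 p) (1, 0)"
    unfolding slice_monogenic_def by blast
  define F where "F = (\<lambda>A z. Complex (f0 (Re z, Im z) $ A) (f1 (Re z, Im z) $ A))"
  have par: "f0 (u, -v) = f0 (u, v)" "f1 (u, -v) = - f1 (u, v)" for u v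
    using dec by (auto simp: slice_decomp_def)
  have holo: "F A holomorphic_on UNIV" for A
  proof -
    have "(F A has_field_derivative Complex (D0 (Re z, Im z) (1, 0) $ A) (D1 (Re z, Im z) (1, 0) $ A)) (at z)" for z
    proof -
      let ?p = "(Re z, Im z)"
      have bl: "bounded_linear (\<lambda>z. (Re z, Im z))"
        by (intro bounded_linear_Pair bounded_linear_Re bounded_linear_Im)
      note c0 = has_derivative_compose[OF bounded_linear_imp_has_derivative[OF bl] D0[of ?p]]
      note c1 = has_derivative_compose[OF bounded_linear_imp_has_derivative[OF bl] D1[of ?p]]
      have "(F A has_derivative (\<lambda>h. complex_of_real (D0 ?p (Re h, Im h) $ A) + \<i> * complex_of_real (D1 ?p (Re h, Im h) $ A))) (at z)"
        unfolding F_def Complex_eq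
        by (intro derivative_intros bounded_linear.has_derivative[OF bounded_linear_vec_nth c0]
            bounded_linear.has_derivative[OF bounded_linear_vec_nth c1])
      note this[THEN has_derivative_eq_rhs]
      moreover have lin: "D (a, b) = a *\<^sub>R D (1, 0) + b *\<^sub>R D (0, 1)" for D :: "(real \<times> real) \<Rightarrow>\<^sub>L 'a clif" and a b
        by (simp flip: blinfun.scaleR_right blinfun.add_right)
      \<comment> \<open>The Cauchy-Riemann equations express both differentials through their values
        at \<open>(1, 0)\<close>; the differential of \<open>f0 + i f1\<close> thereby becomes
        multiplication by one complex number.\<close>
      have lin': "D0 ?p (Re h, Im h) = Re h *\<^sub>R D0 ?p (1, 0) - Im h *\<^sub>R D1 ?p (1, 0)"
           "D1 ?p (Re h, Im h) = Re h *\<^sub>R D1 ?p (1, 0) + Im h *\<^sub>R D0 ?p (1, 0)" for h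
        using lin[of "D0 ?p" "Re h" "Im h"] lin[of "D1 ?p" "Re h" "Im h"] unfolding CR by simp_all
      have "(\<lambda>h. complex_of_real (D0 ?p (Re h, Im h) $ A) + \<i> * complex_of_real (D1 ?p (Re h, Im h) $ A))
         = (*) (Complex (D0 ?p (1, 0) $ A) (D1 ?p (1, 0) $ A))"
        unfolding lin' by (rule ext) (simp add: complex_eq_iff algebra_simps)
      ultimately show ?thesis unfolding has_field_derivative_def by blast
    qed
    then show ?thesis by (auto simp: holomorphic_on_def field_differentiable_def)
  qed
  have st: "stem F" unfolding stem_def using holo by (auto simp: F_def par complex_eq_iff)
  have "f x = ind F x" for x
  proof -
    obtain j where j: "norm j = 1" "x = (fst x, norm (snd x) *\<^sub>R j)" by (rule pt_polar)
    have "f (u, v *\<^sub>R j) = ind F (u, v *\<^sub>R j)" for u v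
      using dec j(1) by (subst ind_slice[OF st j(1)]) (simp add: slice_decomp_def reV_def imV_def F_def)
    then show ?thesis using j(2) by metis
  qed
  with st show ?thesis by (intro exI[of _ F]) (simp add: fun_eq_iff)
qed

lemma slice_monogenic_iff: "slice_monogenic f \<longleftrightarrow> (\<exists>F. stem F \<and> f = ind F)"
  using slice_monogenic_imp_stem slice_monogenic_ind by blast

section \<open>Star product and derivative on the level of stems\<close>

definition sprod :: "'n::{finite,linorder} stem \<Rightarrow> 'n stem \<Rightarrow> 'n stem" where
  "sprod F G C z = clprod (\<lambda>A. F A z) (\<lambda>B. G B z) C"

definition sconst :: "'n::{finite,linorder} clif \<Rightarrow> 'n stem" where
  "sconst a A z = of_real (a $ A)"

lemma stem_sconst: "stem (sconst a)"
  by (simp add: stem_def sconst_def[abs_def])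

lemma stem_sprod:
  assumes "stem F" "stem G"
  shows "stem (sprod F G)"
  unfolding stem_def
proof (intro conjI allI)
  show "sprod F G C holomorphic_on UNIV" for C
    unfolding sprod_def[abs_def] clprod_alt by (intro holomorphic_intros stem_holo assms)
  show "sprod F G C (cnj z) = cnj (sprod F G C z)" for C z
    by (simp add: sprod_def clprod_alt stem_cnj assms)
qed

lemma reV_sprod: "reV (sprod F G) z = cmult (reV F z) (reV G z) - cmult (imV F z) (imV G z)"
  by (simp add: vec_eq_iff cmult_nth clprod_alt reV_def imV_def sprod_def algebra_simps flip: sum_subtractf)

lemma imV_sprod: "imV (sprod F G) z = cmult (imV F z) (reV G z) + cmult (reV F z) (imV G z)"
  by (simp add: vec_eq_iff cmult_nth clprod_alt reV_def imV_def sprod_def algebra_simps flip: sum.distrib)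

text \<open>The choice in \<open>star_L\<close> ranges over all decompositions and all
  representations of \<open>x\<close> as \<open>(u, v *\<^sub>R j)\<close>; for real
  \<open>x\<close> every unit vector \<open>j\<close> occurs. Decompositions are unique, and every
  representation yields the value of one function at \<open>x\<close>, so the choice is
  forced.\<close>

lemma star_L_ind:
  fixes F G :: "'n::{finite,linorder} stem"
  assumes F: "stem F" and G: "stem G"
  shows "star_L (ind F) (ind G) = ind (sprod F G)"
proof
  fix x :: "'n pt"
  have val: "cmult (reV F z) (reV G z) - cmult (imV F z) (imV G z)
      + cmult (emb j) (cmult (imV F z) (reV G z) + cmult (reV F z) (imV G z)) = ind (sprod F G) (u, v *\<^sub>R j)"
    if "norm j = 1" "z = Complex u v" for u v j z
    using ind_slice[OF stem_sprod[OF F G] that(1)] that(2) by (simp add: reV_sprod imV_sprod)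
  obtain j where j: "norm j = 1" "x = (fst x, norm (snd x) *\<^sub>R j)" by (rule pt_polar)
  show "star_L (ind F) (ind G) x = ind (sprod F G) x"
    unfolding star_L_def
  proof (rule some_equality)
    show "\<exists>f0 f1 g0 g1 u v j. slice_decomp (ind F) f0 f1 \<and> slice_decomp (ind G) g0 g1 \<and>
       norm j = 1 \<and> x = (u, v *\<^sub>R j) \<and> ind (sprod F G) x = cmult (f0 (u, v)) (g0 (u, v)) - cmult (f1 (u, v)) (g1 (u, v))
          + cmult (emb j) (cmult (f1 (u, v)) (g0 (u, v)) + cmult (f0 (u, v)) (g1 (u, v)))"
      apply (intro exI conjI)
      apply (rule slice_decomp_ind[OF F])
      apply (rule slice_decomp_ind[OF G])
      apply (rule j(1))
      apply (rule j(2))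
      apply (subst j(2))
      apply (simp add: val[OF j(1) refl])
      done
  next
    fix y
    assume "\<exists>f0 f1 g0 g1 u v j. slice_decomp (ind F) f0 f1 \<and> slice_decomp (ind G) g0 g1 \<and>
       norm j = 1 \<and> x = (u, v *\<^sub>R j) \<and> y = cmult (f0 (u, v)) (g0 (u, v)) - cmult (f1 (u, v)) (g1 (u, v))
          + cmult (emb j) (cmult (f1 (u, v)) (g0 (u, v)) + cmult (f0 (u, v)) (g1 (u, v)))"
    then obtain f0 f1 g0 g1 u v j where dec: "slice_decomp (ind F) f0 f1" "slice_decomp (ind G) g0 g1"
      and j: "norm j = 1" "x = (u, v *\<^sub>R j)"
      and y: "y = cmult (f0 (u, v)) (g0 (u, v)) - cmult (f1 (u, v)) (g1 (u, v))
          + cmult (emb j) (cmult (f1 (u, v)) (g0 (u, v)) + cmult (f0 (u, v)) (g1 (u, v)))" by blast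
    show "y = ind (sprod F G) x"
      unfolding y slice_decomp_unique[OF dec(1) slice_decomp_ind[OF F]]
        slice_decomp_unique[OF dec(2) slice_decomp_ind[OF G]] j(2)
      by (simp add: val[OF j(1) refl])
  qed
qed

definition sderiv :: "nat \<Rightarrow> 'n::{finite,linorder} stem \<Rightarrow> 'n stem" where
  "sderiv l F A = (deriv ^^ l) (F A)"

lemma sderiv_Suc: "sderiv (Suc l) F = sderiv 1 (sderiv l F)"
  by (simp add: sderiv_def fun_eq_iff)

lemma stem_sderiv1:
  assumes "stem F"
  shows "stem (sderiv 1 F)"
  unfolding stem_def
proof (intro conjI allI)
  show "sderiv 1 F A holomorphic_on UNIV" for A
    by (simp add: sderiv_def holomorphic_deriv stem_holo assms)
  fix A z
  \<comment> \<open>Differentiating this identity transfers the conjugation symmetry to the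
    derivative.\<close>
  have "cnj \<circ> F A \<circ> cnj = F A" using assms by (auto simp: fun_eq_iff stem_def)
  moreover have "(cnj \<circ> F A \<circ> cnj has_field_derivative cnj (deriv (F A) (cnj (cnj z)))) (at (cnj z))"
    by (rule has_field_derivative_cnj_cnj) (rule stem_DERIV[OF assms])
  ultimately show "sderiv 1 F A (cnj z) = cnj (sderiv 1 F A z)"
    by (simp add: sderiv_def DERIV_imp_deriv)
qed

lemma stem_sderiv: "stem F \<Longrightarrow> stem (sderiv l F)"
proof (induction l)
  case 0
  then show ?case by (simp add: sderiv_def[abs_def])
next
  case (Suc l)
  then show ?case unfolding sderiv_Suc by (intro stem_sderiv1)
qed

text \<open>Moving in the real direction changes neither the radius nor the unit vector, so only the
  real part of the complex argument varies.\<close>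

lemma dx0_ind1:
  fixes F :: "'n::{finite,linorder} stem"
  assumes F: "stem F"
  shows "dx0 (ind F) = ind (sderiv 1 F)"
proof
  fix x :: "'n pt"
  let ?r = "norm (snd x)" and ?u = "fst x"
  have hd: "((\<lambda>t. (t, ?r)) has_derivative (\<lambda>t. (t, 0))) (at ?u)"
    by (auto intro!: derivative_eq_intros)
  have "((\<lambda>t. reV F (Complex t ?r)) has_derivative (\<lambda>h. h *\<^sub>R reV (sderiv 1 F) (Complex ?u ?r))) (at ?u)"
    using has_derivative_compose[OF hd reV_has_derivative[OF F]]
    by (auto elim!: has_derivative_eq_rhs simp: fun_eq_iff vec_eq_iff reV_def sderiv_def)
  moreover have "((\<lambda>t. imV F (Complex t ?r)) has_derivative (\<lambda>h. h *\<^sub>R imV (sderiv 1 F) (Complex ?u ?r))) (at ?u)"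
    using has_derivative_compose[OF hd imV_has_derivative[OF F]]
    by (auto elim!: has_derivative_eq_rhs simp: fun_eq_iff vec_eq_iff imV_def sderiv_def)
  then have "((\<lambda>t. cmult (emb (sgn (snd x))) (imV F (Complex t ?r))) has_derivative
      (\<lambda>h. cmult (emb (sgn (snd x))) (h *\<^sub>R imV (sderiv 1 F) (Complex ?u ?r)))) (at ?u)"
    by (rule bounded_linear.has_derivative[OF cmult.bounded_linear_right])
  ultimately have "((\<lambda>t. ind F (t, snd x)) has_vector_derivative ind (sderiv 1 F) x) (at ?u)"
    unfolding has_vector_derivative_def ind_def fst_conv snd_conv
    by (auto intro!: has_derivative_add elim!: has_derivative_eq_rhs simp: scaleR_add_right cmult.scaleR_right)
  then show "dx0 (ind F) x = ind (sderiv 1 F) x"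
    by (simp add: dx0_def vector_derivative_at)
qed

lemma dx0_ind:
  assumes "stem F"
  shows "(dx0 ^^ l) (ind F) = ind (sderiv l F)"
proof (induction l)
  case 0
  then show ?case by (simp add: sderiv_def[abs_def])
next
  case (Suc l)
  then show ?case by (simp add: sderiv_Suc dx0_ind1 stem_sderiv assms del: One_nat_def)
qed

lemma reV_add: "reV (\<lambda>A z. F A z + G A z) z = reV F z + reV G z"
  and imV_add: "imV (\<lambda>A z. F A z + G A z) z = imV F z + imV G z"
  and reV_diff: "reV (\<lambda>A z. F A z - G A z) z = reV F z - reV G z"
  and imV_diff: "imV (\<lambda>A z. F A z - G A z) z = imV F z - imV G z"
  by (simp_all add: vec_eq_iff reV_def imV_def)

lemma ind_add: "ind (\<lambda>A z. F A z + G A z) x = ind F x + ind G x"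
  by (simp add: ind_def reV_add imV_add cmult.add_right)

lemma ind_diff: "ind (\<lambda>A z. F A z - G A z) x = ind F x - ind G x"
  by (simp add: ind_def reV_diff imV_diff cmult.diff_right)

lemma ind_zero: "ind (\<lambda>A z. 0) x = 0"
  using ind_diff[of "\<lambda>A z. 0" "\<lambda>A z. 0" x] by simp

lemma ind_sum: "ind (\<lambda>A z. \<Sum>l<N. F l A z) x = (\<Sum>l<N::nat. ind (F l) x)"
  by (induction N) (simp_all add: ind_zero ind_add)

text \<open>A constant has a stem without imaginary part, so the unit vector stays on the left and
  the star product reduces to multiplication from the right.\<close>

lemma ind_sprod_sconst: "ind (sprod F (sconst a)) x = cmult (ind F x) a"
proof -
  have re: "reV (sconst a) z = a" and im: "imV (sconst a) z = 0" for z
    by (simp_all add: vec_eq_iff reV_def imV_def sconst_def)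
  show ?thesis
    by (simp add: ind_def reV_sprod imV_sprod re im cmult.zero_right cmult.add_left cmult_assoc)
qed

lemma stem_add: "stem F \<Longrightarrow> stem G \<Longrightarrow> stem (\<lambda>A z. F A z + G A z)"
  unfolding stem_def by (auto intro!: holomorphic_intros)

lemma stem_diff: "stem F \<Longrightarrow> stem G \<Longrightarrow> stem (\<lambda>A z. F A z - G A z)"
  unfolding stem_def by (auto intro!: holomorphic_intros)

lemma stem_sum: "(\<And>l. l < N \<Longrightarrow> stem (F l)) \<Longrightarrow> stem (\<lambda>A z. \<Sum>l<N::nat. F l A z)"
  unfolding stem_def by (auto intro!: holomorphic_intros)

lemma sprod_assoc: "sprod (sprod F G) H = sprod F (sprod G H)"
  by (simp add: fun_eq_iff sprod_def[abs_def] clprod_assoc)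

section \<open>Norms of a function against norms of its stem\<close>

lemma norm_sprod_le:
  fixes F G :: "'n::{finite,linorder} stem"
  assumes "\<And>A. norm (F A z) \<le> a" "\<And>A. norm (G A z) \<le> b"
  shows "norm (sprod F G C z) \<le> real (card (UNIV :: 'n set set)) * (a * b)"
proof -
  have a: "0 \<le> a" using assms(1) norm_ge_zero order_trans by blast
  have "norm (of_real (csign A (sym_diff A C)) * F A z * G (sym_diff A C) z) \<le> a * b" for A
  proof -
    have "\<bar>csign A (sym_diff A C)\<bar> = 1"
      by (simp add: csign_def power_abs)
    then show ?thesis
      by (simp add: norm_mult mult_mono assms a)
  qed
  then show ?thesis
    unfolding sprod_def clprod_alt by (intro order_trans[OF sum_norm_bound]) auto
qed

lemma norm_pt_Complex: "norm (Complex (fst x) (norm (snd x))) = norm x"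
  by (simp add: cmod_def norm_prod_def)

lemma ind_bound:
  "\<exists>K>0. \<forall>(F :: 'n::{finite,linorder} stem) x N.
     (\<forall>A. norm (F A (Complex (fst x) (norm (snd x)))) \<le> N) \<longrightarrow> norm (ind F x) \<le> K * N"
proof -
  obtain K0 where K0: "K0 > 0" "\<And>a b :: 'n clif. norm (cmult a b) \<le> norm a * norm b * K0"
    using bounded_bilinear.pos_bounded[OF bounded_bilinear_cmult] by blast
  let ?c = "real (card (UNIV :: 'n set set))"
  have "norm (ind F x) \<le> (?c + K0 * ?c) * N"
    if N: "\<And>A. norm (F A (Complex (fst x) (norm (snd x)))) \<le> N" for F :: "'n stem" and x N
  proof -
    let ?z = "Complex (fst x) (norm (snd x))"
    have "norm (reV F ?z) \<le> (\<Sum>A\<in>UNIV. \<bar>reV F ?z $ A\<bar>)" by (rule norm_le_l1_cart)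
    also have "\<dots> \<le> ?c * N"
      by (intro order_trans[OF sum_bounded_above[where K=N]])
         (auto simp: reV_def intro: order_trans[OF abs_Re_le_cmod N])
    finally have re: "norm (reV F ?z) \<le> ?c * N" .
    have "norm (imV F ?z) \<le> (\<Sum>A\<in>UNIV. \<bar>imV F ?z $ A\<bar>)" by (rule norm_le_l1_cart)
    also have "\<dots> \<le> ?c * N"
      by (intro order_trans[OF sum_bounded_above[where K=N]])
         (auto simp: imV_def intro: order_trans[OF abs_Im_le_cmod N])
    finally have im: "norm (imV F ?z) \<le> ?c * N" .
    have "norm (cmult (emb (sgn (snd x))) (imV F ?z)) \<le> norm (emb (sgn (snd x))) * norm (imV F ?z) * K0"
      by (rule K0)
    also have "\<dots> \<le> 1 * (?c * N) * K0"
      using K0(1) im by (intro mult_right_mono mult_mono) (auto simp: norm_emb norm_sgn)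
    finally show ?thesis unfolding ind_def
      using re by (intro order_trans[OF norm_triangle_ineq]) (simp add: algebra_simps)
  qed
  moreover have "?c + K0 * ?c > 0" using K0(1) by (simp add: add_pos_pos card_gt_0_iff)
  ultimately show ?thesis by blast
qed

text \<open>In contrast to \<open>ind_bound\<close> a single point does not suffice: the stem at
  \<open>z\<close> is computed from two conjugate points of a slice. Both have norm
  \<open>norm z\<close>, which is why the majorant \<open>W\<close> is radial. The constant depends
  only on the algebra.\<close>

lemma stem_bound:
  "\<exists>K>0. \<forall>(F :: 'n::{finite,linorder} stem) W. stem F \<longrightarrow>
     (\<forall>x. norm (ind F x) \<le> W (norm x)) \<longrightarrow> (\<forall>A z. norm (F A z) \<le> K * W (norm z))"
proof -
  obtain K0 where K0: "K0 > 0" "\<And>a b :: 'n clif. norm (cmult a b) \<le> norm a * norm b * K0"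
    using bounded_bilinear.pos_bounded[OF bounded_bilinear_cmult] by blast
  obtain j :: "(real, 'n) vec" where j: "norm j = 1" using ex_unit by blast
  have "norm (F A z) \<le> (1 + K0) * W (norm z)"
    if F: "stem F" and W: "\<And>x. norm (ind F x) \<le> W (norm x)" for F :: "'n stem" and W A z
  proof -
    let ?u = "Re z" and ?v = "Im z"
    have nz: "norm (?u, ?v *\<^sub>R j) = norm z" "norm (?u, (-?v) *\<^sub>R j) = norm z"
      using j by (simp_all add: norm_Pair cmod_def)
    have h: "norm ((1/2) *\<^sub>R (a + b)) \<le> w" "norm ((1/2) *\<^sub>R (a - b)) \<le> w"
      if "norm a \<le> w" "norm b \<le> w" for a b :: "'n clif" and w
      using norm_triangle_ineq[of a b] norm_triangle_ineq4[of a b] that by auto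
    note W1 = W[of "(?u, ?v *\<^sub>R j)", unfolded nz] and W2 = W[of "(?u, (-?v) *\<^sub>R j)", unfolded nz]
    note half = slice_decomp_halves[OF slice_decomp_ind[OF F] j, of ?u ?v, unfolded split_conv complex_surj]
    have re: "norm (reV F z) \<le> W (norm z)" unfolding half(1) by (rule h[OF W1 W2])
    have "norm (imV F z) \<le> norm (emb j) *
        norm ((1/2) *\<^sub>R (ind F (?u, ?v *\<^sub>R j) - ind F (?u, (-?v) *\<^sub>R j))) * K0"
      unfolding half(2) norm_minus_cancel by (rule K0(2))
    also have "\<dots> \<le> 1 * W (norm z) * K0"
      using K0(1) j by (intro mult_right_mono mult_mono h W1 W2) (auto simp: norm_emb)
    finally have im: "norm (imV F z) \<le> W (norm z) * K0" by simp
    have "norm (F A z) \<le> \<bar>reV F z $ A\<bar> + \<bar>imV F z $ A\<bar>"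
      by (simp add: reV_def imV_def cmod_le)
    also have "\<dots> \<le> norm (reV F z) + norm (imV F z)"
      by (intro add_mono component_le_norm_cart)
    finally show ?thesis using re im by (simp add: algebra_simps)
  qed
  with K0(1) show ?thesis by (intro exI[of _ "1 + K0"]) auto
qed

section \<open>Weighted norms and the projective limit topology\<close>

text \<open>A supremum of reals carries information only if the family is bounded, so membership and
  norm bound come from the same pointwise estimate.\<close>

lemma A_spaceI:
  assumes "slice_monogenic f" "\<And>x. norm (f x) \<le> N * exp (\<sigma> * norm x powr \<rho> (norm x))"
  shows "f \<in> A_space \<rho> \<sigma>" "wnorm \<rho> \<sigma> f \<le> N"
proof -
  have "weight_fun \<rho> \<sigma> f x \<le> N" for x
    using assms(2)[of x] by (simp add: weight_fun_def exp_minus divide_simps)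
  then show "f \<in> A_space \<rho> \<sigma>" "wnorm \<rho> \<sigma> f \<le> N"
    using assms(1) by (auto simp: A_space_def wnorm_def intro!: bdd_aboveI2 cSUP_least)
qed

lemma wnorm_bound:
  assumes "f \<in> A_space \<rho> \<sigma>"
  shows "norm (f x) \<le> wnorm \<rho> \<sigma> f * exp (\<sigma> * norm x powr \<rho> (norm x))"
proof -
  have "weight_fun \<rho> \<sigma> f x \<le> wnorm \<rho> \<sigma> f"
    unfolding wnorm_def using assms by (auto simp: A_space_def intro!: cSUP_upper)
  then show ?thesis by (simp add: weight_fun_def exp_minus divide_simps)
qed

lemma wnorm_nonneg:
  assumes "f \<in> A_space \<rho> \<sigma>"
  shows "0 \<le> wnorm \<rho> \<sigma> f"
proof -
  have "0 \<le> weight_fun \<rho> \<sigma> f 0" by (simp add: weight_fun_def)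
  also have "\<dots> \<le> wnorm \<rho> \<sigma> f"
    unfolding wnorm_def using assms by (auto simp: A_space_def intro!: cSUP_upper)
  finally show ?thesis .
qed

lemma wnorm_antimono:
  assumes "f \<in> A_space \<rho> \<epsilon>" "\<epsilon> \<le> \<epsilon>'"
  shows "wnorm \<rho> \<epsilon>' f \<le> wnorm \<rho> \<epsilon> f"
proof (rule A_spaceI(2))
  show "slice_monogenic f" using assms by (simp add: A_space_def)
  fix x
  have "norm (f x) \<le> wnorm \<rho> \<epsilon> f * exp (\<epsilon> * norm x powr \<rho> (norm x))"
    by (rule wnorm_bound[OF assms(1)])
  also have "\<dots> \<le> wnorm \<rho> \<epsilon> f * exp (\<epsilon>' * norm x powr \<rho> (norm x))"
    using wnorm_nonneg[OF assms(1)] assms(2) by (intro mult_left_mono) (auto intro: mult_right_mono)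
  finally show "norm (f x) \<le> wnorm \<rho> \<epsilon> f * exp (\<epsilon>' * norm x powr \<rho> (norm x))" .
qed

lemma A_plus0D: "f \<in> A_plus0 \<rho> \<Longrightarrow> \<epsilon> > 0 \<Longrightarrow> f \<in> A_space \<rho> \<epsilon>"
  by (simp add: A_plus0_def)

lemma A_plus0_slice: "f \<in> A_plus0 \<rho> \<Longrightarrow> slice_monogenic f"
  using A_plus0D[of f \<rho> 1] by (simp add: A_space_def)

lemma slice_monogenic_diff:
  assumes "slice_monogenic f" "slice_monogenic g"
  shows "slice_monogenic (\<lambda>x. f x - g x)"
proof -
  obtain F G where "stem F" "f = ind F" "stem G" "g = ind G" using assms slice_monogenic_iff by metis
  then show ?thesis
    by (auto simp: slice_monogenic_iff ind_diff[symmetric] intro!: exI[of _ "\<lambda>A z. F A z - G A z"] stem_diff)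
qed

lemma slice_monogenic_add:
  assumes "slice_monogenic f" "slice_monogenic g"
  shows "slice_monogenic (\<lambda>x. f x + g x)"
proof -
  obtain F G where "stem F" "f = ind F" "stem G" "g = ind G" using assms slice_monogenic_iff by metis
  then show ?thesis
    by (auto simp: slice_monogenic_iff ind_add[symmetric] intro!: exI[of _ "\<lambda>A z. F A z + G A z"] stem_add)
qed

lemma slice_monogenic_rmult:
  assumes "slice_monogenic f"
  shows "slice_monogenic (\<lambda>x. cmult (f x) a)"
proof -
  obtain F where "stem F" "f = ind F" using assms slice_monogenic_iff by metis
  then show ?thesis
    by (auto simp: slice_monogenic_iff ind_sprod_sconst[symmetric]
        intro!: exI[of _ "sprod F (sconst a)"] stem_sprod stem_sconst)
qed

lemma A_space_diff:
  assumes "f \<in> A_space \<rho> \<epsilon>" "g \<in> A_space \<rho> \<epsilon>"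
  shows "(\<lambda>x. f x - g x) \<in> A_space \<rho> \<epsilon>"
    and "wnorm \<rho> \<epsilon> (\<lambda>x. f x - g x) \<le> wnorm \<rho> \<epsilon> f + wnorm \<rho> \<epsilon> g"
proof -
  have "slice_monogenic (\<lambda>x. f x - g x)"
    using assms slice_monogenic_diff by (auto simp: A_space_def)
  moreover have "norm (f x - g x) \<le> (wnorm \<rho> \<epsilon> f + wnorm \<rho> \<epsilon> g) * exp (\<epsilon> * norm x powr \<rho> (norm x))" for x
    using norm_triangle_ineq4[of "f x" "g x"] wnorm_bound[OF assms(1), of x] wnorm_bound[OF assms(2), of x]
    by (simp add: algebra_simps)
  ultimately show "(\<lambda>x. f x - g x) \<in> A_space \<rho> \<epsilon>"
    "wnorm \<rho> \<epsilon> (\<lambda>x. f x - g x) \<le> wnorm \<rho> \<epsilon> f + wnorm \<rho> \<epsilon> g"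
    using A_spaceI[of "\<lambda>x. f x - g x"] by blast+
qed

lemma A_space_add:
  assumes "f \<in> A_space \<rho> \<epsilon>" "g \<in> A_space \<rho> \<epsilon>"
  shows "(\<lambda>x. f x + g x) \<in> A_space \<rho> \<epsilon>"
    and "wnorm \<rho> \<epsilon> (\<lambda>x. f x + g x) \<le> wnorm \<rho> \<epsilon> f + wnorm \<rho> \<epsilon> g"
proof -
  have "slice_monogenic (\<lambda>x. f x + g x)"
    using assms slice_monogenic_add by (auto simp: A_space_def)
  moreover have "norm (f x + g x) \<le> (wnorm \<rho> \<epsilon> f + wnorm \<rho> \<epsilon> g) * exp (\<epsilon> * norm x powr \<rho> (norm x))" for x
    using norm_triangle_ineq[of "f x" "g x"] wnorm_bound[OF assms(1), of x] wnorm_bound[OF assms(2), of x]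
    by (simp add: algebra_simps)
  ultimately show "(\<lambda>x. f x + g x) \<in> A_space \<rho> \<epsilon>"
    "wnorm \<rho> \<epsilon> (\<lambda>x. f x + g x) \<le> wnorm \<rho> \<epsilon> f + wnorm \<rho> \<epsilon> g"
    using A_spaceI[of "\<lambda>x. f x + g x"] by blast+
qed

lemma A_space_rmult:
  assumes "f \<in> A_space \<rho> \<epsilon>"
  shows "(\<lambda>x. cmult (f x) a) \<in> A_space \<rho> \<epsilon>"
proof -
  obtain K0 where K0: "K0 > 0" "\<And>a b :: 'a clif. norm (cmult a b) \<le> norm a * norm b * K0"
    using bounded_bilinear.pos_bounded[OF bounded_bilinear_cmult] by blast
  have "slice_monogenic (\<lambda>x. cmult (f x) a)"
    using assms slice_monogenic_rmult by (auto simp: A_space_def)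
  moreover have "norm (cmult (f x) a) \<le> (wnorm \<rho> \<epsilon> f * norm a * K0) * exp (\<epsilon> * norm x powr \<rho> (norm x))" for x
  proof -
    have "norm (cmult (f x) a) \<le> norm (f x) * norm a * K0" by (rule K0)
    also have "\<dots> \<le> (wnorm \<rho> \<epsilon> f * exp (\<epsilon> * norm x powr \<rho> (norm x))) * norm a * K0"
      using K0(1) by (intro mult_right_mono wnorm_bound assms) auto
    finally show ?thesis by (simp add: algebra_simps)
  qed
  ultimately show ?thesis using A_spaceI[of "\<lambda>x. cmult (f x) a"] by blast
qed

lemma A_plus0_diff: "f \<in> A_plus0 \<rho> \<Longrightarrow> g \<in> A_plus0 \<rho> \<Longrightarrow> (\<lambda>x. f x - g x) \<in> A_plus0 \<rho>"
  by (simp add: A_plus0_def A_space_diff)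

lemma A_plus0_add: "f \<in> A_plus0 \<rho> \<Longrightarrow> g \<in> A_plus0 \<rho> \<Longrightarrow> (\<lambda>x. f x + g x) \<in> A_plus0 \<rho>"
  by (simp add: A_plus0_def A_space_add)

lemma A_plus0_rmult: "f \<in> A_plus0 \<rho> \<Longrightarrow> (\<lambda>x. cmult (f x) a) \<in> A_plus0 \<rho>"
  by (simp add: A_plus0_def A_space_rmult)

section \<open>Open sets, convergence and continuity\<close>

lemma istopology_A:
  "istopology (\<lambda>U. U \<subseteq> A_plus0 \<rho> \<and>
     (\<forall>f\<in>U. \<exists>E r. finite E \<and> (\<forall>e\<in>E. e > 0) \<and> r > 0 \<and>
        {g \<in> A_plus0 \<rho>. \<forall>e\<in>E. wnorm \<rho> e (\<lambda>x. g x - f x) < r} \<subseteq> U))"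
  (is "istopology ?L")
proof -
  have Int: "?L (S \<inter> T)" if 1: "?L S" "?L T" for S T
  proof (intro conjI ballI)
    show "S \<inter> T \<subseteq> A_plus0 \<rho>" using 1 by blast
    fix f assume f: "f \<in> S \<inter> T"
    obtain E r where E: "finite E" "\<forall>e\<in>E. e > 0" "r > 0"
        "{g \<in> A_plus0 \<rho>. \<forall>e\<in>E. wnorm \<rho> e (\<lambda>x. g x - f x) < r} \<subseteq> S"
      using 1(1) f by blast
    obtain E' r' where E': "finite E'" "\<forall>e\<in>E'. e > 0" "r' > 0"
        "{g \<in> A_plus0 \<rho>. \<forall>e\<in>E'. wnorm \<rho> e (\<lambda>x. g x - f x) < r'} \<subseteq> T"
      using 1(2) f by blast
    show "\<exists>E r. finite E \<and> (\<forall>e\<in>E. e > 0) \<and> r > 0 \<and>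
        {g \<in> A_plus0 \<rho>. \<forall>e\<in>E. wnorm \<rho> e (\<lambda>x. g x - f x) < r} \<subseteq> S \<inter> T"
      using E E' by (intro exI[of _ "E \<union> E'"] exI[of _ "min r r'"]) auto
  qed
  have Union: "?L (\<Union>K)" if 2: "\<forall>S\<in>K. ?L S" for K
  proof (intro conjI ballI)
    show "\<Union>K \<subseteq> A_plus0 \<rho>" using 2 by blast
    fix f assume "f \<in> \<Union>K"
    then obtain S where S: "S \<in> K" "f \<in> S" by blast
    then obtain E r where E: "finite E" "\<forall>e\<in>E. e > 0" "r > 0"
        "{g \<in> A_plus0 \<rho>. \<forall>e\<in>E. wnorm \<rho> e (\<lambda>x. g x - f x) < r} \<subseteq> S"
      using 2[rule_format, OF S(1)] by (elim exE conjE ballE[of _ _ f]) (blast+)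
    have "S \<subseteq> \<Union>K" using S by blast
    with E show "\<exists>E r. finite E \<and> (\<forall>e\<in>E. e > 0) \<and> r > 0 \<and>
        {g \<in> A_plus0 \<rho>. \<forall>e\<in>E. wnorm \<rho> e (\<lambda>x. g x - f x) < r} \<subseteq> \<Union>K"
      by (intro exI[of _ E] exI[of _ r] conjI) (assumption | erule order_trans)+
  qed
  show ?thesis
    unfolding istopology_def
    by (rule conjI; intro allI impI) (erule (1) Int, erule Union)
qed

lemma openin_A_top:
  "openin (A_top \<rho>) U \<longleftrightarrow> U \<subseteq> A_plus0 \<rho> \<and>
     (\<forall>f\<in>U. \<exists>E r. finite E \<and> (\<forall>e\<in>E. e > 0) \<and> r > 0 \<and>
        {g \<in> A_plus0 \<rho>. \<forall>e\<in>E. wnorm \<rho> e (\<lambda>x. g x - f x) < r} \<subseteq> U)"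
  unfolding A_top_def topology_inverse'[OF istopology_A] ..

lemma topspace_A_top: "topspace (A_top \<rho>) = A_plus0 \<rho>"
proof
  show "topspace (A_top \<rho>) \<subseteq> A_plus0 \<rho>"
    unfolding topspace_def openin_A_top by blast
  have "openin (A_top \<rho>) (A_plus0 \<rho>)"
    \<comment> \<open>With no norm imposed, the basic neighbourhood is the whole space.\<close>
    unfolding openin_A_top by (auto intro!: exI[of _ "{}"] exI[of _ "1::real"])
  then show "A_plus0 \<rho> \<subseteq> topspace (A_top \<rho>)" by (rule openin_subset)
qed

lemma openin_A_top_ball:
  assumes "f \<in> A_plus0 \<rho>" "\<sigma> > 0" 
  shows "openin (A_top \<rho>) {g \<in> A_plus0 \<rho>. wnorm \<rho> \<sigma> (\<lambda>x. g x - f x) < r}"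
  unfolding openin_A_top
proof (intro conjI ballI)
  fix g assume "g \<in> {g \<in> A_plus0 \<rho>. wnorm \<rho> \<sigma> (\<lambda>x. g x - f x) < r}"
  then have g: "g \<in> A_plus0 \<rho>" "wnorm \<rho> \<sigma> (\<lambda>x. g x - f x) < r" by auto
  have "wnorm \<rho> \<sigma> (\<lambda>x. h x - f x) < r"
    if h: "h \<in> A_plus0 \<rho>" "wnorm \<rho> \<sigma> (\<lambda>x. h x - g x) < r - wnorm \<rho> \<sigma> (\<lambda>x. g x - f x)" for h
    using A_space_add(2)[OF A_plus0D[OF A_plus0_diff[OF h(1) g(1)] assms(2)]
        A_plus0D[OF A_plus0_diff[OF g(1) assms(1)] assms(2)]] h(2) by simp
  then show "\<exists>E r'. finite E \<and> (\<forall>e\<in>E. e > 0) \<and> r' > 0 \<and>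
     {h \<in> A_plus0 \<rho>. \<forall>e\<in>E. wnorm \<rho> e (\<lambda>x. h x - g x) < r'}
      \<subseteq> {g \<in> A_plus0 \<rho>. wnorm \<rho> \<sigma> (\<lambda>x. g x - f x) < r}"
    using g(2) assms(2)
    by (intro exI[of _ "{\<sigma>}"] exI[of _ "r - wnorm \<rho> \<sigma> (\<lambda>x. g x - f x)"]) auto
qed auto

lemma limitin_A_topI:
  assumes l: "l \<in> A_plus0 \<rho>" and s: "\<And>N. s N \<in> A_plus0 \<rho>"
    and lim: "\<And>\<sigma>. \<sigma> > 0 \<Longrightarrow> (\<lambda>N. wnorm \<rho> \<sigma> (\<lambda>x. s N x - l x)) \<longlonglongrightarrow> 0"
  shows "limitin (A_top \<rho>) s l sequentially"
  unfolding limitin_def topspace_A_top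
proof (intro conjI allI impI)
  fix U assume U: "openin (A_top \<rho>) U \<and> l \<in> U"
  then obtain E r where E: "finite E" "\<forall>e\<in>E. e > 0" "r > 0"
        "{g \<in> A_plus0 \<rho>. \<forall>e\<in>E. wnorm \<rho> e (\<lambda>x. g x - l x) < r} \<subseteq> U"
    unfolding openin_A_top by blast
  have "\<forall>\<^sub>F N in sequentially. \<forall>e\<in>E. wnorm \<rho> e (\<lambda>x. s N x - l x) < r"
    using E by (intro eventually_ball_finite ballI order_tendstoD(2)[OF lim]) auto
  then show "\<forall>\<^sub>F N in sequentially. s N \<in> U"
    by eventually_elim (use E s in blast)
qed (fact l)

text \<open>The bound is on differences of values, so that the criterion applies to maps not known
  to be linear.\<close>

lemma continuous_map_A_topI:
  fixes T :: "('n::{finite,linorder} pt \<Rightarrow> 'n clif) \<Rightarrow> ('n pt \<Rightarrow> 'n clif)"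
  assumes T: "\<And>f. f \<in> A_plus0 \<rho>1 \<Longrightarrow> T f \<in> A_plus0 \<rho>2"
    and bd: "\<And>\<sigma>. \<sigma> > 0 \<Longrightarrow> \<exists>\<epsilon>>0. \<exists>C>0. \<forall>f\<in>A_plus0 \<rho>1. \<forall>g\<in>A_plus0 \<rho>1.
       wnorm \<rho>2 \<sigma> (\<lambda>x. T g x - T f x) \<le> C * wnorm \<rho>1 \<epsilon> (\<lambda>x. g x - f x)"
  shows "continuous_map (A_top \<rho>1) (A_top \<rho>2) T"
  unfolding continuous_map_def topspace_A_top
proof (intro conjI allI impI)
  fix U :: "('n pt \<Rightarrow> 'n clif) set"
  assume U: "openin (A_top \<rho>2) U"
  show "openin (A_top \<rho>1) {f \<in> A_plus0 \<rho>1. T f \<in> U}"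
    unfolding openin_A_top
  proof (intro conjI ballI)
    fix f assume f: "f \<in> {f \<in> A_plus0 \<rho>1. T f \<in> U}"
    then have Tf: "T f \<in> U" by simp
    obtain E r where E: "finite E" "\<forall>e\<in>E. e > 0" "r > 0"
        "{g \<in> A_plus0 \<rho>2. \<forall>e\<in>E. wnorm \<rho>2 e (\<lambda>x. g x - T f x) < r} \<subseteq> U"
      using bspec[OF conjunct2[OF U[unfolded openin_A_top]] Tf] by (elim exE conjE) (rule that)
    define B where "B e \<epsilon> C \<longleftrightarrow> (\<forall>f\<in>A_plus0 \<rho>1. \<forall>g\<in>A_plus0 \<rho>1.
       wnorm \<rho>2 e (\<lambda>x. T g x - T f x) \<le> C * wnorm \<rho>1 \<epsilon> (\<lambda>x. g x - f x))" for e \<epsilon> C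
    have "\<forall>e\<in>E. \<exists>\<epsilon>>0. \<exists>C>0. B e \<epsilon> C"
      using bd E(2) unfolding B_def by simp
    then obtain \<epsilon> C where eC: "\<And>e. e \<in> E \<Longrightarrow> \<epsilon> e > 0" "\<And>e. e \<in> E \<Longrightarrow> C e > (0::real)"
      and B: "\<And>e. e \<in> E \<Longrightarrow> B e (\<epsilon> e) (C e)"
      by metis
    \<comment> \<open>The inserted 1 keeps the minimum meaningful when \<open>E\<close> is
      empty.\<close>
    define r' where "r' = Min (insert 1 ((\<lambda>e. r / C e) ` E))"
    have r': "r' > 0" "\<And>e. e \<in> E \<Longrightarrow> r' \<le> r / C e"
      using E(1,3) eC(2) by (auto simp: r'_def)
    have "T g \<in> U" if g: "g \<in> A_plus0 \<rho>1" "\<forall>e\<in>\<epsilon> ` E. wnorm \<rho>1 e (\<lambda>x. g x - f x) < r'" for g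
    proof -
      have "wnorm \<rho>2 e (\<lambda>x. T g x - T f x) < r" if e: "e \<in> E" for e
      proof -
        have "wnorm \<rho>2 e (\<lambda>x. T g x - T f x) \<le> C e * wnorm \<rho>1 (\<epsilon> e) (\<lambda>x. g x - f x)"
          using B[OF e] f g unfolding B_def by simp
        also have "\<dots> < C e * r'" using g(2) e eC(2)[OF e] by auto
        also have "\<dots> \<le> r" using r'(2)[OF e] eC(2)[OF e] by (simp add: field_simps)
        finally show ?thesis .
      qed
      then show ?thesis using E(4) T[OF g(1)] by blast
    qed
    then show "\<exists>E r. finite E \<and> (\<forall>e\<in>E. e > 0) \<and> r > 0 \<and>
        {g \<in> A_plus0 \<rho>1. \<forall>e\<in>E. wnorm \<rho>1 e (\<lambda>x. g x - f x) < r} \<subseteq> {f \<in> A_plus0 \<rho>1. T f \<in> U}"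
      using E(1) eC(1) r'(1) by (intro exI[of _ "\<epsilon> ` E"] exI[of _ r']) auto
  qed auto
qed (use T in auto)

section \<open>Right linear maps and their norm bounds\<close>

lemma cmult_scaleR_one: "cmult a (c *\<^sub>R clif_one) = c *\<^sub>R a"
  by (simp add: cmult.scaleR_right)

lemma wnorm_scaleR:
  assumes "f \<in> A_space \<rho> \<epsilon>" "c > 0"
  shows "wnorm \<rho> \<epsilon> (\<lambda>x. c *\<^sub>R f x) \<le> c * wnorm \<rho> \<epsilon> f"
proof (rule A_spaceI(2))
  show "slice_monogenic (\<lambda>x. c *\<^sub>R f x)"
    using slice_monogenic_rmult[of f "c *\<^sub>R clif_one"] assms(1) by (simp add: A_space_def cmult_scaleR_one)
  show "norm (c *\<^sub>R f x) \<le> c * wnorm \<rho> \<epsilon> f * exp (\<epsilon> * norm x powr \<rho> (norm x))" for x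
    using wnorm_bound[OF assms(1), of x] assms(2) by (simp add: mult.assoc)
qed

lemma right_linear_on_props:
  assumes "right_linear_on (A_plus0 \<rho>) T"
  shows "f \<in> A_plus0 \<rho> \<Longrightarrow> T (\<lambda>x. c *\<^sub>R f x) = (\<lambda>x. c *\<^sub>R T f x)"
    and "f \<in> A_plus0 \<rho> \<Longrightarrow> T (\<lambda>x. cmult (f x) a) = (\<lambda>x. cmult (T f x) a)"
    and "f \<in> A_plus0 \<rho> \<Longrightarrow> g \<in> A_plus0 \<rho> \<Longrightarrow> T (\<lambda>x. f x + g x) = (\<lambda>x. T f x + T g x)"
    and "f \<in> A_plus0 \<rho> \<Longrightarrow> g \<in> A_plus0 \<rho> \<Longrightarrow> T (\<lambda>x. f x - g x) = (\<lambda>x. T f x - T g x)"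
proof -
  have *: "f \<in> A_plus0 \<rho> \<Longrightarrow> g \<in> A_plus0 \<rho> \<Longrightarrow>
     T (\<lambda>x. cmult (f x) a + cmult (g x) b) = (\<lambda>x. cmult (T f x) a + cmult (T g x) b)" for f g a b
    using assms unfolding right_linear_on_def by blast
  show "f \<in> A_plus0 \<rho> \<Longrightarrow> T (\<lambda>x. c *\<^sub>R f x) = (\<lambda>x. c *\<^sub>R T f x)"
    using *[of f f "c *\<^sub>R clif_one" 0] by (simp add: cmult.scaleR_right cmult.zero_right)
  show "f \<in> A_plus0 \<rho> \<Longrightarrow> T (\<lambda>x. cmult (f x) a) = (\<lambda>x. cmult (T f x) a)"
    using *[of f f a 0] by (simp add: cmult.zero_right)
  show "f \<in> A_plus0 \<rho> \<Longrightarrow> g \<in> A_plus0 \<rho> \<Longrightarrow> T (\<lambda>x. f x + g x) = (\<lambda>x. T f x + T g x)"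
    using *[of f g clif_one clif_one] by simp
  show "f \<in> A_plus0 \<rho> \<Longrightarrow> g \<in> A_plus0 \<rho> \<Longrightarrow> T (\<lambda>x. f x - g x) = (\<lambda>x. T f x - T g x)"
    using *[of f g clif_one "- clif_one"] by (simp add: cmult.minus_right)
qed

lemma A_plus0_zero: "(\<lambda>x. 0 :: 'n::{finite,linorder} clif) \<in> A_plus0 \<rho>"
proof -
  have "slice_monogenic (ind (\<lambda>A z. 0) :: 'n pt \<Rightarrow> 'n clif)" by (intro slice_monogenic_ind) (simp add: stem_def)
  then have "slice_monogenic (\<lambda>x::'n pt. 0 :: 'n clif)" by (simp add: ind_zero[abs_def])
  then show ?thesis unfolding A_plus0_def using A_spaceI(1)[of "\<lambda>x::'n pt. 0 :: 'n clif" 0] by simp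
qed

text \<open>The preimage of a unit ball contains a basic neighbourhood of 0. Its finitely many norms
  are all dominated by the one with the least exponent (\<open>wnorm_antimono\<close>), and
  homogeneity turns the neighbourhood into a norm estimate.\<close>

lemma continuous_map_A_topD:
  fixes T :: "('n::{finite,linorder} pt \<Rightarrow> 'n clif) \<Rightarrow> ('n pt \<Rightarrow> 'n clif)"
  assumes cont: "continuous_map (A_top \<rho>1) (A_top \<rho>2) T" and lin: "right_linear_on (A_plus0 \<rho>1) T"
    and "\<sigma> > 0"
  shows "\<exists>\<epsilon>>0. \<exists>C>0. \<forall>f\<in>A_plus0 \<rho>1. wnorm \<rho>2 \<sigma> (T f) \<le> C * wnorm \<rho>1 \<epsilon> f"
proof -
  have T: "T f \<in> A_plus0 \<rho>2" if "f \<in> A_plus0 \<rho>1" for f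
    using cont that by (auto simp: continuous_map_def topspace_A_top)
  let ?U = "{g \<in> A_plus0 \<rho>2. wnorm \<rho>2 \<sigma> (\<lambda>x. g x - 0) < 1}"
  have op: "openin (A_top \<rho>1) {f \<in> A_plus0 \<rho>1. T f \<in> ?U}"
    using cont openin_A_top_ball[OF A_plus0_zero \<open>\<sigma> > 0\<close>, of \<rho>2 1]
    unfolding continuous_map_def topspace_A_top by blast
  have T0: "T (\<lambda>x. 0) = (\<lambda>x. 0)"
    using right_linear_on_props(1)[OF lin A_plus0_zero, of 0] by simp
  have "wnorm \<rho>2 \<sigma> (\<lambda>x. 0 :: 'n clif) \<le> 0"
    by (rule A_spaceI(2)[OF A_plus0_slice[OF A_plus0_zero]]) simp
  then have zero: "(\<lambda>x. 0) \<in> {f \<in> A_plus0 \<rho>1. T f \<in> ?U}"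
    by (simp add: T0 A_plus0_zero)
  obtain E r where E: "finite E" "\<forall>e\<in>E. e > 0" "r > 0"
        "{g \<in> A_plus0 \<rho>1. \<forall>e\<in>E. wnorm \<rho>1 e (\<lambda>x. g x - 0) < r} \<subseteq> {f \<in> A_plus0 \<rho>1. T f \<in> ?U}"
    using bspec[OF conjunct2[OF op[unfolded openin_A_top]] zero] by (elim exE conjE) (rule that)
  \<comment> \<open>Inserting 1 provides a positive exponent even when \<open>E\<close> is
    empty.\<close>
  define \<epsilon> where "\<epsilon> = Min (insert 1 E)"
  have eps: "\<epsilon> > 0" "\<And>e. e \<in> E \<Longrightarrow> \<epsilon> \<le> e" using E(1,2) by (auto simp: \<epsilon>_def)
  have small: "wnorm \<rho>2 \<sigma> (T f) < 1" if f: "f \<in> A_plus0 \<rho>1" "wnorm \<rho>1 \<epsilon> f < r" for f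
  proof -
    have "wnorm \<rho>1 e (\<lambda>x. f x - 0) < r" if "e \<in> E" for e
      using wnorm_antimono[OF A_plus0D[OF f(1) eps(1)] eps(2)[OF that]] f(2) by simp
    then have "T f \<in> ?U" using E(4) f(1) by blast
    then show ?thesis by simp
  qed
  have "wnorm \<rho>2 \<sigma> (T f) \<le> (2 / r) * wnorm \<rho>1 \<epsilon> f" if f: "f \<in> A_plus0 \<rho>1" for f
  proof -
    \<comment> \<open>The scaling factor stays free: it is normally tied to the norm of
      \<open>f\<close>, but if that norm is 0 it may be taken arbitrarily large, which forces the
      norm of \<open>T f\<close> to vanish.\<close>
    have bound: "wnorm \<rho>2 \<sigma> (T f) \<le> 1 / c" if c: "c > 0" "c * wnorm \<rho>1 \<epsilon> f < r" for c
    proof -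
      have cf: "(\<lambda>x. c *\<^sub>R f x) \<in> A_plus0 \<rho>1"
        using A_plus0_rmult[OF f, of "c *\<^sub>R clif_one"] by (simp add: cmult_scaleR_one)
      have "wnorm \<rho>2 \<sigma> (T (\<lambda>x. c *\<^sub>R f x)) < 1"
        using small[OF cf] wnorm_scaleR[OF A_plus0D[OF f eps(1)] c(1)] c(2) by simp
      then have 1: "wnorm \<rho>2 \<sigma> (\<lambda>x. c *\<^sub>R T f x) < 1"
        by (simp add: right_linear_on_props(1)[OF lin f])
      have "(\<lambda>x. c *\<^sub>R T f x) \<in> A_space \<rho>2 \<sigma>"
        using A_space_rmult[OF A_plus0D[OF T[OF f] \<open>\<sigma> > 0\<close>], of "c *\<^sub>R clif_one"] by (simp add: cmult_scaleR_one)
      from wnorm_scaleR[OF this, of "1/c"] c(1)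
      have "wnorm \<rho>2 \<sigma> (T f) \<le> 1 / c * wnorm \<rho>2 \<sigma> (\<lambda>x. c *\<^sub>R T f x)" by simp
      also have "\<dots> \<le> 1 / c * 1" using c(1) 1 by (intro mult_left_mono) auto
      finally show ?thesis by simp
    qed
    let ?w = "wnorm \<rho>1 \<epsilon> f"
    have w: "?w \<ge> 0" by (rule wnorm_nonneg[OF A_plus0D[OF f eps(1)]])
    show ?thesis
    proof (cases "?w = 0")
      case False
      \<comment> \<open>This factor places \<open>f\<close> at half the radius of the neighbourhood,
        whence the constant \<open>2 / r\<close>.\<close>
      then have "wnorm \<rho>2 \<sigma> (T f) \<le> 1 / (r / (2 * ?w))"
        using w E(3) by (intro bound) auto
      then show ?thesis by (simp add: field_simps)
    next
      case True
      have "wnorm \<rho>2 \<sigma> (T f) \<le> 0 + e" if "e > 0" for e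
        using bound[of "1/e"] that True E(3) by simp
      then have "wnorm \<rho>2 \<sigma> (T f) \<le> 0" by (rule field_le_epsilon)
      with True show ?thesis by simp
    qed
  qed
  then show ?thesis using eps(1) E(3) by (intro exI[of _ \<epsilon>] conjI exI[of _ "2/r"]) auto
qed

section \<open>Regular growth of proximate orders\<close>

lemma proximate_order_continuous:
  assumes "proximate_order \<rho>' \<rho>"
  shows "continuous_on {0..} \<rho>'"
  using assms
  by (auto simp: proximate_order_def continuous_on_eq_continuous_within intro: differentiable_imp_continuous_within)

text \<open>The exponent is bounded on the compact interval and nonnegative, so the power is at most
  1 up to \<open>r = 1\<close> and at most \<open>R powr S\<close> beyond. This is what makes
  weights that eventually agree comparable everywhere.\<close>

lemma proximate_order_bdd:
  assumes "proximate_order \<rho>' \<rho>"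
  shows "\<exists>B\<ge>0. \<forall>r. 0 \<le> r \<longrightarrow> r \<le> R \<longrightarrow> r powr \<rho>' r \<le> B"
proof -
  have "compact (\<rho>' ` {0..R})"
    by (intro compact_continuous_image continuous_on_subset[OF proximate_order_continuous[OF assms]]) auto
  then have "bdd_above (\<rho>' ` {0..R})"
    by (intro bounded_imp_bdd_above compact_imp_bounded)
  then obtain S0 where S0: "\<And>r. 0 \<le> r \<Longrightarrow> r \<le> R \<Longrightarrow> \<rho>' r \<le> S0"
    unfolding bdd_above_def by (metis atLeastAtMost_iff imageI)
  define S where "S = max 0 S0"
  have S: "S \<ge> 0" "\<And>r. 0 \<le> r \<Longrightarrow> r \<le> R \<Longrightarrow> \<rho>' r \<le> S" using S0 by (auto simp: S_def le_max_iff_disj)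
  have "r powr \<rho>' r \<le> 1 + R powr S" if r: "0 \<le> r" "r \<le> R" for r
  proof (cases "r \<le> 1")
    case True
    then have "r powr \<rho>' r \<le> 1"
      using r assms by (intro powr_le1) (auto simp: proximate_order_def)
    then show ?thesis by (simp add: add_increasing2)
  next
    case False
    then have "r powr \<rho>' r \<le> r powr S" using S(2)[OF r] by (intro powr_mono) auto
    also have "\<dots> \<le> R powr S" using r S(1) by (intro powr_mono2) auto
    finally show ?thesis by simp
  qed
  then show ?thesis by (intro exI[of _ "1 + R powr S"]) (auto simp: add_nonneg_nonneg)
qed

text \<open>With \<open>h t = ln (m (e^t)) = \<rho>'(e^t) t\<close> for \<open>m r = r powr \<rho>' r\<close>, the proximate order condition says
  precisely that \<open>h'\<close> tends to \<open>\<rho>\<close>.\<close>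

lemma proximate_order_regular:
  assumes "proximate_order \<rho>' \<rho>"
  shows "\<exists>r0\<ge>1. \<forall>r\<ge>r0. \<forall>c\<ge>1. c powr (\<rho> / 2) * r powr \<rho>' r \<le> (c * r) powr \<rho>' (c * r) \<and>
     (c * r) powr \<rho>' (c * r) \<le> c powr (2 * \<rho>) * r powr \<rho>' r"
proof -
  note a = assms[unfolded proximate_order_def]
  have lim: "((\<lambda>r. \<rho>' r + deriv \<rho>' r * r * ln r) \<longlongrightarrow> \<rho> + 0) at_top"
    using a by (intro tendsto_add) auto
  have "\<forall>\<^sub>F r in at_top. \<rho>' r + deriv \<rho>' r * r * ln r > \<rho> / 2"
      "\<forall>\<^sub>F r in at_top. \<rho>' r + deriv \<rho>' r * r * ln r < 2 * \<rho>"
    by (rule order_tendstoD[OF lim]; use a in simp)+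
  then have "\<forall>\<^sub>F r in at_top. \<rho> / 2 < \<rho>' r + deriv \<rho>' r * r * ln r \<and> \<rho>' r + deriv \<rho>' r * r * ln r < 2 * \<rho>"
    by eventually_elim simp
  then obtain r1 where r1: "\<And>r. r \<ge> r1 \<Longrightarrow> \<rho> / 2 < \<rho>' r + deriv \<rho>' r * r * ln r \<and> \<rho>' r + deriv \<rho>' r * r * ln r < 2 * \<rho>"
    unfolding eventually_at_top_linorder by blast
  define r0 where "r0 = max 1 r1"
  have der: "((\<lambda>t. \<rho>' (exp t) * t) has_real_derivative (\<rho>' (exp t) + deriv \<rho>' (exp t) * exp t * ln (exp t))) (at t)" for t
  proof -
    \<comment> \<open>As \<open>exp t > 0\<close> is interior to the half-line, the one-sided notion
      becomes an ordinary derivative.\<close>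
    have "\<rho>' differentiable (at (exp t) within {0..})" using a by simp
    then have "\<rho>' differentiable (at (exp t))"
      by (subst (asm) at_within_interior) (auto simp: interior_real_atLeast)
    then have "(\<rho>' has_real_derivative deriv \<rho>' (exp t)) (at (exp t))"
      by (simp add: DERIV_deriv_iff_real_differentiable)
    from DERIV_chain2[OF this DERIV_exp] show ?thesis
      by (auto intro!: derivative_eq_intros)
  qed
  have "c powr (\<rho> / 2) * r powr \<rho>' r \<le> (c * r) powr \<rho>' (c * r) \<and>
     (c * r) powr \<rho>' (c * r) \<le> c powr (2 * \<rho>) * r powr \<rho>' r" if r: "r \<ge> r0" and c: "c \<ge> 1" for r c
  proof (cases "c = 1")
    case False
    have r': "r \<ge> 1" using r by (simp add: r0_def)
    have lt: "ln r < ln (c * r)" using r' c False by (intro ln_less_cancel_iff[THEN iffD2]) auto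
    \<comment> \<open>By the mean value theorem, passing from \<open>r\<close> to
      \<open>c * r\<close> adds \<open>ln c\<close> times an intermediate slope, and that slope lies
      between \<open>\<rho> / 2\<close> and \<open>2 * \<rho>\<close> because \<open>exp z\<close>
      exceeds \<open>r1\<close>.\<close>
    obtain z where z: "ln r < z" "z < ln (c * r)"
      "\<rho>' (exp (ln (c * r))) * ln (c * r) - \<rho>' (exp (ln r)) * ln r
        = (ln (c * r) - ln r) * (\<rho>' (exp z) + deriv \<rho>' (exp z) * exp z * ln (exp z))"
      using MVT2[OF lt der] by blast
    have "r < exp z" using z(1) r' by (metis exp_less_mono exp_ln less_le_trans zero_less_one)
    then have "r1 \<le> exp z" using r by (simp add: r0_def)
    note * = r1[OF this]
    have lnc: "ln c > 0" "ln (c * r) = ln c + ln r" using c False r' by (auto simp: ln_mult)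
    define d where "d = \<rho>' (exp z) + deriv \<rho>' (exp z) * exp z * ln (exp z)"
    have e: "\<rho>' (c * r) * ln (c * r) = \<rho>' r * ln r + ln c * d"
    proof -
      have 1: "exp (ln (c * r)) = c * r" "exp (ln r) = r" using r' c by simp_all
      have 2: "ln (c * r) - ln r = ln c" using lnc(2) by simp
      show ?thesis using z(3) unfolding 1 2 d_def[symmetric] by linarith
    qed
    have "ln c * (\<rho> / 2) \<le> ln c * d" "ln c * d \<le> ln c * (2 * \<rho>)"
      using * lnc(1) by (auto simp: d_def intro!: mult_left_mono)
    moreover have "c > 0" "r > 0" using c r' by auto
    ultimately show ?thesis
      using e by (simp add: powr_def flip: exp_add) (simp add: algebra_simps)
  qed simp
  then show ?thesis by (intro exI[of _ r0]) (auto simp: r0_def)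
qed

section \<open>Inverse of a normalized growth function\<close>

lemma normalized_mono:
  assumes "normalized_proximate_order \<rho>' \<rho>" "0 \<le> r" "r \<le> s"
  shows "r powr \<rho>' r \<le> s powr \<rho>' s"
proof -
  have "strict_mono_on {0<..} (\<lambda>r. r powr \<rho>' r)"
    using assms(1) by (simp add: normalized_proximate_order_def)
  then show ?thesis
    using assms(2,3) by (cases "r = 0"; cases "r = s") (auto dest: strict_mono_onD[of _ _ r s])
qed

lemma normalized_mono_rev:
  assumes "normalized_proximate_order \<rho>' \<rho>" "0 < r" "0 < s" "r powr \<rho>' r \<le> s powr \<rho>' s"
  shows "r \<le> s"
proof (rule ccontr)
  assume "\<not> r \<le> s"
  moreover have "strict_mono_on {0<..} (\<lambda>r. r powr \<rho>' r)"
    using assms(1) by (simp add: normalized_proximate_order_def)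
  ultimately show False
    using assms(2-4) by (auto dest: strict_mono_onD[of _ _ s r])
qed

text \<open>Existence is the intermediate value theorem: normalization gives values below
  \<open>s\<close> near 0, regular growth gives values above \<open>s\<close> far out. Strict
  monotonicity gives the uniqueness that the definite description needs.\<close>

lemma prox_inv_spec:
  assumes n: "normalized_proximate_order \<rho>' \<rho>" and s: "s > 0"
  shows "prox_inv \<rho>' s > 0" "prox_inv \<rho>' s powr \<rho>' (prox_inv \<rho>' s) = s"
proof -
  have p: "proximate_order \<rho>' \<rho>" using n by (simp add: normalized_proximate_order_def)
  then have rho: "\<rho> > 0" by (simp add: proximate_order_def)
  obtain r0 where r0: "r0 \<ge> 1" "\<And>c. c \<ge> 1 \<Longrightarrow> c powr (\<rho> / 2) * r0 powr \<rho>' r0 \<le> (c * r0) powr \<rho>' (c * r0)"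
    using proximate_order_regular[OF p] by blast
  define m0 where "m0 = r0 powr \<rho>' r0"
  have m0: "m0 > 0" using r0(1) by (simp add: m0_def)
  \<comment> \<open>Chosen so that \<open>c powr (\<rho> / 2) * m0\<close> reaches \<open>s\<close>;
    the maximum with 1 is what regular growth requires.\<close>
  define c where "c = max 1 ((s / m0) powr (2 / \<rho>))"
  have "s / m0 = ((s / m0) powr (2 / \<rho>)) powr (\<rho> / 2)"
    using rho s m0 by (simp add: powr_powr)
  also have "\<dots> \<le> c powr (\<rho> / 2)"
    using rho by (intro powr_mono2) (auto simp: c_def)
  finally have "s \<le> c powr (\<rho> / 2) * m0" using m0 by (simp add: field_simps)
  also have "\<dots> \<le> (c * r0) powr \<rho>' (c * r0)"
    unfolding m0_def by (rule r0(2)) (simp add: c_def)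
  finally have up: "s \<le> (c * r0) powr \<rho>' (c * r0)" .
  have "\<forall>\<^sub>F r in at_right 0. r powr \<rho>' r < s"
    using n s unfolding normalized_proximate_order_def by (auto intro: order_tendstoD)
  moreover have "\<forall>\<^sub>F r in at_right 0. r < c * r0"
    using r0(1) by (intro order_tendstoD(2)[of _ 0] tendsto_ident_at) (auto simp: c_def)
  moreover have "\<forall>\<^sub>F r in at_right (0::real). r > 0" by (rule eventually_at_right_less)
  ultimately have "\<forall>\<^sub>F r in at_right 0. r powr \<rho>' r < s \<and> r < c * r0 \<and> r > 0" by eventually_elim simp
  then obtain a where a: "a powr \<rho>' a < s" "a < c * r0" "a > 0"
    using eventually_happens by fastforce
  have "\<exists>r\<ge>a. r \<le> c * r0 \<and> r powr \<rho>' r = s"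
  proof (rule IVT')
    show "continuous_on {a..c * r0} (\<lambda>r. r powr \<rho>' r)"
      using a(3) by (intro continuous_intros continuous_on_subset[OF proximate_order_continuous[OF p]]) auto
  qed (use a up in auto)
  then obtain r where "a \<le> r" "r powr \<rho>' r = s" by blast
  with a(3) have r: "r > 0" "r powr \<rho>' r = s" by simp_all
  have "r' = r" if "r' > 0 \<and> r' powr \<rho>' r' = s" for r'
  proof (rule antisym)
    show "r' \<le> r" "r \<le> r'" by (rule normalized_mono_rev[OF n]; use that r in simp)+
  qed
  then have "prox_inv \<rho>' s = r"
    unfolding prox_inv_def using r by (intro the_equality conjI)
  then show "prox_inv \<rho>' s > 0" "prox_inv \<rho>' s powr \<rho>' (prox_inv \<rho>' s) = s" using r by auto
qed

text \<open>The proof of the theorem uses the two weights \<open>M1\<close>, \<open>M2\<close> and the numbers \<open>g l = \<phi>(max 1 l)\<close> only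
  through the following properties. The modification at \<open>l = 0\<close> makes \<open>g\<close> positive and increasing.\<close>

locale growth =
  fixes M1 M2 :: "real \<Rightarrow> real" and g :: "nat \<Rightarrow> real"
  assumes M1_nonneg: "M1 r \<ge> 0" and M2_nonneg: "M2 r \<ge> 0"
    and g_pos: "g l > 0" and g_mono: "k \<le> l \<Longrightarrow> g k \<le> g l"
    and M1_add: "\<exists>L>0. \<forall>r\<ge>0. \<forall>s\<ge>0. \<forall>t. 0 \<le> t \<longrightarrow> t \<le> r + s \<longrightarrow> M1 t \<le> L * (1 + M1 r + M1 s)"
    and M1_le_M2: "\<exists>B>0. \<forall>r\<ge>0. M1 r \<le> B * (1 + M2 r)"
    and M1_g: "c > 0 \<Longrightarrow> \<exists>K>0. \<forall>l. M1 (c * g l) \<le> K * (1 + real l)"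
    and power_le: "\<sigma> > 0 \<Longrightarrow> \<exists>C>0. \<forall>l r. r \<ge> 0 \<longrightarrow> r ^ l \<le> (C * g l) ^ l * exp (\<sigma> * M1 r)"
    and M2_bdd: "\<exists>B. \<forall>r. 0 \<le> r \<longrightarrow> r \<le> R \<longrightarrow> M2 r \<le> B"

text \<open>With \<open>a * n \<ge> 1\<close>, the number \<open>c\<close> is at most the
  \<open>n\<close>-th power of \<open>c powr a\<close>, and \<open>x \<le> exp x\<close> at
  \<open>x = b * c powr a / n\<close> gives the constant. It later charges the excess of
  \<open>r\<close> over \<open>g l\<close> to the exponential weight.\<close>

lemma linear_le_exp_powr:
  assumes "a > 0" "b > (0::real)"
  shows "\<exists>C>0. \<forall>c\<ge>1. c \<le> C * exp (b * c powr a)"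
proof -
  define n where "n = nat \<lceil>1 / a\<rceil>"
  have "1 / a > 0" using assms by simp
  then have n: "n > 0" "1 / a \<le> real n" unfolding n_def by (auto simp: of_nat_ceiling)
  have "c \<le> (real n / b) ^ n * exp (b * c powr a)" if "c \<ge> 1" for c
  proof -
    have "c = c powr 1" using that by simp
    also have "\<dots> \<le> c powr (a * n)" using n(2) assms(1) that by (intro powr_mono) (auto simp: field_simps)
    also have "\<dots> = (c powr a) ^ n" using that by (simp add: powr_powr[symmetric] powr_realpow)
    also have "\<dots> = (real n / b) ^ n * (b * c powr a / n) ^ n"
      using n assms by (simp flip: power_mult_distrib)
    also have "\<dots> \<le> (real n / b) ^ n * exp (b * c powr a / n) ^ n"
      using n assms exp_ge_add_one_self[of "b * c powr a / n"]
      by (intro mult_left_mono power_mono) (auto simp del: exp_ge_add_one_self)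
    also have "exp (b * c powr a / n) ^ n = exp (b * c powr a)"
      using n by (simp flip: exp_of_nat_mult)
    finally show ?thesis .
  qed
  moreover have "(real n / b) ^ n > 0" using n assms by simp
  ultimately show ?thesis by blast
qed

text \<open>The estimates on the source weight are carried out for the normalized weight
  \<open>mh\<close>, which is monotone and satisfies \<open>mh (g l) = max 1 l\<close>, and are then
  moved to \<open>m\<close> at the cost of an additive constant \<open>B\<close>.\<close>

lemma growth_proximate:
  fixes \<rho>1' \<rho>2' \<rho>h :: "real \<Rightarrow> real" and \<rho>1 \<rho>2 :: real
  assumes p1: "proximate_order \<rho>1' \<rho>1" and p2: "proximate_order \<rho>2' \<rho>2"
    and O12: "(\<lambda>r. r powr \<rho>1' r) \<in> O(\<lambda>r. r powr \<rho>2' r)"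
    and nh: "normalized_proximate_order \<rho>h \<rho>1"
    and eq: "\<forall>\<^sub>F r in at_top. \<rho>h r = \<rho>1' r"
  shows "growth (\<lambda>r. r powr \<rho>1' r) (\<lambda>r. r powr \<rho>2' r) (\<lambda>l. prox_inv \<rho>h (real (max 1 l)))"
proof -
  define m where "m = (\<lambda>r. r powr \<rho>1' r)"
  define mh where "mh = (\<lambda>r. r powr \<rho>h r)"
  define m2 where "m2 = (\<lambda>r. r powr \<rho>2' r)"
  define g where "g = (\<lambda>l. prox_inv \<rho>h (real (max 1 l)))"
  have ph: "proximate_order \<rho>h \<rho>1" using nh by (simp add: normalized_proximate_order_def)
  have rho: "\<rho>1 > 0" using p1 by (simp add: proximate_order_def)
  have mono: "0 \<le> r \<Longrightarrow> r \<le> s \<Longrightarrow> mh r \<le> mh s" for r s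
    unfolding mh_def by (rule normalized_mono[OF nh])
  have nonneg: "m r \<ge> 0" "mh r \<ge> 0" "m2 r \<ge> 0" for r by (simp_all add: m_def mh_def m2_def)
  have g_pos: "g l > 0" and mh_g: "mh (g l) = real (max 1 l)" for l
    unfolding g_def mh_def by (intro prox_inv_spec[OF nh]; simp)+
  have g_mono: "g k \<le> g l" if "k \<le> l" for k l
    by (rule normalized_mono_rev[OF nh g_pos[of k] g_pos[of l]])
       (use that mh_g[of k] mh_g[of l] in \<open>simp add: mh_def\<close>)
  obtain r0 where r0: "r0 \<ge> 1"
    and lower: "\<And>r c. r \<ge> r0 \<Longrightarrow> c \<ge> 1 \<Longrightarrow> c powr (\<rho>1 / 2) * mh r \<le> mh (c * r)"
    and upper: "\<And>r c. r \<ge> r0 \<Longrightarrow> c \<ge> 1 \<Longrightarrow> mh (c * r) \<le> c powr (2 * \<rho>1) * mh r"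
  proof -
    from proximate_order_regular[OF ph] obtain r0 where "r0 \<ge> 1"
      "\<forall>r\<ge>r0. \<forall>c\<ge>1. c powr (\<rho>1 / 2) * mh r \<le> mh (c * r) \<and> mh (c * r) \<le> c powr (2 * \<rho>1) * mh r"
      unfolding mh_def by blast
    then show ?thesis by (intro that[of r0]) simp_all
  qed
  obtain B where B: "B \<ge> 0" "\<And>r. r \<ge> 0 \<Longrightarrow> m r \<le> mh r + B" "\<And>r. r \<ge> 0 \<Longrightarrow> mh r \<le> m r + B"
  proof -
    obtain R where R: "\<And>r. r \<ge> R \<Longrightarrow> \<rho>h r = \<rho>1' r"
      using eq unfolding eventually_at_top_linorder by blast
    obtain B1 B2 where "B1 \<ge> 0" "B2 \<ge> 0" and b: "\<And>r. 0 \<le> r \<Longrightarrow> r \<le> R \<Longrightarrow> m r \<le> B1"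
      "\<And>r. 0 \<le> r \<Longrightarrow> r \<le> R \<Longrightarrow> mh r \<le> B2"
      using proximate_order_bdd[OF p1, of R, folded m_def] proximate_order_bdd[OF ph, of R, folded mh_def]
      unfolding m_def mh_def by metis
    have "m r \<le> mh r + (B1 + B2)" "mh r \<le> m r + (B1 + B2)" if "r \<ge> 0" for r
    proof -
      have "m r \<le> mh r + (B1 + B2) \<and> mh r \<le> m r + (B1 + B2)"
      proof (cases "r \<le> R")
        case True
        then show ?thesis using b[OF that True] \<open>B1 \<ge> 0\<close> \<open>B2 \<ge> 0\<close> nonneg[of r] by auto
      next
        case False
        then show ?thesis using R[of r] \<open>B1 \<ge> 0\<close> \<open>B2 \<ge> 0\<close> by (simp add: m_def mh_def)
      qed
      then show "m r \<le> mh r + (B1 + B2)" "mh r \<le> m r + (B1 + B2)" by auto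
    qed
    then show ?thesis using that[of "B1 + B2"] \<open>B1 \<ge> 0\<close> \<open>B2 \<ge> 0\<close> by auto
  qed
  have "growth m m2 g"
  proof
    show "m r \<ge> 0" "m2 r \<ge> 0" for r by (rule nonneg)+
    show "g l > 0" for l by (rule g_pos)
    show "g k \<le> g l" if "k \<le> l" for k l by (rule g_mono[OF that])
    show "\<exists>B. \<forall>r. 0 \<le> r \<longrightarrow> r \<le> R \<longrightarrow> m2 r \<le> B" for R
      using proximate_order_bdd[OF p2, of R] unfolding m2_def by blast
    show "\<exists>L>0. \<forall>r\<ge>0. \<forall>s\<ge>0. \<forall>t. 0 \<le> t \<longrightarrow> t \<le> r + s \<longrightarrow> m t \<le> L * (1 + m r + m s)"
    proof -
      \<comment> \<open>\<open>P\<close> is the doubling constant of \<open>mh\<close> beyond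
        \<open>r0\<close>; below \<open>r0\<close>, monotonicity bounds \<open>mh (2 * q)\<close> by
        the value at \<open>2 * r0\<close>. The radius \<open>q\<close> is the larger summand, so
        \<open>t \<le> 2 * q\<close>.\<close>
      define P where "P = 2 powr (2 * \<rho>1)"
      define L where "L = B + mh (2 * r0) + 2 * P * B + P + 1"
      have P: "P \<ge> 0" by (simp add: P_def)
      have "m t \<le> L * (1 + m r + m s)" if "r \<ge> 0" "s \<ge> 0" "0 \<le> t" "t \<le> r + s" for r s t
      proof -
        define q where "q = max r s"
        have q: "q \<ge> 0" "t \<le> 2 * q" using that by (auto simp: q_def)
        have mq: "mh q \<le> mh r + mh s" using nonneg by (auto simp: q_def max_def)
        have "mh (2 * q) \<le> P * mh q + mh (2 * r0)"
        proof (cases "q \<ge> r0")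
          case True
          then show ?thesis using upper[OF True, of 2] nonneg(2)[of "2 * r0"] by (simp add: P_def)
        next
          case False
          then have "mh (2 * q) \<le> mh (2 * r0)" using q by (intro mono) auto
          moreover have "0 \<le> P * mh q" using P nonneg(2)[of q] by simp
          ultimately show ?thesis by linarith
        qed
        also have "\<dots> \<le> P * (m r + m s + 2 * B) + mh (2 * r0)"
          using mq B(3)[OF that(1)] B(3)[OF that(2)] P by (intro add_right_mono mult_left_mono) auto
        finally have "m t \<le> P * (m r + m s + 2 * B) + mh (2 * r0) + B"
          using B(2)[OF that(3)] mono[OF that(3) q(2)] by linarith
        also have "\<dots> = P * (m r + m s) + (B + mh (2 * r0) + 2 * P * B)" by (simp add: algebra_simps)
        also have "\<dots> \<le> L * (m r + m s) + L * 1"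
          using P B(1) nonneg by (intro add_mono mult_right_mono) (auto simp: L_def)
        finally show ?thesis by (simp add: algebra_simps)
      qed
      moreover have "L > 0" using P B(1) nonneg(2)[of "2 * r0"] by (simp add: L_def add_nonneg_pos)
      ultimately show ?thesis by blast
    qed
    show "\<exists>B>0. \<forall>r\<ge>0. m r \<le> B * (1 + m2 r)"
    proof -
      obtain c where c: "c > 0" "\<forall>\<^sub>F r in at_top. norm (m r) \<le> c * norm (m2 r)"
        using O12 unfolding m_def m2_def by (elim landau_o.bigE)
      then obtain R where R: "\<And>r. r \<ge> R \<Longrightarrow> m r \<le> c * m2 r"
        using nonneg unfolding eventually_at_top_linorder by auto
      obtain B1 where B1: "B1 \<ge> 0" "\<And>r. 0 \<le> r \<Longrightarrow> r \<le> R \<Longrightarrow> m r \<le> B1"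
        using proximate_order_bdd[OF p1, of R] unfolding m_def by blast
      have "m r \<le> (c + B1) * (1 + m2 r)" if "r \<ge> 0" for r
      proof (cases "r \<le> R")
        case True
        have "B1 * 1 \<le> (c + B1) * (1 + m2 r)"
          using c B1(1) nonneg(3)[of r] by (intro mult_mono) auto
        then show ?thesis using B1(2)[OF that True] by simp
      next
        case False
        have "c * m2 r \<le> (c + B1) * (1 + m2 r)"
          using c B1(1) nonneg(3)[of r] by (intro mult_mono) auto
        then show ?thesis using R[of r] False by simp
      qed
      moreover have "c + B1 > 0" using c(1) B1(1) by simp
      ultimately show ?thesis by blast
    qed
    show "\<exists>K>0. \<forall>l. m (c * g l) \<le> K * (1 + real l)" if "c > 0" for c
    proof -
      define d where "d = max 1 c"
      define K where "K = B + d powr (2 * \<rho>1) + mh (d * r0) + 1"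
      have d: "d \<ge> 1" "c \<le> d" by (auto simp: d_def)
      have Kpos: "K > 0" using B(1) nonneg(2)[of "d * r0"] by (simp add: K_def add_nonneg_pos)
      have "m (c * g l) \<le> K * (1 + real l)" for l
      proof -
        have "m (c * g l) \<le> mh (c * g l) + B" using that g_pos[of l] by (intro B) auto
        also have "mh (c * g l) \<le> mh (d * g l)" using that g_pos[of l] d by (intro mono) auto
        also have "mh (d * g l) \<le> d powr (2 * \<rho>1) * (1 + real l) + mh (d * r0)"
        proof (cases "g l \<ge> r0")
          case True
          then have "mh (d * g l) \<le> d powr (2 * \<rho>1) * real (max 1 l)"
            using upper[OF True d(1)] by (simp add: mh_g)
          also have "\<dots> \<le> d powr (2 * \<rho>1) * (1 + real l)" by (intro mult_left_mono) auto
          finally show ?thesis using nonneg(2)[of "d * r0"] by simp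
        next
          case False
          then have "mh (d * g l) \<le> mh (d * r0)" using d g_pos[of l] by (intro mono) auto
          then show ?thesis by (simp add: add_increasing)
        qed
        also have "d powr (2 * \<rho>1) * (1 + real l) + mh (d * r0) + B \<le> K * (1 + real l)"
          using B(1) nonneg(2)[of "d * r0"] by (simp add: K_def algebra_simps add_increasing)
        finally show ?thesis by simp
      qed
      with Kpos show ?thesis by blast
    qed
    show "\<exists>C>0. \<forall>l r. r \<ge> 0 \<longrightarrow> r ^ l \<le> (C * g l) ^ l * exp (\<sigma> * m r)" if \<sigma>: "\<sigma> > 0" for \<sigma>
    proof -
      define a where "a = \<rho>1 / 2"
      define k where "k = min 1 ((g 0 / r0) powr a)"
      have a: "a > 0" and k: "k > 0" using rho g_pos[of 0] r0 by (auto simp: a_def k_def)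
      obtain C0 where C0: "C0 > 0" "\<And>c. c \<ge> 1 \<Longrightarrow> c \<le> C0 * exp ((\<sigma> * k) * c powr a)"
        using linear_le_exp_powr[OF a, of "\<sigma> * k"] \<sigma> k by auto
      \<comment> \<open>One summand for each case: \<open>r \<le> g l\<close>,
        \<open>r \<le> r0\<close>, and \<open>r\<close> beyond both.\<close>
      define C where "C = 1 + r0 / g 0 + C0 * exp (\<sigma> * B)"
      have rg: "r0 / g 0 > 0" using r0 g_pos[of 0] by simp
      have C: "C > 0" "C \<ge> 1" "C \<ge> r0 / g 0" "C \<ge> C0 * exp (\<sigma> * B)"
        using rg C0(1) by (auto simp: C_def add_pos_pos add_nonneg_nonneg)
      have "r ^ l \<le> (C * g l) ^ l * exp (\<sigma> * m r)" if r: "r \<ge> 0" for l r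
      proof (cases "l = 0")
        case True
        then show ?thesis using \<sigma> nonneg by simp
      next
        case False
        have gl: "mh (g l) = real l" using mh_g[of l] False by simp
        have ge1: "exp (\<sigma> * m r) \<ge> 1" using \<sigma> nonneg by simp
        have easy: ?thesis if "r \<le> C * g l"
        proof -
          have "r ^ l * 1 \<le> (C * g l) ^ l * exp (\<sigma> * m r)"
            using power_mono[OF that r, of l] ge1 C(1) g_pos[of l] by (intro mult_mono) auto
          then show ?thesis by simp
        qed
        show ?thesis
        proof (cases "r \<le> g l \<or> r \<le> r0")
          case True
          have "g l \<le> C * g l" using C(2) g_pos[of l] by simp
          moreover have "r0 \<le> C * g l"
          proof -
            have "r0 = (r0 / g 0) * g 0" using g_pos[of 0] by simp
            also have "\<dots> \<le> C * g l" using C g_mono[of 0 l] g_pos[of 0] rg by (intro mult_mono) auto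
            finally show ?thesis .
          qed
          ultimately show ?thesis using True easy by linarith
        next
          case F: False
          define c where "c = r / g l"
          have c: "c \<ge> 1" "r = c * g l" using F g_pos[of l] by (auto simp: c_def)
          \<comment> \<open>Beyond \<open>g l\<close> the weight has grown at least like
            \<open>c powr a\<close> times its value \<open>l\<close> there, up to the factor
            \<open>k\<close>. This \<open>l\<close> in the exponent is what pays for the
            \<open>l\<close>-th power of \<open>c\<close>.\<close>
          have key: "k * c powr a * l \<le> mh r"
          proof (cases "g l \<ge> r0")
            case True
            have "k * c powr a * l \<le> 1 * c powr a * l" by (intro mult_right_mono) (auto simp: k_def)
            also have "\<dots> \<le> mh r" using lower[OF True c(1)] by (simp add: gl c(2) a_def)
            finally show ?thesis .
          next
            case False
            have "k * c powr a * l \<le> (g 0 / r0) powr a * c powr a * l"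
              by (intro mult_right_mono) (auto simp: k_def)
            also have "\<dots> = (c * g 0 / r0) powr a * l"
              using r0 g_pos[of 0] c(1) by (simp flip: powr_mult add: mult.commute)
            also have "\<dots> \<le> (r / r0) powr a * mh r0"
            proof (intro mult_mono powr_mono2)
              show "c * g 0 / r0 \<le> r / r0"
                using r0 c g_mono[of 0 l] by (intro divide_right_mono) auto
              show "real l \<le> mh r0" using mono[of "g l" r0] False g_pos[of l] gl by simp
            qed (use a c(1) r0 g_pos[of 0] in auto)
            also have "\<dots> \<le> mh ((r / r0) * r0)" unfolding a_def
              using F r0 by (intro lower) auto
            finally show ?thesis using r0 by simp
          qed
          have "c ^ l \<le> (C0 * exp ((\<sigma> * k) * c powr a)) ^ l"
            using C0(2)[OF c(1)] c(1) by (intro power_mono) auto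
          also have "\<dots> = C0 ^ l * exp (\<sigma> * (k * c powr a * l))"
            by (simp add: power_mult_distrib mult_ac flip: exp_of_nat_mult)
          also have "\<dots> \<le> C0 ^ l * exp (\<sigma> * (m r + B))"
            using key B(3)[OF r] \<sigma> C0(1) by (intro mult_left_mono) auto
          also have "\<dots> = C0 ^ l * exp (\<sigma> * B) * exp (\<sigma> * m r)"
            by (simp add: algebra_simps exp_add)
          \<comment> \<open>As \<open>l \<ge> 1\<close>, the price of passing from \<open>mh\<close>
            to \<open>m\<close> can be raised to the power \<open>l\<close> and hidden in
            \<open>C ^ l\<close>.\<close>
          also have "exp (\<sigma> * B) \<le> exp (\<sigma> * B) ^ l"
            using False \<sigma> B(1) by (intro self_le_power) auto
          then have "C0 ^ l * exp (\<sigma> * B) * exp (\<sigma> * m r) \<le> (C0 * exp (\<sigma> * B)) ^ l * exp (\<sigma> * m r)"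
            using C0(1) by (simp add: power_mult_distrib)
          also have "\<dots> \<le> C ^ l * exp (\<sigma> * m r)"
            using C C0(1) by (intro mult_right_mono power_mono) auto
          finally have "c ^ l \<le> C ^ l * exp (\<sigma> * m r)" .
          then have "c ^ l * g l ^ l \<le> C ^ l * exp (\<sigma> * m r) * g l ^ l"
            using g_pos[of l] by (intro mult_right_mono) auto
          then show ?thesis by (simp add: c(2) power_mult_distrib mult_ac)
        qed
      qed
      with C(1) show ?thesis by blast
    qed
  qed
  then show ?thesis by (simp add: m_def m2_def g_def)
qed

text \<open>The value 1 at \<open>l = 0\<close> is a zeroth power, so replacing \<open>l\<close> by
  \<open>max 1 l\<close> inside the inverse changes nothing.\<close>

lemma Gseq_eq:
  assumes "\<rho> > 0"
  shows "Gseq \<rho>' \<rho> l = (prox_inv \<rho>' (real (max 1 l)) / (exp 1 * \<rho>) powr (1 / \<rho>)) ^ l"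
proof (cases "l = 0")
  case False
  have "((exp 1 * \<rho>) powr (1 / \<rho>)) ^ l = (exp 1 * \<rho>) powr (real l / \<rho>)"
    using assms by (subst powr_realpow[symmetric]) (auto simp: powr_powr)
  with False show ?thesis by (simp add: Gseq_def power_divide max_def)
qed (simp add: Gseq_def)

section \<open>Differential operators of infinite order on stems\<close>

lemma sderiv_diff:
  assumes "stem F" "stem G"
  shows "sderiv l (\<lambda>A z. F A z - G A z) = (\<lambda>A z. sderiv l F A z - sderiv l G A z)"
  by (intro ext) (simp add: sderiv_def higher_deriv_diff[of _ UNIV] stem_holo assms)

lemma sderiv_add:
  assumes "stem F" "stem G"
  shows "sderiv l (\<lambda>A z. F A z + G A z) = (\<lambda>A z. sderiv l F A z + sderiv l G A z)"
  by (intro ext) (simp add: sderiv_def higher_deriv_add[of _ UNIV] stem_holo assms)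

lemma sderiv_sprod_sconst:
  assumes "stem F"
  shows "sderiv l (sprod F (sconst a)) = sprod (sderiv l F) (sconst a)"
proof (induction l)
  case (Suc l)
  have "sderiv 1 (sprod G (sconst a)) = sprod (sderiv 1 G) (sconst a)" if "stem G" for G
  proof (intro ext)
    fix C z
    have "((\<lambda>z. sprod G (sconst a) C z) has_field_derivative sprod (sderiv 1 G) (sconst a) C z) (at z)"
      unfolding sprod_def clprod_alt sconst_def
      by (intro DERIV_sum) (auto intro!: derivative_eq_intros stem_DERIV[OF that] simp: sderiv_def)
    then show "sderiv 1 (sprod G (sconst a)) C z = sprod (sderiv 1 G) (sconst a) C z"
      by (simp add: sderiv_def DERIV_imp_deriv)
  qed
  then show ?case unfolding sderiv_Suc[of l] Suc by (simp add: stem_sderiv assms)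
qed (simp add: sderiv_def[abs_def])

lemma sprod_diff_right: "sprod U (\<lambda>A z. F A z - G A z) C z = sprod U F C z - sprod U G C z"
  by (simp add: sprod_def clprod_alt right_diff_distrib sum_subtractf)

lemma sprod_add_right: "sprod U (\<lambda>A z. F A z + G A z) C z = sprod U F C z + sprod U G C z"
  by (simp add: sprod_def clprod_alt distrib_left sum.distrib)

text \<open>The geometric tail starting at \<open>N\<close> sums to
  \<open>2 * c * (1/2) ^ N\<close>. It serves both the operator series and the Taylor
  series.\<close>

lemma half_series:
  fixes f :: "nat \<Rightarrow> complex"
  assumes "\<And>l. norm (f l) \<le> c * (1/2) ^ l"
  shows "summable f" "norm ((\<Sum>l. f l) - (\<Sum>l<N. f l)) \<le> 2 * c * (1/2) ^ N" "norm (\<Sum>l. f l) \<le> 2 * c"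
proof -
  have s: "summable (\<lambda>l. c * (1/2::real) ^ (l + k))" for k
    unfolding power_add by (intro summable_mult summable_mult2 summable_geometric) simp
  show f: "summable f"
    by (rule summable_comparison_test'[OF s[of 0]]) (use assms in simp)
  have tail: "norm ((\<Sum>l. f l) - (\<Sum>l<N. f l)) \<le> 2 * c * (1/2) ^ N" for N
  proof -
    have "(\<Sum>l. f l) - (\<Sum>l<N. f l) = (\<Sum>l. f (l + N))"
      using suminf_minus_initial_segment[OF f] by simp
    also have "norm \<dots> \<le> (\<Sum>l. c * (1/2::real) ^ (l + N))"
      by (rule norm_suminf_le[OF _ s]) (rule assms)
    also have "\<dots> = 2 * c * (1/2) ^ N"
    proof -
      have "(\<Sum>l. (c * (1/2) ^ N) * (1/2::real) ^ l) = (c * (1/2) ^ N) * (\<Sum>l. (1/2) ^ l)"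
        by (rule suminf_mult) simp
      also have "(\<Sum>l. (1/2::real) ^ l) = 2" by (simp add: suminf_geometric)
      finally show ?thesis by (simp add: power_add mult_ac)
    qed
    finally show ?thesis .
  qed
  show "norm ((\<Sum>l. f l) - (\<Sum>l<N. f l)) \<le> 2 * c * (1/2) ^ N" by (rule tail)
  show "norm (\<Sum>l. f l) \<le> 2 * c" using tail[of 0] by simp
qed

text \<open>The sum is taken pointwise; \<open>opS_summable\<close> gives the setting in which it
  converges.\<close>

definition opS :: "(nat \<Rightarrow> 'n::{finite,linorder} stem) \<Rightarrow> 'n stem \<Rightarrow> 'n stem" where
  "opS U F A z = (\<Sum>l. sprod (U l) (sderiv l F) A z)"

section \<open>Cauchy estimates and convergence of the operator series\<close>

context growth
begin

text \<open>The growth condition of (a) read on stems, with the geometric factor of \<open>G\<close>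
  absorbed into \<open>\<eta>\<close>; \<open>coeff_cond_iff\<close> makes the correspondence
  precise.\<close>

definition scoeff :: "(nat \<Rightarrow> 'n::{finite,linorder} stem) \<Rightarrow> bool" where
  "scoeff U \<longleftrightarrow> (\<forall>l. stem (U l)) \<and> (\<forall>\<sigma>>0. \<exists>\<eta>>0. \<exists>C>0. \<forall>l A z.
     norm (U l A z) \<le> C * (\<eta> * g l) ^ l / fact l * exp (\<sigma> * M2 (norm z)))"

definition sA1 :: "'n::{finite,linorder} stem \<Rightarrow> bool" where
  "sA1 F \<longleftrightarrow> stem F \<and> (\<forall>\<epsilon>>0. \<exists>N. \<forall>A z. norm (F A z) \<le> N * exp (\<epsilon> * M1 (norm z)))"

text \<open>The constants precede \<open>F\<close> and \<open>N\<close>, so the estimate is linear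
  in the norm and yields continuity along with convergence.\<close>

lemma cauchy_bound:
  assumes \<sigma>: "\<sigma> > 0" and \<delta>: "\<delta> > 0"
  shows "\<exists>\<epsilon>>0. \<exists>C>0. \<forall>F N. F holomorphic_on UNIV \<longrightarrow> (\<forall>z. norm (F z) \<le> N * exp (\<epsilon> * M1 (norm z))) \<longrightarrow>
     (\<forall>l z. norm ((deriv ^^ l) F z) \<le> C * N * fact l * (\<delta> / g l) ^ l * exp (\<sigma> * M1 (norm z)))"
proof -
  obtain L where L: "L > 0" "\<And>r s t. r \<ge> 0 \<Longrightarrow> s \<ge> 0 \<Longrightarrow> 0 \<le> t \<Longrightarrow> t \<le> r + s \<Longrightarrow> M1 t \<le> L * (1 + M1 r + M1 s)"
    using M1_add by blast
  \<comment> \<open>With radius \<open>g l / d\<close>, Cauchy's inequality contributes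
    \<open>(d / g l) ^ l\<close> and the weight on the circle a factor \<open>exp 1 ^ l\<close>;
    dividing \<open>\<delta>\<close> by \<open>exp 1\<close> makes them combine to
    \<open>(\<delta> / g l) ^ l\<close>.\<close>
  define d where "d = \<delta> / exp 1"
  have d: "d > 0" using \<delta> by (simp add: d_def)
  obtain K where K: "K > 0" "\<And>l. M1 (1 / d * g l) \<le> K * (1 + real l)"
    using M1_g[of "1 / d"] d by auto
  \<comment> \<open>The first bound keeps the weight at \<open>z\<close> below
    \<open>\<sigma>\<close>, the second keeps the contribution of the radius below
    \<open>1 + l\<close>.\<close>
  define \<epsilon> where "\<epsilon> = min (\<sigma> / L) (1 / (L * K))"
  have \<epsilon>: "\<epsilon> > 0" "\<epsilon> * L \<le> \<sigma>" "\<epsilon> * L * K \<le> 1"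
  proof -
    show "\<epsilon> > 0" using \<sigma> L(1) K(1) by (simp add: \<epsilon>_def)
    have "\<epsilon> \<le> \<sigma> / L" "\<epsilon> \<le> 1 / (L * K)" by (simp_all add: \<epsilon>_def)
    then show "\<epsilon> * L \<le> \<sigma>" "\<epsilon> * L * K \<le> 1" using L(1) K(1) by (simp_all add: field_simps)
  qed
  define C where "C = exp (\<sigma> + 1)"
  have "norm ((deriv ^^ l) F z) \<le> C * N * fact l * (\<delta> / g l) ^ l * exp (\<sigma> * M1 (norm z))"
    if F: "F holomorphic_on UNIV" and N: "\<And>z. norm (F z) \<le> N * exp (\<epsilon> * M1 (norm z))" for F N l z
  proof -
    define R where "R = g l / d"
    have R: "R > 0" using g_pos d by (simp add: R_def)
    have N0: "N \<ge> 0" using order_trans[OF norm_ge_zero N[of 0]] by (simp add: zero_le_mult_iff)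
    have bound: "norm (F w) \<le> N * (C * exp 1 ^ l * exp (\<sigma> * M1 (norm z)))" if w: "norm (z - w) = R" for w
    proof -
      have "norm w \<le> norm z + R"
        using norm_triangle_ineq4[of z "z - w"] w by simp
      then have "M1 (norm w) \<le> L * (1 + M1 (norm z) + M1 R)"
        using R by (intro L) auto
      also have "\<dots> \<le> L * (1 + M1 (norm z) + K * (1 + real l))"
        using K(2)[of l] L(1) by (intro mult_left_mono) (auto simp: R_def)
      finally have "\<epsilon> * M1 (norm w) \<le> \<epsilon> * (L * (1 + M1 (norm z) + K * (1 + real l)))"
        using \<epsilon>(1) by (intro mult_left_mono) auto
      also have "\<dots> = (\<epsilon> * L) * (1 + M1 (norm z)) + (\<epsilon> * L * K) * (1 + real l)"
        by (simp add: algebra_simps)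
      also have "\<dots> \<le> \<sigma> * (1 + M1 (norm z)) + 1 * (1 + real l)"
        using \<epsilon> M1_nonneg[of "norm z"] by (intro add_mono mult_right_mono) auto
      finally have "exp (\<epsilon> * M1 (norm w)) \<le> exp ((\<sigma> + 1) + real l + \<sigma> * M1 (norm z))"
        by (simp add: algebra_simps)
      also have "\<dots> = C * exp 1 ^ l * exp (\<sigma> * M1 (norm z))"
        by (simp add: exp_add C_def flip: exp_of_nat_mult)
      finally show ?thesis using N0 by (intro order_trans[OF N] mult_left_mono)
    qed
    have "norm ((deriv ^^ l) F z) \<le> fact l * (N * (C * exp 1 ^ l * exp (\<sigma> * M1 (norm z)))) / R ^ l"
      using F R bound
      by (intro Cauchy_inequality) (auto intro: holomorphic_on_subset holomorphic_on_imp_continuous_on)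
    also have "\<dots> = C * N * fact l * (\<delta> / g l) ^ l * exp (\<sigma> * M1 (norm z))"
      using \<delta> g_pos[of l] by (simp add: R_def d_def field_simps)
    finally show ?thesis .
  qed
  moreover have "C > 0" by (simp add: C_def)
  ultimately show ?thesis using \<epsilon>(1) by blast
qed

lemma exp_M1_le_M2:
  assumes "\<sigma> > 0"
  shows "\<exists>\<sigma>'>0. \<forall>r\<ge>0. exp (\<sigma>' * M1 r) \<le> exp \<sigma> * exp (\<sigma> * M2 r)"
proof -
  obtain B where B: "B > 0" "\<And>r. r \<ge> 0 \<Longrightarrow> M1 r \<le> B * (1 + M2 r)" using M1_le_M2 by blast
  have "exp (\<sigma> / B * M1 r) \<le> exp \<sigma> * exp (\<sigma> * M2 r)" if "r \<ge> 0" for r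
  proof -
    have "\<sigma> / B * M1 r \<le> \<sigma> / B * (B * (1 + M2 r))"
      using B(1) assms B(2)[OF that] by (intro mult_left_mono) auto
    also have "\<dots> = \<sigma> + \<sigma> * M2 r" using B(1) by (simp add: algebra_simps)
    finally show ?thesis by (simp flip: exp_add)
  qed
  then show ?thesis using B(1) assms by (intro exI[of _ "\<sigma> / B"]) auto
qed

lemma term_bound:
  fixes U :: "nat \<Rightarrow> 'n::{finite,linorder} stem"
  assumes U: "scoeff U" and \<sigma>: "\<sigma> > 0"
  shows "\<exists>\<epsilon>>0. \<exists>C>0. \<forall>F N. stem F \<longrightarrow> (\<forall>A z. norm (F A z) \<le> N * exp (\<epsilon> * M1 (norm z))) \<longrightarrow>
     (\<forall>l A z. norm (sprod (U l) (sderiv l F) A z) \<le> C * N * exp (\<sigma> * M2 (norm z)) * (1/2) ^ l)"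
proof -
  \<comment> \<open>Half of the exponent pays for the coefficient, the other half for the
    derivative.\<close>
  have \<sigma>2: "\<sigma> / 2 > 0" using \<sigma> by simp
  then obtain \<eta> C1 where \<eta>: "\<eta> > 0" and C1: "C1 > 0"
    and Ub: "\<And>l A z. norm (U l A z) \<le> C1 * (\<eta> * g l) ^ l / fact l * exp (\<sigma> / 2 * M2 (norm z))"
    using U unfolding scoeff_def by blast
  obtain \<sigma>' where s': "\<sigma>' > 0" "\<And>r. r \<ge> 0 \<Longrightarrow> exp (\<sigma>' * M1 r) \<le> exp (\<sigma> / 2) * exp (\<sigma> / 2 * M2 r)"
    using exp_M1_le_M2[OF \<sigma>2] by blast
  \<comment> \<open>Chosen so that \<open>(\<eta> * g l) * (\<delta> / g l)\<close> is 1/2.\<close>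
  define \<delta> where "\<delta> = 1 / (2 * \<eta>)"
  have \<delta>: "\<delta> > 0" using \<eta> by (simp add: \<delta>_def)
  obtain \<epsilon> C2 where \<epsilon>: "\<epsilon> > 0" and C2: "C2 > 0"
    and Fb: "\<And>F N l z. F holomorphic_on UNIV \<Longrightarrow> (\<And>z. norm (F z) \<le> N * exp (\<epsilon> * M1 (norm z))) \<Longrightarrow>
       norm ((deriv ^^ l) F z) \<le> C2 * N * fact l * (\<delta> / g l) ^ l * exp (\<sigma>' * M1 (norm z))"
    using cauchy_bound[OF s'(1) \<delta>] by blast
  let ?k = "real (card (UNIV :: 'n set set))"
  define C where "C = ?k * C1 * C2 * exp (\<sigma> / 2)"
  have "norm (sprod (U l) (sderiv l F) A z) \<le> C * N * exp (\<sigma> * M2 (norm z)) * (1/2) ^ l"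
    if F: "stem F" and N: "\<And>A z. norm (F A z) \<le> N * exp (\<epsilon> * M1 (norm z))" for F :: "'n stem" and N l A z
  proof -
    have N0: "N \<ge> 0" using order_trans[OF norm_ge_zero N[of undefined 0]] by (simp add: zero_le_mult_iff)
    have Gb: "norm (sderiv l F B z) \<le> C2 * N * fact l * (\<delta> / g l) ^ l * (exp (\<sigma> / 2) * exp (\<sigma> / 2 * M2 (norm z)))" for B
    proof -
      have "norm (sderiv l F B z) \<le> C2 * N * fact l * (\<delta> / g l) ^ l * exp (\<sigma>' * M1 (norm z))"
        unfolding sderiv_def by (rule Fb[OF stem_holo[OF F] N])
      also have "\<dots> \<le> C2 * N * fact l * (\<delta> / g l) ^ l * (exp (\<sigma> / 2) * exp (\<sigma> / 2 * M2 (norm z)))"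
        using C2 N0 \<delta> g_pos[of l] by (intro mult_left_mono s') auto
      finally show ?thesis .
    qed
    have arrange: "k * ((a * x / f * e) * (b * N * f * y * (s * e))) = (k * a * b * s) * N * (e * e) * (x * y)"
      if "f \<noteq> 0" for k a x f e b y s :: real
      using that by simp
    have "norm (sprod (U l) (sderiv l F) A z) \<le> ?k * ((C1 * (\<eta> * g l) ^ l / fact l * exp (\<sigma> / 2 * M2 (norm z))) *
        (C2 * N * fact l * (\<delta> / g l) ^ l * (exp (\<sigma> / 2) * exp (\<sigma> / 2 * M2 (norm z)))))"
      by (intro norm_sprod_le Ub Gb)
    also have "\<dots> = C * N * (exp (\<sigma> / 2 * M2 (norm z)) * exp (\<sigma> / 2 * M2 (norm z))) * ((\<eta> * g l) * (\<delta> / g l)) ^ l"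
      unfolding C_def power_mult_distrib[of "\<eta> * g l"] by (rule arrange) simp
    also have "(\<eta> * g l) * (\<delta> / g l) = 1 / 2" using \<eta> g_pos[of l] by (simp add: \<delta>_def)
    also have "exp (\<sigma> / 2 * M2 (norm z)) * exp (\<sigma> / 2 * M2 (norm z)) = exp (\<sigma> * M2 (norm z))"
      by (simp flip: exp_add)
    finally show ?thesis .
  qed
  moreover have "C > 0" using C1 C2 by (simp add: C_def card_gt_0_iff)
  ultimately show ?thesis using \<epsilon> by blast
qed

lemma opS_summable:
  assumes U: "scoeff U" and F: "sA1 F"
  shows "summable (\<lambda>l. sprod (U l) (sderiv l F) A z)"
proof -
  obtain \<epsilon> C where "\<epsilon> > 0" and *: "\<And>F N l A z. stem F \<Longrightarrow> (\<And>A z. norm (F A z) \<le> N * exp (\<epsilon> * M1 (norm z))) \<Longrightarrow>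
     norm (sprod (U l) (sderiv l F) A z) \<le> C * N * exp (1 * M2 (norm z)) * (1/2) ^ l"
    using term_bound[OF U zero_less_one] by blast
  moreover obtain N where "\<And>A z. norm (F A z) \<le> N * exp (\<epsilon> * M1 (norm z))"
    using F \<open>\<epsilon> > 0\<close> unfolding sA1_def by blast
  ultimately show ?thesis using F unfolding sA1_def by (intro half_series(1)) blast
qed

text \<open>The decay in \<open>n\<close> gives convergence of the partial sums; the case
  \<open>n = 0\<close> bounds the operator itself.\<close>

lemma opS_bound:
  fixes U :: "nat \<Rightarrow> 'n::{finite,linorder} stem"
  assumes U: "scoeff U" and \<sigma>: "\<sigma> > 0"
  shows "\<exists>\<epsilon>>0. \<exists>C>0. \<forall>F N. stem F \<longrightarrow> (\<forall>A z. norm (F A z) \<le> N * exp (\<epsilon> * M1 (norm z))) \<longrightarrow>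
     (\<forall>n A z. norm (opS U F A z - (\<Sum>l<n. sprod (U l) (sderiv l F) A z))
        \<le> C * N * (1/2) ^ n * exp (\<sigma> * M2 (norm z)))"
proof -
  obtain \<epsilon> C where e: "\<epsilon> > 0" "C > 0" and *: "\<And>F N l A z. stem F \<Longrightarrow> (\<And>A z. norm (F A z) \<le> N * exp (\<epsilon> * M1 (norm z))) \<Longrightarrow>
     norm (sprod (U l) (sderiv l F) A z) \<le> C * N * exp (\<sigma> * M2 (norm z)) * (1/2) ^ l"
    using term_bound[OF U \<sigma>] by blast
  have "norm (opS U F A z - (\<Sum>l<n. sprod (U l) (sderiv l F) A z))
        \<le> (2 * C) * N * (1/2) ^ n * exp (\<sigma> * M2 (norm z))"
    if "stem F" "\<And>A z. norm (F A z) \<le> N * exp (\<epsilon> * M1 (norm z))" for F :: "'n stem" and N n A z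
    using half_series(2)[OF *[OF that]] unfolding opS_def by (simp add: mult_ac)
  then show ?thesis using e by (intro exI[of _ \<epsilon>] conjI exI[of _ "2 * C"]) auto
qed

text \<open>The termwise bound carries a weight that is bounded on discs, so the series converges
  locally uniformly and the limit is entire. Conjugation symmetry passes through the sum.\<close>

lemma stem_opS:
  fixes U :: "nat \<Rightarrow> 'n::{finite,linorder} stem"
  assumes U: "scoeff U" and F: "sA1 F"
  shows "stem (opS U F)"
proof -
  have st: "stem F" using F by (simp add: sA1_def)
  have stU: "stem (U l)" for l using U by (simp add: scoeff_def)
  have stT: "stem (sprod (U l) (sderiv l F))" for l
    by (intro stem_sprod stU stem_sderiv st)
  obtain \<epsilon> C where e: "\<epsilon> > 0" "C > 0" and *: "\<And>F N l A z. stem F \<Longrightarrow> (\<And>A z. norm (F A z) \<le> N * exp (\<epsilon> * M1 (norm z))) \<Longrightarrow>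
     norm (sprod (U l) (sderiv l F) A z) \<le> C * N * exp (1 * M2 (norm z)) * (1/2) ^ l"
    using term_bound[OF U zero_less_one] by blast
  obtain N where N: "\<And>A z. norm (F A z) \<le> N * exp (\<epsilon> * M1 (norm z))"
    using F \<open>\<epsilon> > 0\<close> unfolding sA1_def by blast
  have N0: "N \<ge> 0" using order_trans[OF norm_ge_zero N[of undefined 0]] by (simp add: zero_le_mult_iff)
  have "opS U F A holomorphic_on UNIV" for A
  proof (rule holomorphic_uniform_sequence[OF open_UNIV])
    show "(\<lambda>z. \<Sum>l<n. sprod (U l) (sderiv l F) A z) holomorphic_on UNIV" for n
      by (intro holomorphic_intros stem_holo[OF stT])
    fix x :: complex
    obtain B where B: "\<And>r. 0 \<le> r \<Longrightarrow> r \<le> norm x + 1 \<Longrightarrow> M2 r \<le> B" using M2_bdd by blast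
    have "uniform_limit (cball x 1) (\<lambda>n z. \<Sum>l<n. sprod (U l) (sderiv l F) A z)
      (\<lambda>z. \<Sum>l. sprod (U l) (sderiv l F) A z) sequentially"
    proof (rule Weierstrass_m_test)
      show "summable (\<lambda>l. C * N * exp B * (1/2::real) ^ l)" by (intro summable_mult summable_geometric) simp
      fix l z assume "z \<in> cball x 1"
      then have "norm z \<le> norm x + 1"
        using norm_triangle_ineq2[of z x] by (simp add: dist_norm norm_minus_commute)
      then have "exp (1 * M2 (norm z)) \<le> exp B" using B by simp
      then show "norm (sprod (U l) (sderiv l F) A z) \<le> C * N * exp B * (1/2) ^ l"
        using e N0 by (intro order_trans[OF *[OF st N]] mult_right_mono mult_left_mono) auto
    qed
    then show "\<exists>d>0. cball x d \<subseteq> UNIV \<and>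
       uniform_limit (cball x d) (\<lambda>n z. \<Sum>l<n. sprod (U l) (sderiv l F) A z) (opS U F A) sequentially"
      unfolding opS_def[abs_def] by (intro exI[of _ 1]) auto
  qed
  moreover have "opS U F A (cnj z) = cnj (opS U F A z)" for A z
  proof -
    have "(\<lambda>l. sprod (U l) (sderiv l F) A (cnj z)) sums cnj (opS U F A z)"
      unfolding stem_cnj[OF stT] opS_def using summable_sums[OF opS_summable[OF U F]] by (simp add: sums_cnj)
    then show ?thesis unfolding opS_def by (simp add: sums_iff)
  qed
  ultimately show ?thesis by (simp add: stem_def)
qed

lemma opS_diff:
  assumes "scoeff U" "sA1 F" "sA1 G"
  shows "opS U (\<lambda>A z. F A z - G A z) = (\<lambda>A z. opS U F A z - opS U G A z)"
proof (intro ext)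
  fix A z
  have "stem F" "stem G" using assms by (auto simp: sA1_def)
  then show "opS U (\<lambda>A z. F A z - G A z) A z = opS U F A z - opS U G A z"
    unfolding opS_def by (simp add: sderiv_diff sprod_diff_right suminf_diff opS_summable assms)
qed

lemma opS_add:
  assumes "scoeff U" "sA1 F" "sA1 G"
  shows "opS U (\<lambda>A z. F A z + G A z) = (\<lambda>A z. opS U F A z + opS U G A z)"
proof (intro ext)
  fix A z
  have "stem F" "stem G" using assms by (auto simp: sA1_def)
  then show "opS U (\<lambda>A z. F A z + G A z) A z = opS U F A z + opS U G A z"
    unfolding opS_def by (simp add: sderiv_add sprod_add_right suminf_add[symmetric] opS_summable assms)
qed

lemma opS_sprod_sconst:
  assumes "scoeff U" "sA1 F"
  shows "opS U (sprod F (sconst a)) = sprod (opS U F) (sconst a)"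
proof (intro ext)
  fix C z
  have st: "stem F" using assms by (auto simp: sA1_def)
  have "(\<lambda>l. sprod (sprod (U l) (sderiv l F)) (sconst a) C z) sums sprod (opS U F) (sconst a) C z"
    unfolding sprod_def[of _ "sconst a"] clprod_alt opS_def
    by (intro sums_sum sums_mult sums_mult2 summable_sums opS_summable assms)
  then show "opS U (sprod F (sconst a)) C z = sprod (opS U F) (sconst a) C z"
    unfolding opS_def[of U "sprod F (sconst a)"] by (simp add: sderiv_sprod_sconst[OF st] sums_iff flip: sprod_assoc)
qed

end

section \<open>Representation of continuous operators\<close>

lemma tendsto_zero_half_power:
  fixes w :: "nat \<Rightarrow> real"
  assumes "\<And>n. 0 \<le> w n" "\<And>n. w n \<le> c * (1/2) ^ n"
  shows "w \<longlonglongrightarrow> 0"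
proof (rule real_tendsto_sandwich[OF _ _ tendsto_const])
  show "\<forall>\<^sub>F n in sequentially. 0 \<le> w n" "\<forall>\<^sub>F n in sequentially. w n \<le> c * (1/2) ^ n"
    using assms by simp_all
  show "(\<lambda>n. c * (1/2::real) ^ n) \<longlonglongrightarrow> 0"
    by (intro tendsto_mult_right_zero LIMSEQ_power_zero) simp
qed

definition stem_of :: "('n::{finite,linorder} pt \<Rightarrow> 'n clif) \<Rightarrow> 'n stem" where
  "stem_of f = (SOME F. stem F \<and> f = ind F)"

lemma stem_of:
  assumes "slice_monogenic f"
  shows "stem (stem_of f)" "ind (stem_of f) = f"
  using someI_ex[OF assms[unfolded slice_monogenic_iff]] unfolding stem_of_def by auto

lemma stem_of_ind: "stem F \<Longrightarrow> stem_of (ind F) = F"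
  using ind_inj stem_of slice_monogenic_ind by metis

text \<open>The constant is fixed before the weight and the exponent, so one comparison constant
  serves all norms of both spaces.\<close>

lemma wnorm_stem:
  "\<exists>K>0. \<forall>\<rho> \<sigma> (F :: 'n::{finite,linorder} stem). stem F \<longrightarrow> ind F \<in> A_space \<rho> \<sigma> \<longrightarrow>
     (\<forall>A z. norm (F A z) \<le> K * wnorm \<rho> \<sigma> (ind F) * exp (\<sigma> * (norm z powr \<rho> (norm z))))"
proof -
  obtain K where K: "K > 0" "\<And>(F :: 'n stem) W A z. stem F \<Longrightarrow>
     (\<And>x. norm (ind F x) \<le> W (norm x)) \<Longrightarrow> norm (F A z) \<le> K * W (norm z)"
    using stem_bound by blast
  have "norm (F A z) \<le> K * wnorm \<rho> \<sigma> (ind F) * exp (\<sigma> * (norm z powr \<rho> (norm z)))"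
    if "stem F" "ind F \<in> A_space \<rho> \<sigma>" for F :: "'n stem" and \<rho> \<sigma> A z
    using K(2)[OF that(1) wnorm_bound[OF that(2)]] by (simp add: mult.assoc)
  with K(1) show ?thesis by blast
qed

lemma stem_wnorm:
  "\<exists>K>0. \<forall>\<rho> \<sigma> N (F :: 'n::{finite,linorder} stem). stem F \<longrightarrow>
     (\<forall>A z. norm (F A z) \<le> N * exp (\<sigma> * (norm z powr \<rho> (norm z)))) \<longrightarrow>
     ind F \<in> A_space \<rho> \<sigma> \<and> wnorm \<rho> \<sigma> (ind F) \<le> K * N"
proof -
  obtain K where K: "K > 0" "\<And>(F :: 'n stem) x N.
     (\<And>A. norm (F A (Complex (fst x) (norm (snd x)))) \<le> N) \<Longrightarrow> norm (ind F x) \<le> K * N"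
    using ind_bound by blast
  have "ind F \<in> A_space \<rho> \<sigma> \<and> wnorm \<rho> \<sigma> (ind F) \<le> K * N"
    if "stem F" "\<And>A z. norm (F A z) \<le> N * exp (\<sigma> * (norm z powr \<rho> (norm z)))"
    for F :: "'n stem" and \<rho> \<sigma> N
  proof -
    have "norm (ind F x) \<le> (K * N) * exp (\<sigma> * norm x powr \<rho> (norm x))" for x
      using K(2)[of F x, OF that(2)] by (simp add: norm_pt_Complex mult.assoc)
    then show ?thesis using A_spaceI[OF slice_monogenic_ind[OF that(1)]] by blast
  qed
  with K(1) show ?thesis by blast
qed

section \<open>Monomials and binomial inversion\<close>

definition smono :: "nat \<Rightarrow> 'n::{finite,linorder} stem" where
  "smono m A z = (if A = {} then z ^ m else 0)"

lemma stem_smono: "stem (smono m)"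
proof -
  have "smono m A = (if A = {} then (\<lambda>z. z ^ m) else (\<lambda>z. 0))" for A :: "'a set"
    by (auto simp: smono_def)
  then show ?thesis unfolding stem_def by (auto intro!: holomorphic_intros)
qed

text \<open>A stem concentrated on the empty index set is a complex scalar; all signs against the
  empty set are 1, so it acts by multiplication, and on either side.\<close>

lemma sprod_scalar_left:
  fixes G :: "'n::{finite,linorder} stem"
  shows "sprod (\<lambda>A z. if A = {} then c z else 0) G C z = c z * G C z"
proof -
  have "sprod (\<lambda>A z. if A = {} then c z else 0) G C z
      = (\<Sum>A\<in>(UNIV :: 'n set set). if A = {} then c z * G C z else 0)"
    unfolding sprod_def clprod_alt by (intro sum.cong) auto
  then show ?thesis by simp
qed

lemma sprod_scalar_right:
  fixes G :: "'n::{finite,linorder} stem"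
  shows "sprod G (\<lambda>A z. if A = {} then c z else 0) C z = G C z * c z"
proof -
  have "sprod G (\<lambda>A z. if A = {} then c z else 0) C z
      = (\<Sum>A\<in>UNIV. if A = C then G C z * c z else 0)"
    unfolding sprod_def clprod_alt by (intro sum.cong) auto
  then show ?thesis by simp
qed

lemma higher_deriv_monom:
  "(deriv ^^ l) (\<lambda>z::complex. z ^ m) = (\<lambda>z. if l \<le> m then fact m / fact (m - l) * z ^ (m - l) else 0)"
proof (induction l)
  case (Suc l)
  have "deriv (\<lambda>z::complex. if l \<le> m then fact m / fact (m - l) * z ^ (m - l) else 0) z
     = (if Suc l \<le> m then fact m / fact (m - Suc l) * z ^ (m - Suc l) else 0)" for z
  proof (cases "Suc l \<le> m")
    case True
    then obtain j where j: "m - l = Suc j" "m - Suc l = j" by (metis Suc_diff_le diff_Suc_Suc)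
    have "((\<lambda>z::complex. fact m / fact (Suc j) * z ^ Suc j) has_field_derivative
        (fact m / fact (Suc j) * (of_nat (Suc j) * z ^ j))) (at z)"
    proof (rule DERIV_cmult)
      have "((\<lambda>z::complex. z ^ Suc j) has_field_derivative of_nat (Suc j) * (1 * z ^ (Suc j - Suc 0))) (at z)"
        by (rule DERIV_power[OF DERIV_ident])
      then show "((\<lambda>z::complex. z ^ Suc j) has_field_derivative of_nat (Suc j) * z ^ j) (at z)"
        by (simp del: power_Suc of_nat_Suc)
    qed
    moreover have "fact m / fact (Suc j) * (of_nat (Suc j) * z ^ j) = fact m / fact j * z ^ j"
      by (simp del: of_nat_Suc)
    ultimately show ?thesis using True j by (simp add: DERIV_imp_deriv del: power_Suc fact_Suc)
  next
    case False
    then show ?thesis by (cases "l = m") auto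
  qed
  then show ?case by (simp add: Suc fun_eq_iff)
qed simp

lemma sderiv_smono:
  "sderiv l (smono m) = (\<lambda>A z. if A = {} then (if l \<le> m then fact m / fact (m - l) * z ^ (m - l) else 0) else 0)"
proof (intro ext)
  fix A z
  show "sderiv l (smono m) A z = (if A = {} then (if l \<le> m then fact m / fact (m - l) * z ^ (m - l) else 0) else 0)"
  proof (cases "A = {}")
    case True
    then have "smono m A = (\<lambda>z. z ^ m)" by (simp add: smono_def fun_eq_iff)
    then show ?thesis using True by (simp add: sderiv_def higher_deriv_monom)
  next
    case False
    then have "smono m A = (\<lambda>z. 0)" by (simp add: smono_def fun_eq_iff)
    then show ?thesis using False by (simp add: sderiv_def)
  qed
qed

text \<open>Regrouping \<open>(m choose l) * (l choose k)\<close> as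
  \<open>(m choose k) * ((m - k) choose (l - k))\<close> and exchanging the sums leaves the inner
  sum \<open>(- z + z) ^ (m - k)\<close>, which vanishes unless \<open>k = m\<close>.\<close>

lemma binomial_inversion:
  fixes h :: "nat \<Rightarrow> complex"
  shows "(\<Sum>l\<le>m. (\<Sum>k\<le>l. of_nat (l choose k) * (- z) ^ (l - k) * h k) / fact l *
           (fact m / fact (m - l) * z ^ (m - l))) = h m"
proof -
  define t where "t l k = of_nat (m choose k) * h k * (of_nat ((m - k) choose (l - k)) * (- z) ^ (l - k) * z ^ (m - l))" for l k
  have "(\<Sum>k\<le>l. of_nat (l choose k) * (- z) ^ (l - k) * h k) / fact l *
           (fact m / fact (m - l) * z ^ (m - l)) = (\<Sum>k\<le>m. if k \<le> l then t l k else 0)" if "l \<le> m" for l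
  proof -
    have "(\<Sum>k\<le>l. of_nat (l choose k) * (- z) ^ (l - k) * h k) / fact l *
           (fact m / fact (m - l) * z ^ (m - l))
      = (\<Sum>k\<le>l. of_nat (l choose k) * (- z) ^ (l - k) * h k) * (of_nat (m choose l) * z ^ (m - l))"
      by (simp add: binomial_fact[OF that])
    also have "\<dots> = (\<Sum>k\<le>l. t l k)"
      unfolding sum_distrib_right
    proof (rule sum.cong[OF refl])
      fix k assume "k \<in> {..l}"
      then have eq: "of_nat (m choose l) * of_nat (l choose k) = (of_nat (m choose k) * of_nat ((m - k) choose (l - k)) :: complex)"
        using choose_mult[of k l m] that by (simp flip: of_nat_mult)
      have "of_nat (l choose k) * (- z) ^ (l - k) * h k * (of_nat (m choose l) * z ^ (m - l))
          = (of_nat (m choose l) * of_nat (l choose k)) * (h k * (- z) ^ (l - k) * z ^ (m - l))"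
        by (simp only: mult_ac)
      also have "\<dots> = t l k" unfolding eq t_def by (simp only: mult_ac)
      finally show "of_nat (l choose k) * (- z) ^ (l - k) * h k * (of_nat (m choose l) * z ^ (m - l)) = t l k" .
    qed
    also have "\<dots> = (\<Sum>k\<le>m. if k \<le> l then t l k else 0)"
      using that by (intro sum.mono_neutral_cong_left) auto
    finally show ?thesis .
  qed
  then have "(\<Sum>l\<le>m. (\<Sum>k\<le>l. of_nat (l choose k) * (- z) ^ (l - k) * h k) / fact l *
           (fact m / fact (m - l) * z ^ (m - l))) = (\<Sum>l\<le>m. \<Sum>k\<le>m. if k \<le> l then t l k else 0)"
    by simp
  also have "\<dots> = (\<Sum>k\<le>m. \<Sum>l\<le>m. if k \<le> l then t l k else 0)" by (rule sum.swap)
  also have "\<dots> = (\<Sum>k\<le>m. if k = m then h m else 0)"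
  proof (rule sum.cong[OF refl])
    fix k assume k: "k \<in> {..m}"
    have "(\<Sum>l\<le>m. if k \<le> l then t l k else 0) = (\<Sum>l=0+k..(m-k)+k. t l k)"
      using k by (intro sum.mono_neutral_cong_right) auto
    also have "\<dots> = (\<Sum>j\<le>m-k. t (j + k) k)"
      unfolding sum.shift_bounds_cl_nat_ivl by (simp add: atLeast0AtMost)
    also have "\<dots> = of_nat (m choose k) * h k * (\<Sum>j\<le>m-k. of_nat ((m - k) choose j) * (- z) ^ j * z ^ (m - k - j))"
      unfolding t_def sum_distrib_left by (intro sum.cong) (auto simp: diff_diff_eq add.commute)
    also have "(\<Sum>j\<le>m-k. of_nat ((m - k) choose j) * (- z) ^ j * z ^ (m - k - j)) = (- z + z) ^ (m - k)"
      by (rule binomial_ring[symmetric])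
    finally show "(\<Sum>l\<le>m. if k \<le> l then t l k else 0) = (if k = m then h m else 0)"
      using k by (auto simp: power_0_left)
  qed
  finally show ?thesis by simp
qed

definition opT :: "(nat \<Rightarrow> 'n::{finite,linorder} stem) \<Rightarrow> ('n pt \<Rightarrow> 'n clif) \<Rightarrow> 'n pt \<Rightarrow> 'n clif" where
  "opT U f = ind (opS U (stem_of f))"

text \<open>Conjugation symmetry makes the Taylor coefficients at 0 real, so taking the real part
  loses nothing and they assemble to an element of the Clifford algebra.\<close>

definition taylor_coeff :: "'n::{finite,linorder} stem \<Rightarrow> nat \<Rightarrow> 'n clif" where
  "taylor_coeff F m = (\<chi> A. Re (sderiv m F A 0 / fact m))"

lemma of_real_taylor_coeff:
  assumes "stem F"
  shows "of_real (taylor_coeff F m $ A) = sderiv m F A 0 / fact m"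
proof -
  have "cnj (sderiv m F A 0) = sderiv m F A 0"
    using stem_cnj[OF stem_sderiv[OF assms], of m A 0] by simp
  then have "sderiv m F A 0 \<in> \<real>" by (simp add: Reals_cnj_iff)
  moreover have "(fact m :: complex) \<in> \<real>" using Reals_of_real[of "fact m"] by simp
  ultimately have "sderiv m F A 0 / fact m \<in> \<real>" by (rule Reals_divide)
  then show ?thesis unfolding taylor_coeff_def vec_lambda_beta by (rule of_real_Re)
qed

lemma partial_series_ind:
  assumes "\<And>l. stem (U l)" "stem F"
  shows "partial_series (\<lambda>l. ind (U l)) (ind F) n = ind (\<lambda>A z. \<Sum>l<n. sprod (U l) (sderiv l F) A z)"
  unfolding partial_series_def dx0_ind[OF assms(2)] star_L_ind[OF assms(1) stem_sderiv[OF assms(2)]]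
  by (simp add: fun_eq_iff ind_sum)

section \<open>Operators between the weighted spaces\<close>

locale weights = growth "\<lambda>r. r powr \<rho>1' r" "\<lambda>r. r powr \<rho>2' r" g for \<rho>1' \<rho>2' g
begin

lemma sA1_iff: "stem F \<Longrightarrow> ind F \<in> A_plus0 \<rho>1' \<longleftrightarrow> sA1 F"
  for F :: "'n::{finite,linorder} stem"
proof -
  assume st: "stem F"
  show ?thesis
  proof
    assume *: "ind F \<in> A_plus0 \<rho>1'"
    have "\<exists>N. \<forall>A z. norm (F A z) \<le> N * exp (\<epsilon> * (norm z powr \<rho>1' (norm z)))" if "\<epsilon> > 0" for \<epsilon>
      using wnorm_stem[where ?'n='n] st A_plus0D[OF * that] by blast
    then show "sA1 F" using st by (simp add: sA1_def)
  next
    assume *: "sA1 F"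
    have "ind F \<in> A_space \<rho>1' \<epsilon>" if e: "\<epsilon> > 0" for \<epsilon>
    proof -
      obtain N where "\<And>A z. norm (F A z) \<le> N * exp (\<epsilon> * (norm z powr \<rho>1' (norm z)))"
        using * e unfolding sA1_def by blast
      then show ?thesis using stem_wnorm[where ?'n='n] st by blast
    qed
    then show "ind F \<in> A_plus0 \<rho>1'" by (simp add: A_plus0_def)
  qed
qed

lemma stem_of_A1:
  assumes "f \<in> A_plus0 \<rho>1'"
  shows "stem (stem_of f)" "ind (stem_of f) = f" "sA1 (stem_of f)"
  using stem_of[OF A_plus0_slice[OF assms]] sA1_iff[of "stem_of f"] assms by auto

lemma opT_partial_bound:
  fixes U :: "nat \<Rightarrow> 'n::{finite,linorder} stem"
  assumes U: "scoeff U" and \<sigma>: "\<sigma> > 0"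
  shows "\<exists>\<epsilon>>0. \<exists>C>0. \<forall>f\<in>A_plus0 \<rho>1'. \<forall>n.
     (\<lambda>x. opT U f x - partial_series (\<lambda>l. ind (U l)) f n x) \<in> A_space \<rho>2' \<sigma> \<and>
     wnorm \<rho>2' \<sigma> (\<lambda>x. opT U f x - partial_series (\<lambda>l. ind (U l)) f n x) \<le> C * wnorm \<rho>1' \<epsilon> f * (1/2) ^ n"
proof -
  obtain K1 where K1: "K1 > 0" "\<And>\<rho> \<sigma> (F :: 'n stem) A z. stem F \<Longrightarrow> ind F \<in> A_space \<rho> \<sigma> \<Longrightarrow>
     norm (F A z) \<le> K1 * wnorm \<rho> \<sigma> (ind F) * exp (\<sigma> * (norm z powr \<rho> (norm z)))"
    using wnorm_stem[where ?'n='n] by blast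
  obtain K2 where K2: "K2 > 0" "\<And>\<rho> \<sigma> N (F :: 'n stem). stem F \<Longrightarrow>
     (\<And>A z. norm (F A z) \<le> N * exp (\<sigma> * (norm z powr \<rho> (norm z)))) \<Longrightarrow>
     ind F \<in> A_space \<rho> \<sigma> \<and> wnorm \<rho> \<sigma> (ind F) \<le> K2 * N"
    using stem_wnorm[where ?'n='n] by blast
  from opS_bound[OF U \<sigma>] obtain \<epsilon> C where e: "\<epsilon> > 0" "C > 0" and *: "\<forall>F N. stem F \<longrightarrow>
     (\<forall>A z. norm (F A z) \<le> N * exp (\<epsilon> * (norm z powr \<rho>1' (norm z)))) \<longrightarrow>
     (\<forall>n A z. norm (opS U F A z - (\<Sum>l<n. sprod (U l) (sderiv l F) A z))
        \<le> C * N * (1/2) ^ n * exp (\<sigma> * (norm z powr \<rho>2' (norm z))))"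
    by (elim exE conjE) (rule that)
  have stU: "stem (U l)" for l using U by (simp add: scoeff_def)
  have "(\<lambda>x. opT U f x - partial_series (\<lambda>l. ind (U l)) f n x) \<in> A_space \<rho>2' \<sigma> \<and>
     wnorm \<rho>2' \<sigma> (\<lambda>x. opT U f x - partial_series (\<lambda>l. ind (U l)) f n x) \<le> (K2 * C * K1) * wnorm \<rho>1' \<epsilon> f * (1/2) ^ n"
    if f: "f \<in> A_plus0 \<rho>1'" for f n
  proof -
    define F where "F = stem_of f"
    have F: "stem F" "ind F = f" "sA1 F" using stem_of_A1[OF f] by (simp_all add: F_def)
    define D where "D = (\<lambda>A z. opS U F A z - (\<Sum>l<n. sprod (U l) (sderiv l F) A z))"
    have stD: "stem D"
      unfolding D_def by (intro stem_diff stem_sum stem_opS U F stem_sprod stU stem_sderiv)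
    have D: "(\<lambda>x. opT U f x - partial_series (\<lambda>l. ind (U l)) f n x) = ind D"
      using partial_series_ind[where n = n, OF stU F(1)] F(2)
      by (simp add: D_def opT_def ind_diff fun_eq_iff flip: F_def)
    have "norm (D A z) \<le> (C * (K1 * wnorm \<rho>1' \<epsilon> f) * (1/2) ^ n) * exp (\<sigma> * (norm z powr \<rho>2' (norm z)))" for A z
      unfolding D_def by (rule *[rule_format, OF F(1)]) (use K1(2)[OF F(1)] A_plus0D[OF f e(1)] F(2) in auto)
    from K2(2)[OF stD this] show ?thesis unfolding D by (simp add: mult_ac)
  qed
  moreover have "K2 * C * K1 > 0" using K1 K2 e by simp
  ultimately show ?thesis using e(1) by blast
qed

lemma partial_series_0: "partial_series u f 0 = (\<lambda>x. 0)"
  by (simp add: partial_series_def)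

lemma opT_bound:
  assumes U: "scoeff U" and \<sigma>: "\<sigma> > 0"
  shows "\<exists>\<epsilon>>0. \<exists>C>0. \<forall>f\<in>A_plus0 \<rho>1'. opT U f \<in> A_space \<rho>2' \<sigma> \<and>
     wnorm \<rho>2' \<sigma> (opT U f) \<le> C * wnorm \<rho>1' \<epsilon> f"
proof -
  obtain \<epsilon> C where e: "\<epsilon> > 0" "C > 0" and *: "\<forall>f\<in>A_plus0 \<rho>1'. \<forall>n.
     (\<lambda>x. opT U f x - partial_series (\<lambda>l. ind (U l)) f n x) \<in> A_space \<rho>2' \<sigma> \<and>
     wnorm \<rho>2' \<sigma> (\<lambda>x. opT U f x - partial_series (\<lambda>l. ind (U l)) f n x) \<le> C * wnorm \<rho>1' \<epsilon> f * (1/2) ^ n"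
    using opT_partial_bound[OF U \<sigma>] by blast
  have "opT U f \<in> A_space \<rho>2' \<sigma> \<and> wnorm \<rho>2' \<sigma> (opT U f) \<le> C * wnorm \<rho>1' \<epsilon> f" if "f \<in> A_plus0 \<rho>1'" for f
    using *[rule_format, OF that, of 0] by (simp add: partial_series_0)
  then show ?thesis using e by blast
qed

lemma opT_mem:
  assumes "scoeff U" "f \<in> A_plus0 \<rho>1'"
  shows "opT U f \<in> A_plus0 \<rho>2'"
  unfolding A_plus0_def using opT_bound[OF assms(1)] assms(2) by blast

lemma opT_diff:
  assumes "scoeff U" "f \<in> A_plus0 \<rho>1'" "h \<in> A_plus0 \<rho>1'"
  shows "opT U (\<lambda>x. f x - h x) = (\<lambda>x. opT U f x - opT U h x)"
proof -
  note F = stem_of_A1[OF assms(2)] and G = stem_of_A1[OF assms(3)]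
  have "(\<lambda>x. f x - h x) = ind (\<lambda>A z. stem_of f A z - stem_of h A z)"
    by (simp add: fun_eq_iff ind_diff F G)
  then have eq: "stem_of (\<lambda>x. f x - h x) = (\<lambda>A z. stem_of f A z - stem_of h A z)"
    by (simp only: stem_of_ind stem_diff stem_add stem_sprod stem_sconst F G)
  show ?thesis unfolding opT_def eq
    by (simp add: stem_of_ind stem_diff F G opS_diff[OF assms(1)] ind_diff fun_eq_iff)
qed

lemma opT_add:
  assumes "scoeff U" "f \<in> A_plus0 \<rho>1'" "h \<in> A_plus0 \<rho>1'"
  shows "opT U (\<lambda>x. f x + h x) = (\<lambda>x. opT U f x + opT U h x)"
proof -
  note F = stem_of_A1[OF assms(2)] and G = stem_of_A1[OF assms(3)]
  have "(\<lambda>x. f x + h x) = ind (\<lambda>A z. stem_of f A z + stem_of h A z)"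
    by (simp add: fun_eq_iff ind_add F G)
  then have eq: "stem_of (\<lambda>x. f x + h x) = (\<lambda>A z. stem_of f A z + stem_of h A z)"
    by (simp only: stem_of_ind stem_diff stem_add stem_sprod stem_sconst F G)
  show ?thesis unfolding opT_def eq
    by (simp add: stem_of_ind stem_add F G opS_add[OF assms(1)] ind_add fun_eq_iff)
qed

lemma opT_rmult:
  assumes "scoeff U" "f \<in> A_plus0 \<rho>1'"
  shows "opT U (\<lambda>x. cmult (f x) a) = (\<lambda>x. cmult (opT U f x) a)"
proof -
  note F = stem_of_A1[OF assms(2)]
  have "(\<lambda>x. cmult (f x) a) = ind (sprod (stem_of f) (sconst a))"
    by (simp add: fun_eq_iff ind_sprod_sconst F)
  then have eq: "stem_of (\<lambda>x. cmult (f x) a) = (sprod (stem_of f) (sconst a))"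
    by (simp only: stem_of_ind stem_diff stem_add stem_sprod stem_sconst F)
  show ?thesis unfolding opT_def eq
    by (simp add: stem_of_ind stem_sprod stem_sconst F opS_sprod_sconst[OF assms(1)] ind_sprod_sconst fun_eq_iff)
qed

lemma opT_right_linear:
  assumes "scoeff U"
  shows "right_linear_on (A_plus0 \<rho>1') (opT U)"
  unfolding right_linear_on_def
  by (simp add: opT_add[OF assms] opT_rmult[OF assms] A_plus0_rmult)

text \<open>A partial sum is the full operator minus the remainder, and both have already been
  estimated.\<close>

lemma partial_series_mem:
  assumes U: "scoeff U" and f: "f \<in> A_plus0 \<rho>1'"
  shows "partial_series (\<lambda>l. ind (U l)) f n \<in> A_plus0 \<rho>2'"
  unfolding A_plus0_def
proof (intro CollectI allI impI)
  fix \<sigma> :: real assume s: "\<sigma> > 0"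
  then have "(\<lambda>x. opT U f x - partial_series (\<lambda>l. ind (U l)) f n x) \<in> A_space \<rho>2' \<sigma>"
    using opT_partial_bound[OF U s] f by blast
  from A_space_diff(1)[OF A_plus0D[OF opT_mem[OF U f] s] this]
  show "partial_series (\<lambda>l. ind (U l)) f n \<in> A_space \<rho>2' \<sigma>" by simp
qed

lemma opT_limit:
  assumes U: "scoeff U" and f: "f \<in> A_plus0 \<rho>1'"
  shows "limitin (A_top \<rho>2') (partial_series (\<lambda>l. ind (U l)) f) (opT U f) sequentially"
proof (rule limitin_A_topI[OF opT_mem[OF U f] partial_series_mem[OF U f]])
  fix \<sigma> :: real assume s: "\<sigma> > 0"
  let ?d = "\<lambda>n x. opT U f x - partial_series (\<lambda>l. ind (U l)) f n x"
  let ?d' = "\<lambda>n x. partial_series (\<lambda>l. ind (U l)) f n x - opT U f x"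
  obtain \<epsilon> C where *: "\<And>n. ?d n \<in> A_space \<rho>2' \<sigma>" "\<And>n. wnorm \<rho>2' \<sigma> (?d n) \<le> C * wnorm \<rho>1' \<epsilon> f * (1/2) ^ n"
    using opT_partial_bound[OF U s] f by blast
  have mem: "?d' n \<in> A_space \<rho>2' \<sigma>" for n
    by (rule A_plus0D[OF A_plus0_diff[OF partial_series_mem[OF U f] opT_mem[OF U f]] s])
  have "wnorm \<rho>2' \<sigma> (?d' n) \<le> C * wnorm \<rho>1' \<epsilon> f * (1/2) ^ n" for n
  proof (rule order_trans[OF _ *(2)], rule A_spaceI(2))
    show "slice_monogenic (?d' n)" using mem by (simp add: A_space_def)
    show "norm (?d' n x) \<le> wnorm \<rho>2' \<sigma> (?d n) * exp (\<sigma> * norm x powr \<rho>2' (norm x))" for x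
      using wnorm_bound[OF *(1)[of n], of x] by (simp add: norm_minus_commute)
  qed
  then show "(\<lambda>n. wnorm \<rho>2' \<sigma> (?d' n)) \<longlonglongrightarrow> 0"
    by (intro tendsto_zero_half_power[OF wnorm_nonneg[OF mem]])
qed

lemma opT_continuous:
  fixes U :: "nat \<Rightarrow> 'n::{finite,linorder} stem"
  assumes U: "scoeff U"
  shows "continuous_map (A_top \<rho>1') (A_top \<rho>2') (opT U)"
proof (rule continuous_map_A_topI[OF opT_mem[OF U]])
  fix \<sigma> :: real assume s: "\<sigma> > 0"
  obtain \<epsilon> C where e: "\<epsilon> > 0" "C > 0" and *: "\<And>f. f \<in> A_plus0 \<rho>1' \<Longrightarrow> wnorm \<rho>2' \<sigma> (opT U f) \<le> C * wnorm \<rho>1' \<epsilon> f"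
    using opT_bound[OF U s] by blast
  have "wnorm \<rho>2' \<sigma> (\<lambda>x. opT U g x - opT U f x) \<le> C * wnorm \<rho>1' \<epsilon> (\<lambda>x. g x - f x)"
    if "f \<in> A_plus0 \<rho>1'" "g \<in> A_plus0 \<rho>1'" for f g
    using *[OF A_plus0_diff[OF that(2,1)]] by (simp add: opT_diff[OF U that(2,1)])
  then show "\<exists>\<epsilon>>0. \<exists>C>0. \<forall>f\<in>A_plus0 \<rho>1'. \<forall>g\<in>A_plus0 \<rho>1'.
       wnorm \<rho>2' \<sigma> (\<lambda>x. opT U g x - opT U f x) \<le> C * wnorm \<rho>1' \<epsilon> (\<lambda>x. g x - f x)"
    using e by blast
qed

text \<open>The two rates differ by the factor \<open>E\<close>:
  \<open>\<eta> = \<epsilon> / E\<close> in one direction and \<open>\<epsilon> = \<eta> * E\<close>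
  in the other.\<close>

lemma coeff_cond_iff:
  fixes U :: "nat \<Rightarrow> 'n::{finite,linorder} stem"
  assumes U: "\<And>l. stem (U l)" and G: "\<And>l. Gseq \<rho>h \<rho> l = (g l / E) ^ l" and E: "E > 0"
  shows "coeff_cond \<rho>2' \<rho>h \<rho> (\<lambda>l. ind (U l)) \<longleftrightarrow> scoeff U"
proof
  assume *: "coeff_cond \<rho>2' \<rho>h \<rho> (\<lambda>l. ind (U l))"
  obtain K where K: "K > 0" "\<And>\<rho> \<sigma> (F :: 'n stem) A z. stem F \<Longrightarrow> ind F \<in> A_space \<rho> \<sigma> \<Longrightarrow>
     norm (F A z) \<le> K * wnorm \<rho> \<sigma> (ind F) * exp (\<sigma> * (norm z powr \<rho> (norm z)))"
    using wnorm_stem[where ?'n='n] by blast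
  have "\<exists>\<eta>>0. \<exists>C>0. \<forall>l A z. norm (U l A z) \<le> C * (\<eta> * g l) ^ l / fact l * exp (\<sigma> * (norm z powr \<rho>2' (norm z)))"
    if \<sigma>: "\<sigma> > 0" for \<sigma>
  proof -
    from *[unfolded coeff_cond_def G, rule_format, OF \<sigma>]
    obtain \<epsilon> C where e: "\<epsilon> > 0" "C > 0" and "\<forall>l. ind (U l) \<in> A_space \<rho>2' \<sigma> \<and>
      wnorm \<rho>2' \<sigma> (ind (U l)) \<le> C * (g l / E) ^ l / fact l * \<epsilon> ^ l"
      by (elim exE conjE) (rule that)
    then have u: "ind (U l) \<in> A_space \<rho>2' \<sigma>"
      "wnorm \<rho>2' \<sigma> (ind (U l)) \<le> C * (g l / E) ^ l / fact l * \<epsilon> ^ l" for l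
      by simp_all
    have "norm (U l A z) \<le> (K * C) * (\<epsilon> / E * g l) ^ l / fact l * exp (\<sigma> * (norm z powr \<rho>2' (norm z)))" for l A z
    proof -
      have "norm (U l A z) \<le> K * wnorm \<rho>2' \<sigma> (ind (U l)) * exp (\<sigma> * (norm z powr \<rho>2' (norm z)))"
        by (rule K(2)[OF U u(1)])
      also have "\<dots> \<le> K * (C * (g l / E) ^ l / fact l * \<epsilon> ^ l) * exp (\<sigma> * (norm z powr \<rho>2' (norm z)))"
        using K(1) by (intro mult_right_mono mult_left_mono u) auto
      also have "\<dots> = (K * C) * (\<epsilon> / E * g l) ^ l / fact l * exp (\<sigma> * (norm z powr \<rho>2' (norm z)))"
        by (simp add: power_mult_distrib power_divide)
      finally show ?thesis .
    qed
    moreover have "\<epsilon> / E > 0" "K * C > 0" using e E K by auto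
    ultimately show ?thesis by blast
  qed
  then show "scoeff U" using U by (simp add: scoeff_def)
next
  assume *: "scoeff U"
  obtain K where K: "K > 0" "\<And>\<rho> \<sigma> N (F :: 'n stem). stem F \<Longrightarrow>
     (\<And>A z. norm (F A z) \<le> N * exp (\<sigma> * (norm z powr \<rho> (norm z)))) \<Longrightarrow>
     ind F \<in> A_space \<rho> \<sigma> \<and> wnorm \<rho> \<sigma> (ind F) \<le> K * N"
    using stem_wnorm[where ?'n='n] by blast
  show "coeff_cond \<rho>2' \<rho>h \<rho> (\<lambda>l. ind (U l))"
    unfolding coeff_cond_def
  proof (intro allI impI)
    fix \<sigma> :: real assume \<sigma>: "\<sigma> > 0"
    obtain \<eta> C where e: "\<eta> > 0" "C > 0" and
      u: "\<And>l A z. norm (U l A z) \<le> C * (\<eta> * g l) ^ l / fact l * exp (\<sigma> * (norm z powr \<rho>2' (norm z)))"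
      using * \<sigma> unfolding scoeff_def by blast
    have "ind (U l) \<in> A_space \<rho>2' \<sigma> \<and> wnorm \<rho>2' \<sigma> (ind (U l)) \<le> (K * C) * Gseq \<rho>h \<rho> l / fact l * (\<eta> * E) ^ l" for l
      using K(2)[OF U u] E by (simp add: G power_mult_distrib power_divide mult_ac)
    moreover have "\<eta> * E > 0" "K * C > 0" using e E K by auto
    ultimately show "\<exists>\<epsilon>>0. \<exists>C>0. \<forall>l. ind (U l) \<in> A_space \<rho>2' \<sigma> \<and>
        wnorm \<rho>2' \<sigma> (ind (U l)) \<le> C * Gseq \<rho>h \<rho> l / fact l * \<epsilon> ^ l" by blast
  qed
qed

section \<open>Density of polynomials\<close>

lemma smono_bound:
  assumes "\<sigma> > 0"
  shows "\<exists>C>0. \<forall>m A z. norm (smono m A z) \<le> (C * g m) ^ m * exp (\<sigma> * (norm z powr \<rho>1' (norm z)))"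
proof -
  obtain C where C: "C > 0" "\<And>l r. r \<ge> 0 \<Longrightarrow> r ^ l \<le> (C * g l) ^ l * exp (\<sigma> * (r powr \<rho>1' r))"
    using power_le[OF assms] by blast
  have "norm (smono m A z) \<le> (C * g m) ^ m * exp (\<sigma> * (norm z powr \<rho>1' (norm z)))" for m A z
    using C(2)[of "norm z" m] C(1) g_pos[of m] by (auto simp: smono_def norm_power)
  then show ?thesis using C(1) by blast
qed

lemma smono_mem: "ind (smono m) \<in> A_plus0 \<rho>1'"
  unfolding sA1_iff[OF stem_smono] sA1_def
proof (intro conjI allI impI stem_smono)
  fix \<epsilon> :: real assume "\<epsilon> > 0"
  from smono_bound[OF this] obtain C where
    "\<forall>m (A :: 'a set) z. norm (smono m A z) \<le> (C * g m) ^ m * exp (\<epsilon> * (norm z powr \<rho>1' (norm z)))"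
    by (elim exE conjE) (rule that)
  then show "\<exists>N. \<forall>(A :: 'a set) z. norm (smono m A z) \<le> N * exp (\<epsilon> * (norm z powr \<rho>1' (norm z)))"
    by (intro exI[of _ "(C * g m) ^ m"]) simp
qed

lemma taylor_mem: "(\<lambda>x. \<Sum>m<n. cmult (ind (smono m) x) (a m)) \<in> A_plus0 \<rho>1'"
proof (induction n)
  case (Suc n)
  then show ?case using A_plus0_add[OF Suc A_plus0_rmult[OF smono_mem]] by simp
qed (simp add: A_plus0_zero)

text \<open>The Cauchy estimate at 0 bounds the \<open>m\<close>-th coefficient by a multiple of
  \<open>(\<delta> / g m) ^ m\<close>, and \<open>power_le\<close> bounds \<open>z ^ m\<close> by
  \<open>(C1 * g m) ^ m\<close> times the weight. The choice of \<open>\<delta>\<close> makes the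
  terms decay like \<open>(1/2) ^ m\<close> in norm.\<close>

lemma taylor_limit:
  fixes f :: "'n::{finite,linorder} pt \<Rightarrow> 'n clif"
  assumes f: "f \<in> A_plus0 \<rho>1'" and \<epsilon>: "\<epsilon> > 0"
  shows "(\<lambda>n. wnorm \<rho>1' \<epsilon> (\<lambda>x. f x - (\<Sum>m<n. cmult (ind (smono m) x) (taylor_coeff (stem_of f) m)))) \<longlonglongrightarrow> 0"
proof -
  define F where "F = stem_of f"
  have F: "stem F" "ind F = f" "sA1 F" using stem_of_A1[OF f] by (simp_all add: F_def)
  obtain C1 where C1: "C1 > 0" "\<And>l r. r \<ge> 0 \<Longrightarrow> r ^ l \<le> (C1 * g l) ^ l * exp (\<epsilon> * (r powr \<rho>1' r))"
    using power_le[OF \<epsilon>] by blast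
  define \<delta> where "\<delta> = 1 / (2 * C1)"
  have \<delta>: "\<delta> > 0" using C1 by (simp add: \<delta>_def)
  from cauchy_bound[OF zero_less_one \<delta>] obtain \<epsilon>' C2 where e': "\<epsilon>' > 0" and C2: "C2 > 0"
    and Fb: "\<forall>F N. F holomorphic_on UNIV \<longrightarrow> (\<forall>z. norm (F z) \<le> N * exp (\<epsilon>' * (norm z powr \<rho>1' (norm z)))) \<longrightarrow>
       (\<forall>l z. norm ((deriv ^^ l) F z) \<le> C2 * N * fact l * (\<delta> / g l) ^ l * exp (1 * (norm z powr \<rho>1' (norm z))))"
    by (elim exE conjE) (rule that)
  obtain N where N: "\<And>A z. norm (F A z) \<le> N * exp (\<epsilon>' * (norm z powr \<rho>1' (norm z)))"
    using F(3) e' unfolding sA1_def by blast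
  have N0: "N \<ge> 0" using order_trans[OF norm_ge_zero N[of undefined 0]] by (simp add: zero_le_mult_iff)
  let ?c = "\<lambda>m A. sderiv m F A 0 / fact m"
  have term_le: "norm (?c m A * z ^ m) \<le> C2 * N * exp (\<epsilon> * (norm z powr \<rho>1' (norm z))) * (1/2) ^ m" for m A z
  proof -
    have "norm (sderiv m F A 0) \<le> C2 * N * fact m * (\<delta> / g m) ^ m"
      \<comment> \<open>At the origin the weight is \<open>exp 0 = 1\<close>, so the exponent 1
        chosen for the Cauchy estimate has no effect.\<close>
      using Fb[rule_format, OF stem_holo[OF F(1)] N, of m A 0] by (simp add: sderiv_def)
    then have 1: "norm (?c m A) \<le> C2 * N * (\<delta> / g m) ^ m"
      by (simp add: norm_divide field_simps)
    have "norm (?c m A * z ^ m) \<le> (C2 * N * (\<delta> / g m) ^ m) * ((C1 * g m) ^ m * exp (\<epsilon> * (norm z powr \<rho>1' (norm z))))"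
      unfolding norm_mult norm_power using C2 N0 \<delta> g_pos[of m]
      by (intro mult_mono 1 C1(2)) auto
    also have "\<dots> = C2 * N * exp (\<epsilon> * (norm z powr \<rho>1' (norm z))) * ((\<delta> / g m) * (C1 * g m)) ^ m"
      unfolding power_mult_distrib[of "\<delta> / g m"] by (simp only: mult_ac)
    also have "(\<delta> / g m) * (C1 * g m) = 1 / 2" using C1 g_pos[of m] by (simp add: \<delta>_def)
    finally show ?thesis .
  qed
  define D where "D n = (\<lambda>A z. F A z - (\<Sum>m<n. sprod (smono m) (sconst (taylor_coeff F m)) A z))" for n
  have stD: "stem (D n)" for n
    unfolding D_def by (intro stem_diff stem_sum stem_sprod stem_smono stem_sconst F)
  have prod: "sprod (smono m) (sconst (taylor_coeff F m)) A z = ?c m A * z ^ m" for m A z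
    unfolding smono_def[abs_def] sprod_scalar_left by (simp add: sconst_def of_real_taylor_coeff[OF F(1)])
  have Dind: "(\<lambda>x. f x - (\<Sum>m<n. cmult (ind (smono m) x) (taylor_coeff F m))) = ind (D n)" for n
    unfolding D_def by (simp add: fun_eq_iff ind_diff ind_sum ind_sprod_sconst F(2))
  have Dbound: "norm (D n A z) \<le> (2 * C2 * N * (1/2) ^ n) * exp (\<epsilon> * (norm z powr \<rho>1' (norm z)))" for n A z
  proof -
    have "(\<lambda>m. ?c m A * z ^ m) sums F A z"
      using holomorphic_power_series[of "F A" 0 "norm z + 1" z] stem_holo[OF F(1)]
      by (simp add: sderiv_def)
    then have "F A z = (\<Sum>m. ?c m A * z ^ m)" by (simp add: sums_iff)
    then show ?thesis
      using half_series(2)[of "\<lambda>m. ?c m A * z ^ m", OF term_le, of n] by (simp add: D_def prod mult_ac)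
  qed
  obtain K where K: "K > 0" "\<And>\<rho> \<sigma> N (F :: 'n stem). stem F \<Longrightarrow>
     (\<And>A z. norm (F A z) \<le> N * exp (\<sigma> * (norm z powr \<rho> (norm z)))) \<Longrightarrow>
     ind F \<in> A_space \<rho> \<sigma> \<and> wnorm \<rho> \<sigma> (ind F) \<le> K * N"
    using stem_wnorm[where ?'n='n] by blast
  have D: "ind (D n) \<in> A_space \<rho>1' \<epsilon>" "wnorm \<rho>1' \<epsilon> (ind (D n)) \<le> (K * (2 * C2 * N)) * (1/2) ^ n" for n
    using K(2)[OF stD Dbound] by (simp_all add: mult.assoc)
  show ?thesis unfolding F_def[symmetric] Dind
    by (rule tendsto_zero_half_power[OF wnorm_nonneg[OF D(1)] D(2)])
qed

text \<open>The two maps agree on Taylor polynomials, and the norm estimates carry the agreement to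
  the limit. Since the conclusion is pointwise, one target norm suffices: it dominates the value at
  each point.\<close>

lemma right_linear_eq:
  fixes S T :: "('n::{finite,linorder} pt \<Rightarrow> 'n clif) \<Rightarrow> 'n pt \<Rightarrow> 'n clif"
  assumes lin: "right_linear_on (A_plus0 \<rho>1') S" "right_linear_on (A_plus0 \<rho>1') T"
    and mem: "\<And>f. f \<in> A_plus0 \<rho>1' \<Longrightarrow> S f \<in> A_plus0 \<rho>2'" "\<And>f. f \<in> A_plus0 \<rho>1' \<Longrightarrow> T f \<in> A_plus0 \<rho>2'"
    and bd: "\<exists>\<epsilon>>0. \<exists>C>0. \<forall>f\<in>A_plus0 \<rho>1'. wnorm \<rho>2' 1 (S f) \<le> C * wnorm \<rho>1' \<epsilon> f"
            "\<exists>\<epsilon>>0. \<exists>C>0. \<forall>f\<in>A_plus0 \<rho>1'. wnorm \<rho>2' 1 (T f) \<le> C * wnorm \<rho>1' \<epsilon> f"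
    and mono: "\<And>m. S (ind (smono m)) = T (ind (smono m))"
    and f: "f \<in> A_plus0 \<rho>1'"
  shows "S f = T f"
proof
  fix x :: "'n pt"
  define P where "P n = (\<lambda>x. \<Sum>m<n. cmult (ind (smono m) x) (taylor_coeff (stem_of f) m))" for n
  have P: "P n \<in> A_plus0 \<rho>1'" for n unfolding P_def by (rule taylor_mem)
  have eq: "S (P n) = T (P n)" for n
  proof (induction n)
    case 0
    show ?case using right_linear_on_props(1)[OF lin(1) f, of 0] right_linear_on_props(1)[OF lin(2) f, of 0]
      by (simp add: P_def)
  next
    case (Suc n)
    have "P (Suc n) = (\<lambda>x. P n x + cmult (ind (smono n) x) (taylor_coeff (stem_of f) n))"
      by (simp add: P_def)
    then show ?case
      using right_linear_on_props(2)[OF lin(1) smono_mem] right_linear_on_props(2)[OF lin(2) smono_mem]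
        right_linear_on_props(3)[OF lin(1) P A_plus0_rmult[OF smono_mem]]
        right_linear_on_props(3)[OF lin(2) P A_plus0_rmult[OF smono_mem]] Suc mono by simp
  qed
  obtain \<epsilon>1 C1 where 1: "\<epsilon>1 > 0" "\<And>f. f \<in> A_plus0 \<rho>1' \<Longrightarrow> wnorm \<rho>2' 1 (S f) \<le> C1 * wnorm \<rho>1' \<epsilon>1 f"
    using bd(1) by blast
  obtain \<epsilon>2 C2 where 2: "\<epsilon>2 > 0" "\<And>f. f \<in> A_plus0 \<rho>1' \<Longrightarrow> wnorm \<rho>2' 1 (T f) \<le> C2 * wnorm \<rho>1' \<epsilon>2 f"
    using bd(2) by blast
  let ?e = "exp (1 * norm x powr \<rho>2' (norm x))"
  have "norm (S f x - T f x) \<le> (C1 * wnorm \<rho>1' \<epsilon>1 (\<lambda>x. f x - P n x) + C2 * wnorm \<rho>1' \<epsilon>2 (\<lambda>x. f x - P n x)) * ?e" for n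
  proof -
    have d: "(\<lambda>x. f x - P n x) \<in> A_plus0 \<rho>1'" by (rule A_plus0_diff[OF f P])
    have "S f x - T f x = S (\<lambda>x. f x - P n x) x - T (\<lambda>x. f x - P n x) x"
      by (simp add: right_linear_on_props(4)[OF lin(1) f P] right_linear_on_props(4)[OF lin(2) f P] eq)
    also have "norm \<dots> \<le> norm (S (\<lambda>x. f x - P n x) x) + norm (T (\<lambda>x. f x - P n x) x)"
      by (rule norm_triangle_ineq4)
    also have "\<dots> \<le> wnorm \<rho>2' 1 (S (\<lambda>x. f x - P n x)) * ?e + wnorm \<rho>2' 1 (T (\<lambda>x. f x - P n x)) * ?e"
      by (intro add_mono wnorm_bound A_plus0D[OF mem(1)[OF d]] A_plus0D[OF mem(2)[OF d]]) simp_all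
    also have "\<dots> \<le> C1 * wnorm \<rho>1' \<epsilon>1 (\<lambda>x. f x - P n x) * ?e + C2 * wnorm \<rho>1' \<epsilon>2 (\<lambda>x. f x - P n x) * ?e"
      by (intro add_mono mult_right_mono 1(2)[OF d] 2(2)[OF d]) simp_all
    finally show ?thesis by (simp add: algebra_simps)
  qed
  note le = this
  have lim: "(\<lambda>n. (C1 * wnorm \<rho>1' \<epsilon>1 (\<lambda>x. f x - P n x) + C2 * wnorm \<rho>1' \<epsilon>2 (\<lambda>x. f x - P n x)) * ?e)
     \<longlonglongrightarrow> (C1 * 0 + C2 * 0) * ?e"
    unfolding P_def by (intro tendsto_intros taylor_limit f 1(1) 2(1))
  have "norm (S f x - T f x) \<le> (C1 * 0 + C2 * 0) * ?e"
    by (rule LIMSEQ_le_const[OF lim]) (use le in blast)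
  then show "S f x = T f x" by simp
qed

section \<open>Coefficients of a given operator\<close>

lemma opT_smono:
  assumes V: "scoeff V"
    and V_eq: "\<And>l A z. V l A z = (\<Sum>k\<le>l. of_nat (l choose k) * (- z) ^ (l - k) * H k A z) / fact l"
  shows "opT V (ind (smono m)) = ind (H m)"
proof -
  have "opS V (smono m) A z = H m A z" for A z
  proof -
    have "opS V (smono m) A z = (\<Sum>l\<le>m. sprod (V l) (sderiv l (smono m)) A z)"
      unfolding opS_def
      \<comment> \<open>Derivatives of order above \<open>m\<close> vanish on the
        \<open>m\<close>-th power, so the series is a finite sum.\<close>
      by (rule suminf_finite) (auto simp: sderiv_smono sprod_scalar_right)
    also have "\<dots> = (\<Sum>l\<le>m. (\<Sum>k\<le>l. of_nat (l choose k) * (- z) ^ (l - k) * H k A z) / fact l *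
           (fact m / fact (m - l) * z ^ (m - l)))"
      unfolding sderiv_smono sprod_scalar_right V_eq by (intro sum.cong) auto
    also have "\<dots> = H m A z" by (rule binomial_inversion)
    finally show ?thesis .
  qed
  then have "opS V (smono m) = H m" by (simp add: fun_eq_iff)
  then show ?thesis by (simp add: opT_def stem_of_ind stem_smono)
qed

text \<open>In each summand \<open>power_le\<close> controls the power of \<open>z\<close> and
  continuity of \<open>T\<close> controls the image of the \<open>k\<close>-th power. Monotonicity
  of \<open>g\<close> replaces \<open>g (l - k)\<close> and \<open>g k\<close> by
  \<open>g l\<close>, so the two powers merge into an \<open>l\<close>-th power, and the binomial
  coefficients add up to \<open>2 ^ l\<close>.\<close>

lemma scoeff_inversion:
  fixes T :: "('n::{finite,linorder} pt \<Rightarrow> 'n clif) \<Rightarrow> 'n pt \<Rightarrow> 'n clif" and V :: "nat \<Rightarrow> 'n stem"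
  assumes T: "\<And>f. f \<in> A_plus0 \<rho>1' \<Longrightarrow> T f \<in> A_plus0 \<rho>2'"
    and bd: "\<And>\<sigma>. \<sigma> > 0 \<Longrightarrow> \<exists>\<epsilon>>0. \<exists>C>0. \<forall>f\<in>A_plus0 \<rho>1'. wnorm \<rho>2' \<sigma> (T f) \<le> C * wnorm \<rho>1' \<epsilon> f"
    and H: "\<And>k. stem (H k)" "\<And>k. ind (H k) = T (ind (smono k))"
    and V_eq: "\<And>l A z. V l A z = (\<Sum>k\<le>l. of_nat (l choose k) * (- z) ^ (l - k) * H k A z) / fact l"
  shows "scoeff V"
  unfolding scoeff_def
proof (intro conjI allI impI)
  show "stem (V l)" for l
    unfolding stem_def V_eq[abs_def] by (auto intro!: holomorphic_intros stem_holo[OF H(1)] simp: stem_cnj[OF H(1)])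
  fix \<sigma> :: real assume \<sigma>: "\<sigma> > 0"
  \<comment> \<open>Half of the exponent is reserved for the power of \<open>z\<close>, half for the
    image under \<open>T\<close>.\<close>
  then have s2: "\<sigma> / 2 > 0" by simp
  obtain \<epsilon> C1 where e: "\<epsilon> > 0" "C1 > 0" and Tb: "\<And>f. f \<in> A_plus0 \<rho>1' \<Longrightarrow> wnorm \<rho>2' (\<sigma> / 2) (T f) \<le> C1 * wnorm \<rho>1' \<epsilon> f"
    using bd[OF s2] by blast
  obtain D1 where D1: "D1 > 0" "\<And>m (A::'n set) z. norm (smono m A z) \<le> (D1 * g m) ^ m * exp (\<epsilon> * (norm z powr \<rho>1' (norm z)))"
    using smono_bound[OF e(1)] by blast
  obtain \<sigma>' where s': "\<sigma>' > 0" "\<And>r. r \<ge> 0 \<Longrightarrow> exp (\<sigma>' * (r powr \<rho>1' r)) \<le> exp (\<sigma> / 2) * exp (\<sigma> / 2 * (r powr \<rho>2' r))"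
    using exp_M1_le_M2[OF s2] by blast
  obtain D2 where D2: "D2 > 0" "\<And>l r. r \<ge> 0 \<Longrightarrow> r ^ l \<le> (D2 * g l) ^ l * exp (\<sigma>' * (r powr \<rho>1' r))"
    using power_le[OF s'(1)] by blast
  obtain K1 where K1: "K1 > 0" "\<And>\<rho> \<sigma> (F :: 'n stem) A z. stem F \<Longrightarrow> ind F \<in> A_space \<rho> \<sigma> \<Longrightarrow>
     norm (F A z) \<le> K1 * wnorm \<rho> \<sigma> (ind F) * exp (\<sigma> * (norm z powr \<rho> (norm z)))"
    using wnorm_stem[where ?'n='n] by blast
  obtain K2 where K2: "K2 > 0" "\<And>\<rho> \<sigma> N (F :: 'n stem). stem F \<Longrightarrow>
     (\<And>A z. norm (F A z) \<le> N * exp (\<sigma> * (norm z powr \<rho> (norm z)))) \<Longrightarrow>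
     ind F \<in> A_space \<rho> \<sigma> \<and> wnorm \<rho> \<sigma> (ind F) \<le> K2 * N"
    using stem_wnorm[where ?'n='n] by blast
  define C where "C = K1 * C1 * K2 * exp (\<sigma> / 2)"
  \<comment> \<open>A common bound for the two rates \<open>D1\<close> and \<open>D2\<close>, so
    that powers with exponents \<open>k\<close> and \<open>l - k\<close> have the same base.\<close>
  define Q where "Q = D1 + D2"
  have Q: "Q > 0" using D1 D2 by (simp add: Q_def)
  have C: "C > 0" using K1 K2 e by (simp add: C_def)
  have Hb: "norm (H k A z) \<le> K1 * C1 * K2 * (D1 * g k) ^ k * exp (\<sigma> / 2 * (norm z powr \<rho>2' (norm z)))" for k A z
  proof -
    have "wnorm \<rho>2' (\<sigma> / 2) (ind (H k)) \<le> C1 * wnorm \<rho>1' \<epsilon> (ind (smono k) :: 'n pt \<Rightarrow> 'n clif)"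
      unfolding H by (rule Tb[OF smono_mem])
    also have "\<dots> \<le> C1 * (K2 * (D1 * g k) ^ k)"
      using K2(2)[OF stem_smono D1(2)] e by (intro mult_left_mono) auto
    finally have w: "wnorm \<rho>2' (\<sigma> / 2) (ind (H k)) \<le> C1 * (K2 * (D1 * g k) ^ k)" .
    have "norm (H k A z) \<le> K1 * wnorm \<rho>2' (\<sigma> / 2) (ind (H k)) * exp (\<sigma> / 2 * (norm z powr \<rho>2' (norm z)))"
      by (rule K1(2)[OF H(1)]) (use A_plus0D[OF T[OF smono_mem] s2] H(2) in simp)
    also have "\<dots> \<le> K1 * (C1 * (K2 * (D1 * g k) ^ k)) * exp (\<sigma> / 2 * (norm z powr \<rho>2' (norm z)))"
      using K1(1) by (intro mult_right_mono mult_left_mono w) auto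
    finally show ?thesis by (simp add: mult_ac)
  qed
  have "norm (V l A z) \<le> C * ((2 * Q) * g l) ^ l / fact l * exp (\<sigma> * (norm z powr \<rho>2' (norm z)))" for l A z
  proof -
    let ?e = "exp (\<sigma> / 2 * (norm z powr \<rho>2' (norm z)))"
    have "norm (of_nat (l choose k) * (- z) ^ (l - k) * H k A z) \<le> of_nat (l choose k) * (C * (Q * g l) ^ l * (?e * ?e))"
      if k: "k \<le> l" for k
    proof -
      have "norm z ^ (l - k) \<le> (D2 * g (l - k)) ^ (l - k) * exp (\<sigma>' * (norm z powr \<rho>1' (norm z)))"
        by (rule D2) simp
      also have "\<dots> \<le> (Q * g l) ^ (l - k) * (exp (\<sigma> / 2) * ?e)"
        using D1(1) D2(1) Q g_pos[of l] g_pos[of "l - k"] g_mono[of "l - k" l]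
        by (intro mult_mono power_mono s') (auto simp: Q_def)
      finally have 1: "norm z ^ (l - k) \<le> (Q * g l) ^ (l - k) * (exp (\<sigma> / 2) * ?e)" .
      have "norm (H k A z) \<le> K1 * C1 * K2 * (D1 * g k) ^ k * ?e" by (rule Hb)
      also have "\<dots> \<le> K1 * C1 * K2 * (Q * g l) ^ k * ?e"
        using D1(1) D2(1) Q g_pos[of l] g_pos[of k] g_mono[OF k] K1(1) K2(1) e(2)
        by (intro mult_right_mono mult_left_mono power_mono mult_mono) (auto simp: Q_def)
      finally have 2: "norm (H k A z) \<le> K1 * C1 * K2 * (Q * g l) ^ k * ?e" .
      have "norm z ^ (l - k) * norm (H k A z) \<le> ((Q * g l) ^ (l - k) * (exp (\<sigma> / 2) * ?e)) * (K1 * C1 * K2 * (Q * g l) ^ k * ?e)"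
        using Q g_pos[of l] by (intro mult_mono 1 2) auto
      also have "\<dots> = C * ((Q * g l) ^ (l - k) * (Q * g l) ^ k) * (?e * ?e)"
        by (simp add: C_def)
      also have "(Q * g l) ^ (l - k) * (Q * g l) ^ k = (Q * g l) ^ l"
        using k by (simp flip: power_add)
      finally show ?thesis
        by (simp add: norm_mult norm_power mult.assoc mult_left_mono)
    qed
    then have "norm (\<Sum>k\<le>l. of_nat (l choose k) * (- z) ^ (l - k) * H k A z)
        \<le> (\<Sum>k\<le>l. of_nat (l choose k) * (C * (Q * g l) ^ l * (?e * ?e)))"
      by (intro sum_norm_le) auto
    also have "\<dots> = real (\<Sum>k\<le>l. l choose k) * (C * (Q * g l) ^ l * (?e * ?e))"
      by (simp add: sum_distrib_right)
    also have "\<dots> = C * ((2 * Q) * g l) ^ l * exp (\<sigma> * (norm z powr \<rho>2' (norm z)))"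
      by (simp add: choose_row_sum power_mult_distrib flip: exp_add)
    finally show ?thesis unfolding V_eq by (simp add: norm_divide divide_right_mono)
  qed
  then show "\<exists>\<eta>>0. \<exists>C>0. \<forall>l A z. norm (V l A z) \<le> C * (\<eta> * g l) ^ l / fact l * exp (\<sigma> * (norm z powr \<rho>2' (norm z)))"
    using C Q by (intro exI[of _ "2 * Q"] conjI exI[of _ C]) auto
qed

lemma operator_representation:
  fixes T :: "('n::{finite,linorder} pt \<Rightarrow> 'n clif) \<Rightarrow> 'n pt \<Rightarrow> 'n clif"
  assumes cont: "continuous_map (A_top \<rho>1') (A_top \<rho>2') T" and lin: "right_linear_on (A_plus0 \<rho>1') T"
  shows "\<exists>V. scoeff V \<and> (\<forall>f\<in>A_plus0 \<rho>1'. opT V f = T f)"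
proof -
  have T: "T f \<in> A_plus0 \<rho>2'" if "f \<in> A_plus0 \<rho>1'" for f
    using cont that by (auto simp: continuous_map_def topspace_A_top)
  note bd = continuous_map_A_topD[OF cont lin]
  define H where "H k = stem_of (T (ind (smono k)))" for k
  have H: "stem (H k)" "ind (H k) = T (ind (smono k))" for k
    using stem_of[OF A_plus0_slice[OF T[OF smono_mem]]] by (simp_all add: H_def)
  define V where "V l A z = (\<Sum>k\<le>l. of_nat (l choose k) * (- z) ^ (l - k) * H k A z) / fact l" for l A z
  have V: "scoeff V" by (rule scoeff_inversion[OF T bd H V_def])
  have "opT V f = T f" if f: "f \<in> A_plus0 \<rho>1'" for f
  proof (rule right_linear_eq[OF opT_right_linear[OF V] lin opT_mem[OF V] T _ bd _ f])
    show "\<exists>\<epsilon>>0. \<exists>C>0. \<forall>f\<in>A_plus0 \<rho>1'. wnorm \<rho>2' 1 (opT V f) \<le> C * wnorm \<rho>1' \<epsilon> f"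
      using opT_bound[OF V zero_less_one] by blast
    show "opT V (ind (smono m)) = T (ind (smono m))" for m
      by (simp add: opT_smono[OF V V_def] H)
  qed auto
  with V show ?thesis by blast
qed

end

theorem theorem4p4:
  fixes \<rho>1' \<rho>2' \<rho>h1 :: "real \<Rightarrow> real" and \<rho>1 \<rho>2 :: real
  assumes "proximate_order \<rho>1' \<rho>1" and "proximate_order \<rho>2' \<rho>2"
    and "(\<lambda>r. r powr \<rho>1' r) \<in> O(\<lambda>r. r powr \<rho>2' r)"
    and "normalized_proximate_order \<rho>h1 \<rho>1"
    and "\<forall>\<^sub>F r in at_top. \<rho>h1 r = \<rho>1' r"
  shows "(\<forall>u :: nat \<Rightarrow> 'n::{finite,linorder} pt \<Rightarrow> 'n clif.
            (\<forall>l. slice_monogenic (u l)) \<and> coeff_cond \<rho>2' \<rho>h1 \<rho>1 u \<longrightarrow>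
            (\<exists>T. (\<forall>f\<in>A_plus0 \<rho>1'. limitin (A_top \<rho>2') (partial_series u f) (T f) sequentially) \<and>
                 continuous_map (A_top \<rho>1') (A_top \<rho>2') T))
       \<and> (\<forall>T :: ('n pt \<Rightarrow> 'n clif) \<Rightarrow> ('n pt \<Rightarrow> 'n clif).
            continuous_map (A_top \<rho>1') (A_top \<rho>2') T \<and> right_linear_on (A_plus0 \<rho>1') T \<longrightarrow>
            (\<exists>u. (\<forall>l. slice_monogenic (u l)) \<and> coeff_cond \<rho>2' \<rho>h1 \<rho>1 u \<and>
                 (\<forall>f\<in>A_plus0 \<rho>1'. limitin (A_top \<rho>2') (partial_series u f) (T f) sequentially)))"
proof -
  define g where "g = (\<lambda>l. prox_inv \<rho>h1 (real (max 1 l)))"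
  define E where "E = (exp 1 * \<rho>1) powr (1 / \<rho>1)"
  have rho: "\<rho>1 > 0" using assms(1) by (simp add: proximate_order_def)
  have E: "E > 0" using rho by (simp add: E_def)
  have G: "Gseq \<rho>h1 \<rho>1 l = (g l / E) ^ l" for l
    unfolding g_def E_def by (rule Gseq_eq[OF rho])
  interpret weights \<rho>1' \<rho>2' g
    unfolding weights_def g_def by (rule growth_proximate[OF assms])
  show ?thesis
  proof (intro conjI allI impI)
    fix u :: "nat \<Rightarrow> 'n pt \<Rightarrow> 'n clif"
    assume u: "(\<forall>l. slice_monogenic (u l)) \<and> coeff_cond \<rho>2' \<rho>h1 \<rho>1 u"
    define U where "U l = stem_of (u l)" for l
    have U: "stem (U l)" and ind_U: "ind (U l) = u l" for l
      using u stem_of by (auto simp: U_def)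
    have sU: "scoeff U"
      using u coeff_cond_iff[OF U G E] by (simp add: ind_U)
    show "\<exists>T. (\<forall>f\<in>A_plus0 \<rho>1'. limitin (A_top \<rho>2') (partial_series u f) (T f) sequentially) \<and>
                 continuous_map (A_top \<rho>1') (A_top \<rho>2') T"
      using opT_limit[OF sU] opT_continuous[OF sU] by (intro exI[of _ "opT U"]) (simp add: ind_U)
  next
    fix T :: "('n pt \<Rightarrow> 'n clif) \<Rightarrow> ('n pt \<Rightarrow> 'n clif)"
    assume "continuous_map (A_top \<rho>1') (A_top \<rho>2') T \<and> right_linear_on (A_plus0 \<rho>1') T"
    then obtain V where V: "scoeff V" "\<And>f. f \<in> A_plus0 \<rho>1' \<Longrightarrow> opT V f = T f"
      using operator_representation by blast
    have stV: "stem (V l)" for l using V(1) by (simp add: scoeff_def)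
    show "\<exists>u. (\<forall>l. slice_monogenic (u l)) \<and> coeff_cond \<rho>2' \<rho>h1 \<rho>1 u \<and>
                 (\<forall>f\<in>A_plus0 \<rho>1'. limitin (A_top \<rho>2') (partial_series u f) (T f) sequentially)"
      using opT_limit[OF V(1)] coeff_cond_iff[OF stV G E] V
      by (intro exI[of _ "\<lambda>l. ind (V l)"]) (simp add: slice_monogenic_ind stV)
  qed
qed

end
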